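(* Let $\theta\in H^\infty$ be inner, let $\phi,\psi\in L^\infty$ be unimodular with $\overline\psi\phi=A_-\overline\theta+A_+\theta$ for some $A_+\in H^\infty$, $A_-\in\overline{H^\infty}$, such that neither $\phi\overline\psi$ nor $\overline\phi\psi$ is a constant multiple of $\theta$, and let $M=\phi K_\theta\oplus\psi K_\theta$. Put $$\Delta_\lambda:=\theta(\lambda)^2-\overline{A_+(0)}\;\overline{\overline{A_-}(0)}\,\bigl(1-\overline{\theta(0)}\theta(\lambda)\bigr)^2\quad(\lambda\in\mathbb D\cup\mathbb T_{\mathrm{ADC}}),$$ $$\widetilde{\Delta_\lambda}:=1-\overline{A_+(0)}\;\overline{\overline{A_-}(0)}\,\bigl(\overline{\theta(0)}-\overline{\theta(1/\overline\lambda)}\bigr)^2\quad(\lambda\in\mathbb D^-).$$ Then for the dual-band shift $T^M_z$: (i) $\lambda\in\sigma(T^M_z)$ if and only if one of the following holds: $\lambda\in\mathbb D$ and $\Delta_\lambda=0$; or $\lambda\in\mathbb D^-$ and $\widetilde{\Delta_\lambda}=0$; or $\lambda\in\mathbb T\cap\sigma(\theta)$; or $\lambda\in\mathbb T_{\mathrm{ADC}}\setminus\sigma(\theta)$ and $\Delta_\lambda=0$. (ii) The point, continuous and residual spectra are $$\sigma_p(T^M_z)=\{\lambda\in\mathbb D:\Delta_\lambda=0\}\cup\{\lambda\in\mathbb D^-:\widetilde{\Delta_\lambda}=0\}\cup\{\lambda\in\mathbb T_{\mathrm{ADC}}:\Delta_\lambda=0\},$$ $$\sigma_c(T^M_z)=(\mathbb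 T\setminus\mathbb T_{\mathrm{ADC}})\cup\{\lambda\in\mathbb T_{\mathrm{ADC}}\cap\sigma(\theta):\Delta_\lambda\ne0\},$$ $$\sigma_r(T^M_z)=\emptyset.$$
   Context: All function spaces are on the unit circle $\mathbb T$; $H^2,H^\infty$ are the Hardy spaces of the unit disc $\mathbb D$; $\mathbb D^-=\{z\in\mathbb C:|z|>1\}$. $\overline{H^\infty}$ is the set of complex conjugates of functions in $H^\infty$; for $A_-\in\overline{H^\infty}$, $\overline{A_-}\in H^\infty$ and $\overline{A_-}(0)$ is the value at $0$ of its analytic extension to $\mathbb D$. For $\theta$ inner, $K_\theta=H^2\ominus\theta H^2$. The condition $\overline\psi\phi=A_-\overline\theta+A_+\theta$ implies $\phi K_\theta\perp\psi K_\theta$, and $M=\phi K_\theta\oplus\psi K_\theta$ is a closed subspace of $L^2=L^2(\mathbb T)$ with orthogonal projection $P_M$. The dual-band shift is $T^M_zf=P_M(zf)$ for $f\in M$. An inner function $\theta$ has an angular derivative in the sense of Carathéodory (ADC) at $\lambda\in\mathbb T$ if the nontangential limit $\theta(\lambda)$ of $\theta(z)$ as $z\to\lambda$ exists with $|\theta(\lambda)|=1$ and $\frac{\theta(z)-\theta(\lambda)}{z-\lambda}$ has a (finite) nontangential limit at $\lambda$; $\mathbb T_{\mathrm{ADC}}$ is the set of such $\lambda\in\mathbb T$, and for these $\theta(\lambda)$ denotes the nontangential limit. $\sigma(\theta)=\{\lambda\in\mathbb T:\liminf_{z\to\lambda,\,z\in\mathbb D}|\theta(z)|=0\}$. For a bounded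 operator $T$: $\sigma_p(T)$ is the set of eigenvalues; $\sigma_c(T)$ is the set of $\lambda$ for which $T-\lambda I$ is injective with dense range but not surjective; $\sigma_r(T)$ is the set of $\lambda$ for which $T-\lambda I$ is injective with non-dense range. *)

theory Defs
  imports "HOL-Analysis.Analysis"
begin

section \<open>Function spaces on the unit circle\<close>

text \<open>
  Normalised arc length on the unit circle, as a Borel measure on the complex plane that is
  carried by the circle.  A function on the circle is represented by a Borel function on the
  plane, whose values off the circle are irrelevant up to null sets.
\<close>

definition circle_measure :: "complex measure" where
  "circle_measure = distr (uniform_measure lborel {0..2 * pi}) borel cis"

lemma sets_circle_measure [simp, measurable_cong]: "sets circle_measure = sets borel"
  by (simp add: circle_measure_def)

lemma space_circle_measure [simp]: "space circle_measure = UNIV"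
  by (simp add: circle_measure_def)

definition L2_fun :: "(complex \<Rightarrow> complex) set" where
  "L2_fun = {f \<in> borel_measurable circle_measure.
               integrable circle_measure (\<lambda>z. (norm (f z))\<^sup>2)}"

definition Linf_fun :: "(complex \<Rightarrow> complex) set" where
  "Linf_fun = {f \<in> borel_measurable circle_measure.
                 \<exists>C. AE z in circle_measure. norm (f z) \<le> C}"

lemma borel_measurable_cnj [measurable (raw)]:
  "f \<in> borel_measurable M \<Longrightarrow> (\<lambda>x. cnj (f x)) \<in> borel_measurable M"
  by (rule borel_measurable_continuous_on[where f = cnj]) (auto intro: continuous_intros)

lemma L2_fun_measurable: "f \<in> L2_fun \<Longrightarrow> f \<in> borel_measurable circle_measure"
  by (simp add: L2_fun_def)

lemma L2_fun_integrable:
  "f \<in> L2_fun \<Longrightarrow> integrable circle_measure (\<lambda>z. (norm (f z))\<^sup>2)"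
  by (simp add: L2_fun_def)

lemma L2_fun_zero: "(\<lambda>_. 0) \<in> L2_fun"
  by (simp add: L2_fun_def)

lemma L2_fun_add:
  assumes "f \<in> L2_fun" "g \<in> L2_fun"
  shows "(\<lambda>z. f z + g z) \<in> L2_fun"
proof -
  note [measurable] = assms[THEN L2_fun_measurable]
  have bound: "(norm (a + b))\<^sup>2 \<le> 2 * (norm a)\<^sup>2 + 2 * (norm b)\<^sup>2" for a b :: complex
  proof -
    have "(norm (a + b))\<^sup>2 \<le> (norm a + norm b)\<^sup>2"
      by (intro power_mono norm_triangle_ineq) simp
    also have "\<dots> \<le> 2 * (norm a)\<^sup>2 + 2 * (norm b)\<^sup>2"
      using zero_le_power2[of "norm a - norm b"] by (simp add: power2_eq_square algebra_simps)
    finally show ?thesis .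
  qed
  have "integrable circle_measure (\<lambda>z. (norm (f z + g z))\<^sup>2)"
  proof (rule Bochner_Integration.integrable_bound)
    show "integrable circle_measure (\<lambda>z. 2 * (norm (f z))\<^sup>2 + 2 * (norm (g z))\<^sup>2)"
      using assms[THEN L2_fun_integrable] by simp
    show "(\<lambda>z. (norm (f z + g z))\<^sup>2) \<in> borel_measurable circle_measure" by measurable
    show "AE z in circle_measure. norm ((norm (f z + g z))\<^sup>2)
            \<le> norm (2 * (norm (f z))\<^sup>2 + 2 * (norm (g z))\<^sup>2)"
      using bound by (auto intro!: AE_I2)
  qed
  then show ?thesis by (simp add: L2_fun_def)
qed

lemma L2_fun_mult:
  assumes "f \<in> Linf_fun" "g \<in> L2_fun"
  shows "(\<lambda>z. f z * g z) \<in> L2_fun"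
proof -
  have [measurable]: "f \<in> borel_measurable circle_measure" "g \<in> borel_measurable circle_measure"
    using assms by (simp_all add: Linf_fun_def L2_fun_def)
  obtain C where C: "AE z in circle_measure. norm (f z) \<le> C"
    using assms by (auto simp: Linf_fun_def)
  have "integrable circle_measure (\<lambda>z. (norm (f z * g z))\<^sup>2)"
  proof (rule Bochner_Integration.integrable_bound)
    show "integrable circle_measure (\<lambda>z. C\<^sup>2 * (norm (g z))\<^sup>2)"
      using assms(2)[THEN L2_fun_integrable] by simp
    show "(\<lambda>z. (norm (f z * g z))\<^sup>2) \<in> borel_measurable circle_measure" by measurable
    show "AE z in circle_measure. norm ((norm (f z * g z))\<^sup>2) \<le> norm (C\<^sup>2 * (norm (g z))\<^sup>2)"
      using C by eventually_elim
        (auto simp: norm_mult power_mult_distrib intro!: mult_right_mono power_mono)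
  qed
  then show ?thesis by (simp add: L2_fun_def)
qed

lemma Linf_fun_const: "(\<lambda>_. c) \<in> Linf_fun"
  by (auto simp: Linf_fun_def)

lemma L2_fun_scale: "f \<in> L2_fun \<Longrightarrow> (\<lambda>z. c * f z) \<in> L2_fun"
  using L2_fun_mult[OF Linf_fun_const] .

lemma L2_fun_uminus: "f \<in> L2_fun \<Longrightarrow> (\<lambda>z. - f z) \<in> L2_fun"
  using L2_fun_scale[of f "-1"] by simp

lemma L2_fun_diff: "f \<in> L2_fun \<Longrightarrow> g \<in> L2_fun \<Longrightarrow> (\<lambda>z. f z - g z) \<in> L2_fun"
  using L2_fun_add[OF _ L2_fun_uminus, of f g] by simp

lemma L2_fun_integrable_mult_cnj:
  assumes "f \<in> L2_fun" "g \<in> L2_fun"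
  shows "integrable circle_measure (\<lambda>z. f z * cnj (g z))"
proof (rule Bochner_Integration.integrable_bound)
  note [measurable] = assms[THEN L2_fun_measurable]
  show "integrable circle_measure (\<lambda>z. (norm (f z))\<^sup>2 + (norm (g z))\<^sup>2)"
    using assms[THEN L2_fun_integrable] by simp
  show "(\<lambda>z. f z * cnj (g z)) \<in> borel_measurable circle_measure" by measurable
  have "norm a * norm b \<le> (norm a)\<^sup>2 + (norm b)\<^sup>2" for a b :: complex
  proof -
    have "2 * (norm a * norm b) \<le> (norm a)\<^sup>2 + (norm b)\<^sup>2"
      using sum_squares_bound[of "norm a" "norm b"] by (simp only: mult.assoc)
    moreover have "0 \<le> norm a * norm b" by simp
    ultimately show ?thesis by linarith
  qed
  then show "AE z in circle_measure. norm (f z * cnj (g z))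
               \<le> norm ((norm (f z))\<^sup>2 + (norm (g z))\<^sup>2)"
    by (auto intro!: AE_I2 simp: norm_mult)
qed

subsection \<open>The Hilbert space \<open>L\<^sup>2\<close> of the circle\<close>

definition L2_rel :: "(complex \<Rightarrow> complex) \<Rightarrow> (complex \<Rightarrow> complex) \<Rightarrow> bool" where
  "L2_rel f g \<longleftrightarrow> f \<in> L2_fun \<and> g \<in> L2_fun \<and> (AE z in circle_measure. f z = g z)"

lemma part_equivp_L2_rel: "part_equivp L2_rel"
proof (rule part_equivpI)
  show "\<exists>f. L2_rel f f"
    using L2_fun_zero by (auto simp: L2_rel_def)
  show "symp L2_rel"
  proof (rule sympI)
    fix f g assume fg: "L2_rel f g"
    have "AE z in circle_measure. f z = g z" using fg by (simp add: L2_rel_def)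
    then have "AE z in circle_measure. g z = f z" by eventually_elim simp
    then show "L2_rel g f" using fg by (simp add: L2_rel_def)
  qed
  show "transp L2_rel"
  proof (rule transpI)
    fix f g h assume fg: "L2_rel f g" and gh: "L2_rel g h"
    have "AE z in circle_measure. f z = g z" "AE z in circle_measure. g z = h z"
      using fg gh by (auto simp: L2_rel_def)
    then have "AE z in circle_measure. f z = h z" by eventually_elim simp
    then show "L2_rel f h" using fg gh by (simp add: L2_rel_def)
  qed
qed

quotient_type L2_circle = "complex \<Rightarrow> complex" / partial: L2_rel
  by (rule part_equivp_L2_rel)

lift_definition cinner_L2 :: "L2_circle \<Rightarrow> L2_circle \<Rightarrow> complex" is
  "\<lambda>f g. LINT z|circle_measure. f z * cnj (g z)"
proof -
  fix f f' g g' assume "L2_rel f f'" "L2_rel g g'"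
  then show "(LINT z|circle_measure. f z * cnj (g z)) = (LINT z|circle_measure. f' z * cnj (g' z))"
    by (intro integral_cong_AE) (auto simp: L2_rel_def L2_fun_def)
qed

lift_definition scaleC_L2 :: "complex \<Rightarrow> L2_circle \<Rightarrow> L2_circle" (infixr "*\<^sub>C" 75) is
  "\<lambda>c f z. c * f z"
  by (auto simp: L2_rel_def L2_fun_scale)

text \<open>
  Multiplication by an essentially bounded function.  For \<open>u\<close> outside \<open>L\<^sup>\<infinity>\<close> the result is set
  to zero only to make the operation total.
\<close>

lift_definition mult_L2 :: "(complex \<Rightarrow> complex) \<Rightarrow> L2_circle \<Rightarrow> L2_circle" is
  "\<lambda>u f z. if u \<in> Linf_fun then u z * f z else 0"
proof -
  fix u f g assume fg: "L2_rel f g"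
  show "L2_rel (\<lambda>z. if u \<in> Linf_fun then u z * f z else 0)
               (\<lambda>z. if u \<in> Linf_fun then u z * g z else 0)"
  proof (cases "u \<in> Linf_fun")
    case True
    then show ?thesis using fg by (auto simp: L2_rel_def L2_fun_mult)
  next
    case False
    then show ?thesis using L2_fun_zero by (auto simp: L2_rel_def)
  qed
qed

instantiation L2_circle :: real_vector
begin

lift_definition zero_L2_circle :: L2_circle is "\<lambda>_. 0"
  by (simp add: L2_rel_def L2_fun_zero)

lift_definition plus_L2_circle :: "L2_circle \<Rightarrow> L2_circle \<Rightarrow> L2_circle" is "\<lambda>f g z. f z + g z"
  by (auto simp: L2_rel_def L2_fun_add)

lift_definition uminus_L2_circle :: "L2_circle \<Rightarrow> L2_circle" is "\<lambda>f z. - f z"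
  by (auto simp: L2_rel_def L2_fun_uminus)

lift_definition minus_L2_circle :: "L2_circle \<Rightarrow> L2_circle \<Rightarrow> L2_circle" is "\<lambda>f g z. f z - g z"
  by (auto simp: L2_rel_def L2_fun_diff)

definition scaleR_L2_circle :: "real \<Rightarrow> L2_circle \<Rightarrow> L2_circle" where
  "scaleR_L2_circle r f = of_real r *\<^sub>C f"

instance
proof
  fix a b c :: L2_circle and r s :: real
  show "a + b + c = a + (b + c)"
    by transfer (auto simp: L2_rel_def add.assoc intro!: L2_fun_add)
  show "a + b = b + a"
    by transfer (auto simp: L2_rel_def add.commute intro!: L2_fun_add)
  show "0 + a = a"
    by transfer (auto simp: L2_rel_def)
  show "- a + a = 0"
    by transfer (auto simp: L2_rel_def L2_fun_zero)
  show "a - b = a + - b"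
    by transfer (auto simp: L2_rel_def intro!: L2_fun_diff)
  show "r *\<^sub>R (a + b) = r *\<^sub>R a + r *\<^sub>R b"
    unfolding scaleR_L2_circle_def
    by transfer (auto simp: L2_rel_def distrib_left intro!: L2_fun_add L2_fun_scale)
  show "(r + s) *\<^sub>R a = r *\<^sub>R a + s *\<^sub>R a"
    unfolding scaleR_L2_circle_def
    by transfer (auto simp: L2_rel_def distrib_right intro!: L2_fun_add L2_fun_scale)
  show "r *\<^sub>R s *\<^sub>R a = (r * s) *\<^sub>R a"
    unfolding scaleR_L2_circle_def
    by transfer (auto simp: L2_rel_def mult.assoc intro!: L2_fun_scale)
  show "1 *\<^sub>R a = a"
    unfolding scaleR_L2_circle_def
    by transfer (auto simp: L2_rel_def)
qed

end

lemma cinner_L2_commute: "cinner_L2 f g = cnj (cinner_L2 g f)"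
proof transfer
  fix f g
  have "cnj (LINT z|circle_measure. g z * cnj (f z)) = (LINT z|circle_measure. cnj (g z * cnj (f z)))"
    by (rule Bochner_Integration.integral_cnj [symmetric])
  then show "(LINT z|circle_measure. f z * cnj (g z)) = cnj (LINT z|circle_measure. g z * cnj (f z))"
    by (simp add: mult.commute)
qed

lemma cinner_L2_add_left: "cinner_L2 (f + g) h = cinner_L2 f h + cinner_L2 g h"
  by transfer
    (simp add: L2_rel_def distrib_right L2_fun_integrable_mult_cnj)

lemma cinner_L2_scaleC_left: "cinner_L2 (c *\<^sub>C f) g = c * cinner_L2 f g"
  by transfer (simp add: mult.assoc)

lemma cinner_L2_self:
  "\<exists>r\<ge>0. cinner_L2 f f = of_real r \<and> (r = 0 \<longleftrightarrow> f = 0)"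
proof transfer
  fix f assume "L2_rel f f"
  then have f: "f \<in> L2_fun" by (simp add: L2_rel_def)
  note [measurable] = L2_fun_measurable[OF f]
  let ?r = "LINT z|circle_measure. (norm (f z))\<^sup>2"
  have "(LINT z|circle_measure. f z * cnj (f z)) = of_real ?r"
    unfolding complex_norm_square [symmetric] by (rule integral_complex_of_real)
  moreover have "?r \<ge> 0" by simp
  moreover have "?r = 0 \<longleftrightarrow> (AE z in circle_measure. f z = 0)"
    using L2_fun_integrable[OF f] by (simp add: integral_nonneg_eq_0_iff_AE)
  ultimately show "\<exists>r\<ge>0. (LINT z|circle_measure. f z * cnj (f z)) = of_real r \<and>
                      (r = 0 \<longleftrightarrow> L2_rel f (\<lambda>_. 0))"
    using f L2_fun_zero by (auto simp: L2_rel_def)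
qed

instantiation L2_circle :: real_inner
begin

definition inner_L2_circle :: "L2_circle \<Rightarrow> L2_circle \<Rightarrow> real" where
  "inner_L2_circle f g = Re (cinner_L2 f g)"

definition norm_L2_circle :: "L2_circle \<Rightarrow> real" where
  "norm_L2_circle f = sqrt (Re (cinner_L2 f f))"

definition dist_L2_circle :: "L2_circle \<Rightarrow> L2_circle \<Rightarrow> real" where
  "dist_L2_circle f g = norm (f - g)"

definition sgn_L2_circle :: "L2_circle \<Rightarrow> L2_circle" where
  "sgn_L2_circle f = f /\<^sub>R norm f"

definition uniformity_L2_circle :: "(L2_circle \<times> L2_circle) filter" where
  "uniformity_L2_circle = (INF e\<in>{0<..}. principal {(f, g). dist f g < e})"

definition open_L2_circle :: "L2_circle set \<Rightarrow> bool" where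
  "open_L2_circle U \<longleftrightarrow> (\<forall>f\<in>U. \<forall>\<^sub>F (f', g) in uniformity. f' = f \<longrightarrow> g \<in> U)"

instance
proof
  fix f g h :: L2_circle and r :: real and U :: "L2_circle set"
  show "dist f g = norm (f - g)" by (rule dist_L2_circle_def)
  show "sgn f = f /\<^sub>R norm f" by (rule sgn_L2_circle_def)
  show "(uniformity :: (L2_circle \<times> L2_circle) filter)
          = (INF e\<in>{0<..}. principal {(f, g). dist f g < e})"
    by (rule uniformity_L2_circle_def)
  show "open U \<longleftrightarrow> (\<forall>f\<in>U. \<forall>\<^sub>F (f', g) in uniformity. f' = f \<longrightarrow> g \<in> U)"
    by (rule open_L2_circle_def)
  show "inner f g = inner g f"
    unfolding inner_L2_circle_def by (subst cinner_L2_commute) simp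
  show "inner (f + g) h = inner f h + inner g h"
    by (simp add: inner_L2_circle_def cinner_L2_add_left)
  show "inner (r *\<^sub>R f) g = r * inner f g"
    by (simp add: inner_L2_circle_def scaleR_L2_circle_def cinner_L2_scaleC_left)
  show "0 \<le> inner f f" "inner f f = 0 \<longleftrightarrow> f = 0"
    using cinner_L2_self[of f] by (auto simp: inner_L2_circle_def)
  show "norm f = sqrt (inner f f)"
    by (simp add: norm_L2_circle_def inner_L2_circle_def)
qed

end

subsection \<open>Hardy spaces and inner functions\<close>

definition fourier_coeff :: "(complex \<Rightarrow> complex) \<Rightarrow> int \<Rightarrow> complex" where
  "fourier_coeff f n = (LINT z|circle_measure. f z * cnj (z powi n))"

lemma borel_measurable_powi [measurable]:
  "(\<lambda>z::complex. z powi n) \<in> borel_measurable borel"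
  unfolding power_int_def by (cases "n \<ge> 0") auto

lift_definition fourier_coeff_L2 :: "L2_circle \<Rightarrow> int \<Rightarrow> complex" is fourier_coeff
proof (rule ext)
  fix f g n assume "L2_rel f g"
  then show "fourier_coeff f n = fourier_coeff g n"
    unfolding fourier_coeff_def
    by (intro integral_cong_AE) (auto simp: L2_rel_def L2_fun_def)
qed

definition Hardy2 :: "L2_circle set" where
  "Hardy2 = {f. \<forall>n<0. fourier_coeff_L2 f n = 0}"

definition Hinf :: "(complex \<Rightarrow> complex) set" where
  "Hinf = {f \<in> Linf_fun. \<forall>n<0. fourier_coeff f n = 0}"

text \<open>The analytic extension to the open unit disc of a boundary function in \<open>H\<^sup>\<infinity>\<close>.\<close>

definition disc_ext :: "(complex \<Rightarrow> complex) \<Rightarrow> complex \<Rightarrow> complex" where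
  "disc_ext f z = (\<Sum>n. fourier_coeff f (int n) * z ^ n)"

definition unimodular :: "(complex \<Rightarrow> complex) \<Rightarrow> bool" where
  "unimodular u \<longleftrightarrow> u \<in> Linf_fun \<and> (AE z in circle_measure. norm (u z) = 1)"

definition inner_fun :: "(complex \<Rightarrow> complex) \<Rightarrow> bool" where
  "inner_fun \<theta> \<longleftrightarrow> \<theta> \<in> Hinf \<and> unimodular \<theta>"

definition model_space :: "(complex \<Rightarrow> complex) \<Rightarrow> L2_circle set" where
  "model_space \<theta> = {f \<in> Hardy2. \<forall>g\<in>Hardy2. cinner_L2 f (mult_L2 \<theta> g) = 0}"

subsection \<open>Boundary behaviour of inner functions\<close>

definition Stolz_region :: "complex \<Rightarrow> real \<Rightarrow> complex set" where
  "Stolz_region \<zeta> \<alpha> = {z \<in> ball 0 1. norm (z - \<zeta>) < \<alpha> * (1 - norm z)}"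

definition nontangential_limit ::
    "(complex \<Rightarrow> complex) \<Rightarrow> complex \<Rightarrow> complex \<Rightarrow> bool" where
  "nontangential_limit F \<zeta> L \<longleftrightarrow> (\<forall>\<alpha>>1. (F \<longlongrightarrow> L) (at \<zeta> within Stolz_region \<zeta> \<alpha>))"

definition T_ADC :: "(complex \<Rightarrow> complex) \<Rightarrow> complex set" where
  "T_ADC \<theta> = {\<zeta> \<in> sphere 0 1.
     \<exists>w. nontangential_limit (disc_ext \<theta>) \<zeta> w \<and> norm w = 1 \<and>
         (\<exists>d. nontangential_limit (\<lambda>z. (disc_ext \<theta> z - w) / (z - \<zeta>)) \<zeta> d)}"

text \<open>
  The value \<open>\<theta>(\<zeta>)\<close>: the analytic extension at points of the open disc, the nontangential limit
  at points of the circle.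
\<close>

definition inner_value :: "(complex \<Rightarrow> complex) \<Rightarrow> complex \<Rightarrow> complex" where
  "inner_value \<theta> \<zeta> =
     (if norm \<zeta> < 1 then disc_ext \<theta> \<zeta> else (THE w. nontangential_limit (disc_ext \<theta>) \<zeta> w))"

definition inner_spectrum :: "(complex \<Rightarrow> complex) \<Rightarrow> complex set" where
  "inner_spectrum \<theta> =
     {\<zeta> \<in> sphere 0 1. Liminf (at \<zeta> within ball 0 1) (\<lambda>z. ereal (norm (disc_ext \<theta> z))) = 0}"

section \<open>Spectra of operators on a subspace of \<open>L\<^sup>2\<close>\<close>

text \<open>
  An operator on a closed subspace \<open>M\<close> is given by a function on the whole of \<open>L\<^sup>2\<close> of which only
  the restriction to \<open>M\<close> matters.  A point is outside the spectrum iff \<open>T - \<mu>I\<close> is a bijection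
  of \<open>M\<close> with bounded inverse.
\<close>

definition op_spectrum :: "L2_circle set \<Rightarrow> (L2_circle \<Rightarrow> L2_circle) \<Rightarrow> complex set" where
  "op_spectrum M T =
     {\<mu>. \<not> (bij_betw (\<lambda>f. T f - \<mu> *\<^sub>C f) M M \<and>
            (\<exists>C. \<forall>f\<in>M. norm f \<le> C * norm (T f - \<mu> *\<^sub>C f)))}"

definition point_spectrum :: "L2_circle set \<Rightarrow> (L2_circle \<Rightarrow> L2_circle) \<Rightarrow> complex set" where
  "point_spectrum M T = {\<mu>. \<exists>f\<in>M. f \<noteq> 0 \<and> T f = \<mu> *\<^sub>C f}"

definition continuous_spectrum :: "L2_circle set \<Rightarrow> (L2_circle \<Rightarrow> L2_circle) \<Rightarrow> complex set" where
  "continuous_spectrum M T =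
     {\<mu>. inj_on (\<lambda>f. T f - \<mu> *\<^sub>C f) M \<and>
         M \<subseteq> closure ((\<lambda>f. T f - \<mu> *\<^sub>C f) ` M) \<and>
         (\<lambda>f. T f - \<mu> *\<^sub>C f) ` M \<noteq> M}"

definition residual_spectrum :: "L2_circle set \<Rightarrow> (L2_circle \<Rightarrow> L2_circle) \<Rightarrow> complex set" where
  "residual_spectrum M T =
     {\<mu>. inj_on (\<lambda>f. T f - \<mu> *\<^sub>C f) M \<and>
         \<not> M \<subseteq> closure ((\<lambda>f. T f - \<mu> *\<^sub>C f) ` M)}"

section \<open>Dual-band shifts\<close>

definition dual_band_space ::
    "(complex \<Rightarrow> complex) \<Rightarrow> (complex \<Rightarrow> complex) \<Rightarrow> (complex \<Rightarrow> complex) \<Rightarrow> L2_circle set" where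
  "dual_band_space \<phi> \<psi> \<theta> =
     {mult_L2 \<phi> f + mult_L2 \<psi> g | f g. f \<in> model_space \<theta> \<and> g \<in> model_space \<theta>}"

definition orth_proj :: "L2_circle set \<Rightarrow> L2_circle \<Rightarrow> L2_circle" where
  "orth_proj M f = (THE g. g \<in> M \<and> (\<forall>h\<in>M. cinner_L2 (f - g) h = 0))"

definition compressed_shift :: "L2_circle set \<Rightarrow> L2_circle \<Rightarrow> L2_circle" where
  "compressed_shift M f = orth_proj M (mult_L2 (\<lambda>z. z) f)"

text \<open>
  The functions \<open>Ap\<close> and \<open>Am\<close> are \<open>A\<^sub>+\<close> and \<open>A\<^sub>-\<close>; the latter is the conjugate of a function
  in \<open>H\<^sup>\<infinity>\<close>, and it is that conjugate which is extended to the disc.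
\<close>

definition Delta ::
    "(complex \<Rightarrow> complex) \<Rightarrow> (complex \<Rightarrow> complex) \<Rightarrow> (complex \<Rightarrow> complex) \<Rightarrow> complex \<Rightarrow> complex" where
  "Delta \<theta> Ap Am \<zeta> =
     (inner_value \<theta> \<zeta>)\<^sup>2 - cnj (disc_ext Ap 0) * cnj (disc_ext (\<lambda>z. cnj (Am z)) 0)
       * (1 - cnj (disc_ext \<theta> 0) * inner_value \<theta> \<zeta>)\<^sup>2"

definition Delta_tilde ::
    "(complex \<Rightarrow> complex) \<Rightarrow> (complex \<Rightarrow> complex) \<Rightarrow> (complex \<Rightarrow> complex) \<Rightarrow> complex \<Rightarrow> complex" where
  "Delta_tilde \<theta> Ap Am \<zeta> =
     1 - cnj (disc_ext Ap 0) * cnj (disc_ext (\<lambda>z. cnj (Am z)) 0)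
       * (cnj (disc_ext \<theta> 0) - cnj (disc_ext \<theta> (1 / cnj \<zeta>)))\<^sup>2"

end

theory Submission
  imports Defs "HOL-Complex_Analysis.Complex_Analysis"
begin

text \<open>
  Multiplication by \<open>\<phi>\<close> and \<open>\<psi>\<close> identifies \<open>M\<close> with \<open>K \<times> K\<close>, \<open>K\<close> the model space of \<open>\<theta>\<close>, and turns the
  dual-band shift into the compressed shift on each copy of \<open>K\<close>, coupled by rank-one entries
  with coefficients \<open>\<alpha> = cnj A\<^sub>+(0)\<close> and \<open>\<beta>\<close>, its analogue for \<open>A\<^sub>-\<close>.  Hence
  \<open>(T - \<lambda>) (f, g) = (h, k)\<close> means that \<open>(\<zeta> - \<lambda>) f\<close> and \<open>(\<zeta> - \<lambda>) g\<close> equal \<open>h\<close> and \<open>k\<close> up to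
  combinations of \<open>1\<close> and \<open>\<theta>\<close> with two unknown constants.  Off the circle, asking \<open>f\<close> and \<open>g\<close>
  to lie in \<open>K\<close> is a \<open>2 \<times> 2\<close> linear system for these constants, whose determinant is
  \<open>\<Delta>\<close> or its exterior analogue.

  For \<open>\<lambda>\<close> on the circle, \<open>(a \<theta> - b) / (\<zeta> - \<lambda>)\<close> is square integrable only if \<open>a = b = 0\<close> or \<open>\<theta>\<close> has an
  angular derivative at \<open>\<lambda>\<close> and \<open>\<theta>(\<lambda>) = b / a\<close> (Caratheodory), so eigenvalues occur exactly where
  \<open>\<Delta>\<close> vanishes on \<open>T\<^sub>A\<^sub>D\<^sub>C\<close>; an adjoint eigenvector satisfies equations of the same kind, so there
  is no residual spectrum.  If \<open>\<theta>(z\<^sub>n) \<rightarrow> 0\<close> for some \<open>z\<^sub>n \<rightarrow> \<lambda>\<close>, reproducing kernels and uniform boundedness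
  show that \<open>T - \<lambda>\<close> is not onto.  If instead \<open>|\<theta>|\<close> is bounded below near \<open>\<lambda>\<close>, then for \<open>f\<close> in \<open>K\<close>
  the function \<open>|f|\<^sup>2\<close> is the boundary value of \<open>z f f\<^sub>* / \<theta>\<close>, where \<open>f\<^sub>* = \<theta> cnj (\<zeta> f)\<close> on the
  circle; this quotient is analytic in the disc near \<open>\<lambda>\<close>, and moving the arc of integration inwards
  gives \<open>\<parallel>f\<parallel> \<le> C \<parallel>(\<zeta> - \<lambda>) f\<parallel>\<close>, from which both the angular derivative and the bounded inverse of
  \<open>T - \<lambda>\<close> follow.
\<close>

section \<open>Hilbert space preliminaries\<close>

text \<open>Both components live in the same \<open>K\<close>, so the diagonal entries of the linear
  system agree and its determinant has the form \<open>p^2 - \<alpha> * \<beta> * q^2\<close>; in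
  the disc \<open>p\<close> and \<open>q\<close> are the values at \<lambda> of \<theta> and of
  \<open>k0\<close>, the reproducing kernel of \<open>K\<close> at 0. The two unknown constants are
  the functionals \<open>c f\<close> and \<open>c g\<close> of the solution itself; the equation is
  not implicit all the same, because a solution in \<open>K\<close> always reproduces the constants
  put into its right-hand side.

  On the circle \<open>1 / (\<zeta> - \<lambda>)\<close> is unbounded, so invertibility is split
  into a lower bound and density of the range. The lower bound has to be uniform while the arc
  approaches the circle. The weight \<open>e^2 - s^2\<close> is made for this: its derivative has
  size |s|, which is at most a multiple of the distance to \<lambda>, so it can be traded for a
  factor \<open>\<zeta> - \<lambda>\<close> on \<open>f\<close>. Boundary values enter only through
  mean-square convergence of dilates, with almost everywhere convergence along a subsequence for
  \<theta>.\<close>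

lemma orthogonal_projection_exists:
  fixes S :: "'a::{real_inner,complete_space} set"
  assumes "closed S" "subspace S"
  shows "\<exists>p\<in>S. \<forall>y\<in>S. inner (x - p) y = 0"
proof -
  have S0: "S \<noteq> {}" using assms(2) subspace_0 by blast
  define d where "d = infdist x S"
  have d_le: "d \<le> norm (x - y)" if "y \<in> S" for y
    using infdist_le[OF that, of x] by (simp add: d_def dist_norm)
  have d0: "d \<ge> 0" by (simp add: d_def infdist_nonneg)
  have "\<exists>y\<in>S. norm (x - y) < d + 1 / real (Suc n)" for n
  proof -
    have "(INF y\<in>S. dist x y) < d + 1 / real (Suc n)" using S0 by (simp add: d_def infdist_def)
    moreover have "bdd_below ((\<lambda>y. dist x y) ` S)" by (rule bdd_belowI2[of _ 0]) simp
    ultimately show ?thesis using S0 by (simp add: cINF_less_iff dist_norm)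
  qed
  then obtain y where yS: "\<And>n. y n \<in> S" and y: "\<And>n. norm (x - y n) < d + 1 / real (Suc n)"
    by metis
  \<comment> \<open>Parallelogram law: the midpoint \<open>?c\<close> lies in \<open>S\<close> and
    so is no nearer to \<open>x\<close> than \<open>d\<close>.\<close>
  have par: "(norm (y m - y n))\<^sup>2 \<le> 2 * (norm (x - y m))\<^sup>2 + 2 * (norm (x - y n))\<^sup>2 - 4 * d\<^sup>2" for m n
  proof -
    let ?c = "(1/2) *\<^sub>R (y m + y n)"
    have "?c \<in> S" using assms(2) yS by (intro subspace_scale subspace_add) auto
    then have "d\<^sup>2 \<le> (norm (x - ?c))\<^sup>2" using d_le d0 by (intro power_mono) auto
    moreover have "(norm (y m - y n))\<^sup>2
        = 2 * (norm (x - y m))\<^sup>2 + 2 * (norm (x - y n))\<^sup>2 - 4 * (norm (x - ?c))\<^sup>2"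
      by (simp add: power2_norm_eq_inner inner_diff_left inner_diff_right inner_add_left
          inner_add_right inner_commute algebra_simps)
    ultimately show ?thesis by simp
  qed
  have small: "(norm (x - y n))\<^sup>2 \<le> d\<^sup>2 + (2 * d + 1) / real (Suc N)" if "n \<ge> N" for n N
  proof -
    have "norm (x - y n) \<le> d + 1 / real (Suc N)"
      using y[of n] that by (smt (verit) frac_le of_nat_0_less_iff of_nat_le_iff zero_less_Suc Suc_le_mono)
    then have "(norm (x - y n))\<^sup>2 \<le> (d + 1 / real (Suc N))\<^sup>2" by (intro power_mono) auto
    also have "\<dots> = d\<^sup>2 + 2 * d / real (Suc N) + (1 / real (Suc N)) * (1 / real (Suc N))"
      by (simp add: power2_eq_square algebra_simps)
    also have "(1 / real (Suc N)) * (1 / real (Suc N)) \<le> (1 / real (Suc N)) * 1"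
      by (intro mult_left_mono) auto
    finally show ?thesis by (simp add: add_divide_distrib)
  qed
  have "Cauchy y"
  proof (rule metric_CauchyI)
    fix e :: real assume e: "e > 0"
    obtain N where N: "(4 * (2 * d + 1)) / e\<^sup>2 < real N"
      using reals_Archimedean2 by blast
    have N': "4 * (2 * d + 1) / real (Suc N) < e\<^sup>2"
    proof -
      have "4 * (2 * d + 1) < e\<^sup>2 * real N" using N e by (simp add: divide_less_eq mult.commute)
      also have "\<dots> \<le> e\<^sup>2 * real (Suc N)" using e by (intro mult_left_mono) auto
      finally show ?thesis by (simp add: divide_less_eq)
    qed
    have "dist (y m) (y n) < e" if "m \<ge> N" "n \<ge> N" for m n
    proof -
      have "(norm (y m - y n))\<^sup>2 \<le> 4 * ((2 * d + 1) / real (Suc N))"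
        using par[of m n] small[OF that(1)] small[OF that(2)] by linarith
      then have "(norm (y m - y n))\<^sup>2 < e\<^sup>2" using N' by simp
      then show ?thesis using e by (simp add: dist_norm power2_less_imp_less)
    qed
    then show "\<exists>M. \<forall>m\<ge>M. \<forall>n\<ge>M. dist (y m) (y n) < e" by blast
  qed
  then obtain p where p: "y \<longlonglongrightarrow> p" by (auto simp: Cauchy_convergent_iff convergent_def)
  have pS: "p \<in> S" using closed_sequentially[OF assms(1)] yS p by blast
  have "norm (x - p) \<le> d"
  proof (rule LIMSEQ_le)
    show "(\<lambda>n. norm (x - y n)) \<longlonglongrightarrow> norm (x - p)" using p by (intro tendsto_intros)
    show "(\<lambda>n. d + 1 / real (Suc n)) \<longlonglongrightarrow> d"
      using tendsto_add[OF tendsto_const LIMSEQ_Suc[OF lim_1_over_n], of d] by simp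
    show "\<exists>N. \<forall>n\<ge>N. norm (x - y n) \<le> d + 1 / real (Suc n)" using y less_imp_le by blast
  qed
  have "inner (x - p) v = 0" if v: "v \<in> S" for v
  proof (cases "v = 0")
    case False
    \<comment> \<open>This \<open>t\<close> minimises the norm of \<open>(x - p) - t v\<close>;
      since \<open>p\<close> is already nearest, the gain
      \<open>(inner (x - p) v)^2 / (norm v)^2\<close> must be zero.\<close>
    define t where "t = inner (x - p) v / (norm v)\<^sup>2"
    have "p + t *\<^sub>R v \<in> S" using assms(2) pS v by (intro subspace_add subspace_scale)
    then have "norm (x - p) \<le> norm (x - (p + t *\<^sub>R v))" using d_le \<open>norm (x - p) \<le> d\<close> by force
    then have "(norm (x - p))\<^sup>2 \<le> (norm ((x - p) - t *\<^sub>R v))\<^sup>2"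
      by (intro power_mono) (auto simp: algebra_simps)
    also have "\<dots> = (norm (x - p))\<^sup>2 - 2 * t * inner (x - p) v + t\<^sup>2 * (norm v)\<^sup>2"
      unfolding power2_norm_eq_inner by (simp add: inner_diff_left inner_diff_right inner_commute power2_eq_square algebra_simps)
    also have "\<dots> = (norm (x - p))\<^sup>2 - (inner (x - p) v)\<^sup>2 / (norm v)\<^sup>2"
      using False by (simp add: t_def power2_eq_square field_simps)
    finally have "(inner (x - p) v)\<^sup>2 / (norm v)\<^sup>2 \<le> 0" by simp
    then show ?thesis using False by (simp add: divide_le_0_iff)
  qed simp
  with pS show ?thesis by blast
qed

text \<open>A gliding hump: \<open>x\<^sub>n\<close> moves by \<open>3\<^sup>-\<^sup>n\<close> in the direction of a vector \<open>u\<^sub>n\<close> of norm at least \<open>4\<^sup>n\<close>,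
  with the sign that does not decrease \<open>\<bar>inner x u\<^sub>n\<bar>\<close>.\<close>

lemma uniform_boundedness_inner:
  fixes K :: "'a::{real_inner,complete_space} set" and w :: "'i \<Rightarrow> 'a"
  assumes K: "closed K" "subspace K" and w: "\<And>i. w i \<in> K"
    and bdd: "\<And>y. y \<in> K \<Longrightarrow> \<exists>B. \<forall>i. \<bar>inner y (w i)\<bar> \<le> B"
  shows "\<exists>B. \<forall>i. norm (w i) \<le> B"
proof (rule ccontr)
  assume "\<not> ?thesis"
  then have "\<forall>n::nat. \<exists>i. norm (w i) > 4 ^ n" by (meson not_le)
  then obtain j where j: "\<And>n::nat. norm (w (j n)) > 4 ^ n" by metis
  define u where "u n = w (j n)" for n
  have u: "norm (u n) > 4 ^ n" for n using j by (simp add: u_def)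
  define st where "st n y = (if inner y (u (Suc n)) \<ge> 0 then 1 else -1) * (1/3) ^ Suc n / norm (u (Suc n))" for n y
  define x where "x = rec_nat 0 (\<lambda>n y. y + st n y *\<^sub>R u (Suc n))"
  have x0: "x 0 = 0" and xS: "x (Suc n) = x n + st n (x n) *\<^sub>R u (Suc n)" for n
    by (simp_all add: x_def)
  have upos: "norm (u n) > 0" for n using u[of n] by (meson less_trans zero_less_power zero_less_numeral)
  have step: "norm (x (Suc n) - x n) = (1/3) ^ Suc n" for n
    using upos[of "Suc n"] by (simp add: xS st_def abs_mult)
  have xK: "x n \<in> K" for n
    by (induction n) (auto simp: x0 xS u_def intro!: subspace_0 subspace_add subspace_scale K w)
  have big: "\<bar>inner (x (Suc n)) (u (Suc n))\<bar> \<ge> (1/3) ^ Suc n * norm (u (Suc n))" for n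
  proof -
    have "inner (x (Suc n)) (u (Suc n)) = inner (x n) (u (Suc n)) + st n (x n) * (norm (u (Suc n)))\<^sup>2"
      by (simp add: xS inner_add_left power2_norm_eq_inner)
    also have "st n (x n) * (norm (u (Suc n)))\<^sup>2
       = (if inner (x n) (u (Suc n)) \<ge> 0 then 1 else -1) * ((1/3) ^ Suc n * norm (u (Suc n)))"
      using upos[of "Suc n"] by (simp add: st_def power2_eq_square field_simps)
    finally have eq: "inner (x (Suc n)) (u (Suc n)) = inner (x n) (u (Suc n)) + \<dots>" .
    have gen: "b \<le> \<bar>a + (if a \<ge> 0 then 1 else -1) * b\<bar>" if "b \<ge> 0" for a b :: real
      using that by auto
    show ?thesis unfolding eq by (rule gen) simp
  qed
  \<comment> \<open>The steps after \<open>n\<close> add up to at most \<open>(1/2) (1/3)^n\<close>,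
    half of step \<open>n\<close>, so at least half of the hump created at step \<open>n\<close>
    survives in the limit.\<close>
  have tel: "norm (x (n + k) - x n) \<le> (1/2) * (1/3) ^ n" for n k
  proof -
    have "norm (x (n + k) - x n) \<le> (1/2) * (1/3) ^ n - (1/2) * (1/3) ^ (n + k)"
    proof (induction k)
      case (Suc k)
      have "norm (x (n + Suc k) - x n) \<le> norm (x (n + k) - x n) + norm (x (Suc (n + k)) - x (n + k))"
        using norm_triangle_ineq[of "x (n + k) - x n" "x (Suc (n + k)) - x (n + k)"] by simp
      then show ?case using Suc step[of "n + k"] by (simp add: power_add)
    qed simp
    then show ?thesis by (smt (verit) zero_le_power zero_le_divide_1_iff mult_nonneg_nonneg)
  qed
  have "Cauchy x"
  proof (rule CauchyI)
    fix e :: real assume "e > 0"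
    obtain N where N: "(1/3) ^ N < e" using real_arch_pow_inv[OF \<open>e > 0\<close>, of "1/3"] by auto
    have t: "norm (x m - x N) \<le> (1/2) * (1/3) ^ N" if "m \<ge> N" for m
      using tel[of N "m - N"] that by simp
    have "norm (x m - x n) < e" if "m \<ge> N" "n \<ge> N" for m n
      using t[OF that(1)] t[OF that(2)] norm_triangle_ineq4[of "x m - x N" "x n - x N"] N by simp
    then show "\<exists>M. \<forall>m\<ge>M. \<forall>n\<ge>M. norm (x m - x n) < e" by blast
  qed
  then obtain y where y: "x \<longlonglongrightarrow> y" by (auto simp: Cauchy_convergent_iff convergent_def)
  have yK: "y \<in> K" using closed_sequentially[OF K(1)] xK y by blast
  have near: "norm (y - x n) \<le> (1/2) * (1/3) ^ n" for n
  proof (rule LIMSEQ_le_const2)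
    show "(\<lambda>k. norm (x (k + n) - x n)) \<longlonglongrightarrow> norm (y - x n)"
      using LIMSEQ_ignore_initial_segment[OF y, of n] by (intro tendsto_intros)
    show "\<exists>N. \<forall>k\<ge>N. norm (x (k + n) - x n) \<le> 1/2 * (1/3) ^ n"
      using tel[of n] by (auto simp: add.commute)
  qed
  have lower: "\<bar>inner y (u (Suc n))\<bar> \<ge> (1/2) * (4/3) ^ Suc n" for n
  proof -
    have "\<bar>inner (y - x (Suc n)) (u (Suc n))\<bar> \<le> norm (y - x (Suc n)) * norm (u (Suc n))"
      by (rule Cauchy_Schwarz_ineq2)
    also have "\<dots> \<le> (1/2) * (1/3) ^ Suc n * norm (u (Suc n))"
      by (intro mult_right_mono near) auto
    finally have "\<bar>inner (x (Suc n)) (u (Suc n)) - inner y (u (Suc n))\<bar> \<le> (1/2) * (1/3) ^ Suc n * norm (u (Suc n))"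
      by (simp add: inner_diff_left abs_minus_commute)
    then have "\<bar>inner y (u (Suc n))\<bar> \<ge> (1/2) * (1/3) ^ Suc n * norm (u (Suc n))"
      using big[of n] by linarith
    moreover have "(1/2) * (1/3) ^ Suc n * norm (u (Suc n)) \<ge> (1/2) * (1/3) ^ Suc n * (4::real) ^ Suc n"
      using u[of "Suc n"] by (intro mult_left_mono) auto
    ultimately show ?thesis by (simp add: power_divide)
  qed
  obtain B where B: "\<And>i. \<bar>inner y (w i)\<bar> \<le> B" using bdd[OF yK] by blast
  obtain n where n: "(4/3::real) ^ n > 2 * B" using real_arch_pow[of "4/3" "2*B"] by auto
  have "(4/3::real) ^ n \<le> (4/3) ^ Suc n" by (intro power_increasing) auto
  then show False using lower[of n] B[of "j (Suc n)"] n by (simp add: u_def)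
qed

text \<open>The lower bound makes preimages of a Cauchy sequence Cauchy, so the range is closed, and
  being dense it is everything.\<close>

lemma bounded_below_dense_imp_surj:
  fixes L :: "'a::{real_normed_vector,complete_space} \<Rightarrow> 'a"
  assumes K: "closed K" and L: "bounded_linear L" and sub: "\<And>x y. x \<in> K \<Longrightarrow> y \<in> K \<Longrightarrow> x - y \<in> K"
    and LK: "L ` K \<subseteq> K"
    and bb: "\<And>x. x \<in> K \<Longrightarrow> norm x \<le> C * norm (L x)"
    and dense: "K \<subseteq> closure (L ` K)"
  shows "L ` K = K"
proof (rule antisym[OF LK], rule subsetI)
  interpret L: bounded_linear L by fact
  fix y assume "y \<in> K"
  then have "y \<in> closure (L ` K)" using dense by blast
  then obtain s where s: "\<And>n. s n \<in> L ` K" "s \<longlonglongrightarrow> y" unfolding closure_sequential by blast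
  then have "\<forall>n. \<exists>x\<in>K. L x = s n" by (metis imageE)
  then obtain x where x: "\<And>n. x n \<in> K" "\<And>n. L (x n) = s n" by metis
  have "Cauchy s" using s(2) by (rule LIMSEQ_imp_Cauchy)
  have "Cauchy x"
  proof (rule metric_CauchyI)
    fix e :: real assume e: "e > 0"
    \<comment> \<open>The sign of \<open>C\<close> is unknown, and a positive constant is needed to
      divide by.\<close>
    define C' where "C' = \<bar>C\<bar> + 1"
    have C': "C' > 0" by (simp add: C'_def)
    then have "e / C' > 0" using e by simp
    then obtain M where M: "\<And>m n. m \<ge> M \<Longrightarrow> n \<ge> M \<Longrightarrow> dist (s m) (s n) < e / C'"
      using metric_CauchyD[OF \<open>Cauchy s\<close>] by meson
    have "dist (x m) (x n) < e" if "m \<ge> M" "n \<ge> M" for m n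
    proof -
      have "norm (x m - x n) \<le> C * norm (L (x m - x n))" using bb sub x by blast
      also have "\<dots> \<le> C' * norm (L (x m - x n))" by (intro mult_right_mono) (auto simp: C'_def)
      also have "\<dots> = C' * dist (s m) (s n)" by (simp add: L.diff x dist_norm)
      also have "\<dots> < e" using M[OF that] C' by (simp add: field_simps)
      finally show ?thesis by (simp add: dist_norm)
    qed
    then show "\<exists>M. \<forall>m\<ge>M. \<forall>n\<ge>M. dist (x m) (x n) < e" by blast
  qed
  then obtain p where p: "x \<longlonglongrightarrow> p" by (auto simp: Cauchy_convergent_iff convergent_def)
  have "p \<in> K" using closed_sequentially[OF K] x p by blast
  moreover have "s \<longlonglongrightarrow> L p" using L.tendsto[OF p] x by simp
  then have "L p = y" using s(2) LIMSEQ_unique by blast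
  ultimately show "y \<in> L ` K" by blast
qed

section \<open>The Hilbert space of the circle\<close>

subsection \<open>The measure\<close>

lemma cis_measurable [measurable]: "cis \<in> borel_measurable borel"
  by (intro borel_measurable_continuous_onI continuous_intros)

lemma emeasure_circle_UNIV: "emeasure circle_measure UNIV = 1"
proof -
  have "emeasure lborel {0..2*pi} \<noteq> 0" "emeasure lborel {0..2*pi} \<noteq> \<infinity>"
    using pi_gt_zero by (auto simp: ennreal_eq_0_iff not_le)
  then show ?thesis
    unfolding circle_measure_def
    by (subst emeasure_distr) (auto intro!: emeasure_uniform_measure_1)
qed

interpretation circle: finite_measure circle_measure
  by standard (simp add: emeasure_circle_UNIV)

lemma measure_circle_UNIV [simp]: "measure circle_measure UNIV = 1"
  by (simp add: measure_def emeasure_circle_UNIV)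

lemma AE_circle_iff:
  assumes [measurable]: "Measurable.pred borel P"
  shows "(AE z in circle_measure. P z) \<longleftrightarrow> (AE t in lborel. t \<in> {0..2*pi} \<longrightarrow> P (cis t))"
proof -
  have "(AE z in circle_measure. P z) \<longleftrightarrow> (AE t in uniform_measure lborel {0..2*pi}. P (cis t))"
    unfolding circle_measure_def by (subst AE_distr_iff) auto
  also have "\<dots> \<longleftrightarrow> (AE t in lborel. t \<in> {0..2*pi} \<longrightarrow> P (cis t))"
    using pi_gt_zero by (intro AE_uniform_measure) (auto simp: ennreal_eq_0_iff not_le)
  finally show ?thesis .
qed

lemma AE_circle_norm: "AE z in circle_measure. norm z = 1"
  by (subst AE_circle_iff) auto

text \<open>Points are null. Division by \<open>\<zeta> - l\<close> is therefore harmless almost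
  everywhere even when \<open>l\<close> lies on the circle, which is how the resolvent equations
  there are solved pointwise.\<close>

lemma AE_circle_neq: "AE z in circle_measure. z \<noteq> w"
proof (subst AE_circle_iff)
  have "AE t in lborel. t \<notin> {t\<in>{0..2*pi}. cis t = w}"
  proof (rule AE_not_in, rule countable_imp_null_set_lborel, rule countable_finite)
    show "finite {t \<in> {0..2*pi}. cis t = w}"
    proof (cases "\<exists>t. cis t = w")
      case True
      then obtain s where s: "cis s = w" by blast
      have "{t \<in> {0..2*pi}. cis t = w} \<subseteq> (\<lambda>n::int. s + 2 * pi * of_int n) ` {\<lfloor>- s/(2*pi)\<rfloor> - 1..\<lceil>(2 * pi - s)/(2*pi)\<rceil> + 1}"
      proof
        fix t assume t: "t \<in> {t \<in> {0..2*pi}. cis t = w}"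
        then have "cis (t - s) = 1" using s by (metis (mono_tags, lifting) cis_divide cis_neq_zero divide_self mem_Collect_eq)
        then have "cos (t - s) = 1" by (simp add: complex_eq_iff)
        then obtain n :: int where "t - s = of_int n * 2 * pi" by (auto simp: cos_one_2pi_int)
        then have n: "t = s + 2 * pi * of_int n" by (simp add: algebra_simps)
        have n2: "of_int n = (t - s) / (2*pi)" using n by (simp add: field_simps)
        have "- s/(2*pi) \<le> of_int n" "of_int n \<le> (2 * pi - s)/(2*pi)"
          unfolding n2 using t by (auto simp: field_simps)
        then have "n \<in> {\<lfloor>- s/(2*pi)\<rfloor> - 1..\<lceil>(2 * pi - s)/(2*pi)\<rceil> + 1}"
          by auto linarith+
        then show "t \<in> (\<lambda>n::int. s + 2 * pi * of_int n) ` {\<lfloor>- s/(2*pi)\<rfloor> - 1..\<lceil>(2 * pi - s)/(2*pi)\<rceil> + 1}"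
          using n by blast
      qed
      then show ?thesis by (rule finite_subset) auto
    qed auto
  qed
  then show "AE t in lborel. t \<in> {0..2*pi} \<longrightarrow> cis t \<noteq> w" by auto
qed auto

lemma integral_circle_eq:
  fixes g :: "complex \<Rightarrow> complex"
  assumes [measurable]: "g \<in> borel_measurable borel"
  shows "(LINT z|circle_measure. g z) = (LINT t:{0..2*pi}|lborel. g (cis t)) / (2 * pi)"
proof -
  have "(LINT z|circle_measure. g z) = (LINT t|uniform_measure lborel {0..2*pi}. g (cis t))"
    unfolding circle_measure_def by (subst integral_distr) auto
  also have "\<dots> = (LINT t|lborel. (indicator {0..2*pi} t / (2*pi)) *\<^sub>R g (cis t))"
  proof -
    have "uniform_measure lborel {0..2*pi} = density lborel (\<lambda>t. ennreal (indicator {0..2*pi} t / (2*pi)))"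
      unfolding uniform_measure_def by (rule density_cong) (auto simp: indicator_def divide_ennreal[symmetric] ennreal_1[symmetric] simp del: ennreal_1)
    then show ?thesis by (simp add: integral_density)
  qed
  also have "\<dots> = (LINT t|lborel. (indicator {0..2*pi} t *\<^sub>R g (cis t)) / (2*pi))"
    by (intro Bochner_Integration.integral_cong) (auto simp: indicator_def scaleR_conv_of_real)
  also have "\<dots> = (LINT t:{0..2*pi}|lborel. g (cis t)) / (2 * pi)"
    unfolding set_lebesgue_integral_def by (rule integral_divide_zero)
  finally show ?thesis .
qed

lemma integral_circle_powi: "(LINT z|circle_measure. z powi n) = (if n = 0 then 1 else 0)"
proof (cases "n = 0")
  case False
  have "(LINT t:{0..2*pi}|lborel. cis t powi n) = 0"
  proof -
    let ?F = "\<lambda>t. Complex (sin (of_int n * t) / of_int n) (- cos (of_int n * t) / of_int n)"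
    have "(LINT t|lborel. indicator {0..2*pi} t *\<^sub>R cis (of_int n * t)) = ?F (2*pi) - ?F 0"
    proof (rule integral_FTC_Icc)
      show "0 \<le> 2 * pi" by simp
      show "(?F has_vector_derivative cis (of_int n * t)) (at t within {0..2*pi})" for t
        using False unfolding has_vector_derivative_complex_iff
        by (auto intro!: derivative_eq_intros simp: has_real_derivative_iff_has_vector_derivative[symmetric])
    qed (auto intro!: continuous_intros)
    also have "?F (2*pi) = ?F 0"
      using cis_multiple_2pi[of "of_int n"] by (simp add: mult.commute mult.left_commute complex_eq_iff)
    finally show ?thesis by (simp add: set_lebesgue_integral_def cis_power_int)
  qed
  then show ?thesis using False by (subst integral_circle_eq) auto
qed simp

subsection \<open>Bounded symbols\<close>

lemma Linf_fun_measurable: "u \<in> Linf_fun \<Longrightarrow> u \<in> borel_measurable borel"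
  by (simp add: Linf_fun_def measurable_def)

lemma Linf_funI:
  assumes "u \<in> borel_measurable borel" "AE z in circle_measure. norm (u z) \<le> C"
  shows "u \<in> Linf_fun"
  using assms by (auto simp: Linf_fun_def measurable_def)

lemma Linf_fun_mult:
  assumes "u \<in> Linf_fun" "v \<in> Linf_fun" shows "(\<lambda>z. u z * v z) \<in> Linf_fun"
proof -
  obtain C D where C: "AE z in circle_measure. norm (u z) \<le> C" and D: "AE z in circle_measure. norm (v z) \<le> D"
    using assms by (auto simp: Linf_fun_def)
  note [measurable] = assms[THEN Linf_fun_measurable]
  show ?thesis
  proof (rule Linf_funI)
    show "AE z in circle_measure. norm (u z * v z) \<le> \<bar>C\<bar> * \<bar>D\<bar>"
      using C D by eventually_elim (auto simp: norm_mult intro!: mult_mono)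
  qed measurable
qed

lemma Linf_fun_add:
  assumes "u \<in> Linf_fun" "v \<in> Linf_fun" shows "(\<lambda>z. u z + v z) \<in> Linf_fun"
proof -
  obtain C D where C: "AE z in circle_measure. norm (u z) \<le> C" and D: "AE z in circle_measure. norm (v z) \<le> D"
    using assms by (auto simp: Linf_fun_def)
  note [measurable] = assms[THEN Linf_fun_measurable]
  show ?thesis
  proof (rule Linf_funI)
    show "AE z in circle_measure. norm (u z + v z) \<le> C + D"
      using C D by eventually_elim (rule norm_triangle_mono)
  qed measurable
qed

lemma Linf_fun_cnj: "u \<in> Linf_fun \<Longrightarrow> (\<lambda>z. cnj (u z)) \<in> Linf_fun"
  by (auto simp: Linf_fun_def)

lemma Linf_fun_uminus: "u \<in> Linf_fun \<Longrightarrow> (\<lambda>z. - u z) \<in> Linf_fun"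
  by (auto simp: Linf_fun_def)

lemma Linf_fun_diff: "u \<in> Linf_fun \<Longrightarrow> v \<in> Linf_fun \<Longrightarrow> (\<lambda>z. u z - v z) \<in> Linf_fun"
  using Linf_fun_add[OF _ Linf_fun_uminus] by simp

lemma Linf_fun_id: "(\<lambda>z. z) \<in> Linf_fun"
  using AE_circle_norm by (intro Linf_funI[where C = 1]) auto

lemma Linf_fun_powi: "(\<lambda>z. z powi n) \<in> Linf_fun"
  using AE_circle_norm by (intro Linf_funI[where C = 1]) (auto simp: norm_power_int)

lemmas Linf_fun_intros = Linf_fun_mult Linf_fun_add Linf_fun_cnj Linf_fun_uminus Linf_fun_diff
  Linf_fun_id Linf_fun_powi Linf_fun_const

lemma unimodular_Linf: "unimodular u \<Longrightarrow> u \<in> Linf_fun"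
  by (simp add: unimodular_def)

lemma Linf_fun_L2: "u \<in> Linf_fun \<Longrightarrow> u \<in> L2_fun"
  using L2_fun_mult[of u "\<lambda>_. 1"] by (simp add: L2_fun_def)

lemma unimodular_id: "unimodular (\<lambda>z. z)"
  using AE_circle_norm Linf_fun_id by (auto simp: unimodular_def)

lemma unimodular_powi: "unimodular (\<lambda>z. z powi n)"
  using AE_circle_norm Linf_fun_powi by (auto simp: unimodular_def norm_power_int)

subsection \<open>Elements represented by functions\<close>

abbreviation L2_of :: "(complex \<Rightarrow> complex) \<Rightarrow> L2_circle" where
  "L2_of \<equiv> abs_L2_circle"

abbreviation fn :: "L2_circle \<Rightarrow> complex \<Rightarrow> complex" where
  "fn \<equiv> rep_L2_circle"

lemma L2_rel_refl: "f \<in> L2_fun \<Longrightarrow> L2_rel f f"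
  by (simp add: L2_rel_def)

lemma fn_L2 [simp]: "fn x \<in> L2_fun"
  using Quotient3_rep_reflp[OF Quotient3_L2_circle, of x] by (simp add: L2_rel_def)

lemma L2_of_fn [simp]: "L2_of (fn x) = x"
  by (rule Quotient3_abs_rep[OF Quotient3_L2_circle])

lemma fn_measurable [measurable]: "fn x \<in> borel_measurable borel"
  using fn_L2[of x] by (simp add: L2_fun_def measurable_def)

lemma L2_of_eq_iff: "f \<in> L2_fun \<Longrightarrow> g \<in> L2_fun \<Longrightarrow> L2_of f = L2_of g \<longleftrightarrow> (AE z in circle_measure. f z = g z)"
  using Quotient3_rel[OF Quotient3_L2_circle, of f g] by (auto simp: L2_rel_def)

lemma fn_L2_of: "f \<in> L2_fun \<Longrightarrow> AE z in circle_measure. fn (L2_of f) z = f z"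
  using L2_of_eq_iff[of "fn (L2_of f)" f] by simp

lemma L2_eqI: "AE z in circle_measure. fn x z = fn y z \<Longrightarrow> x = y"
  using L2_of_eq_iff[of "fn x" "fn y"] by simp

lemma mult_L2_of: "u \<in> Linf_fun \<Longrightarrow> f \<in> L2_fun \<Longrightarrow> mult_L2 u (L2_of f) = L2_of (\<lambda>z. u z * f z)"
  using mult_L2.abs_eq[OF L2_rel_refl, of f u] by simp

lemma fn_mult_L2: "u \<in> Linf_fun \<Longrightarrow> AE z in circle_measure. fn (mult_L2 u x) z = u z * fn x z"
  using fn_L2_of[of "\<lambda>z. u z * fn x z"] mult_L2_of[of u "fn x"] L2_fun_mult by simp

lemma fn_add: "AE z in circle_measure. fn (x + y) z = fn x z + fn y z"
  using fn_L2_of[of "\<lambda>z. fn x z + fn y z"] plus_L2_circle.abs_eq[of "fn x" "fn y"]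
  by (simp add: L2_fun_add L2_rel_refl)

lemma fn_scaleC: "AE z in circle_measure. fn (c *\<^sub>C x) z = c * fn x z"
  using fn_L2_of[of "\<lambda>z. c * fn x z"] scaleC_L2.abs_eq[of "fn x" c]
  by (simp add: L2_fun_scale L2_rel_refl)

lemma cinner_fn: "cinner_L2 x y = (LINT z|circle_measure. fn x z * cnj (fn y z))"
  using cinner_L2.abs_eq[of "fn x" "fn y"] by (simp add: L2_rel_refl)

lemma cinner_L2_of: "f \<in> L2_fun \<Longrightarrow> g \<in> L2_fun \<Longrightarrow> cinner_L2 (L2_of f) (L2_of g) = (LINT z|circle_measure. f z * cnj (g z))"
  using cinner_L2.abs_eq[of f g] by (simp add: L2_rel_refl)

subsection \<open>Algebra of the inner product and of multiplication operators\<close>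

lemma cinner_L2_add_right: "cinner_L2 h (f + g) = cinner_L2 h f + cinner_L2 h g"
  by (subst (1 2 3) cinner_L2_commute) (simp add: cinner_L2_add_left)

lemma cinner_L2_scaleC_right: "cinner_L2 f (c *\<^sub>C g) = cnj c * cinner_L2 f g"
  by (subst (1 2) cinner_L2_commute) (simp add: cinner_L2_scaleC_left)

lemma scaleC_scaleC: "a *\<^sub>C b *\<^sub>C x = (a * b) *\<^sub>C x"
  by transfer (auto simp: L2_rel_def mult.assoc intro!: L2_fun_scale)

lemma scaleC_one [simp]: "1 *\<^sub>C x = x"
  by transfer (auto simp: L2_rel_def)

lemma scaleC_zero_left [simp]: "0 *\<^sub>C x = 0"
  by transfer (auto simp: L2_rel_def L2_fun_zero)

lemma scaleC_zero_right [simp]: "c *\<^sub>C 0 = (0 :: L2_circle)"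
  by transfer (auto simp: L2_rel_def L2_fun_zero)

lemma scaleC_add_right: "c *\<^sub>C (x + y) = c *\<^sub>C x + c *\<^sub>C y"
  by transfer (auto simp: L2_rel_def distrib_left intro!: L2_fun_scale L2_fun_add)

lemma scaleC_add_left: "(a + b) *\<^sub>C x = a *\<^sub>C x + b *\<^sub>C x"
  by transfer (auto simp: L2_rel_def distrib_right intro!: L2_fun_scale L2_fun_add)

lemma scaleC_minus_one: "- x = (-1) *\<^sub>C x"
  by transfer (auto simp: L2_rel_def intro!: L2_fun_uminus)

lemma scaleC_uminus_right: "c *\<^sub>C (- x) = - (c *\<^sub>C x)"
  unfolding scaleC_minus_one by (simp add: scaleC_scaleC)

lemma scaleC_uminus_left: "(- c) *\<^sub>C x = - (c *\<^sub>C x)"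
  unfolding scaleC_minus_one by (simp add: scaleC_scaleC)

lemma scaleC_diff_right: "c *\<^sub>C (x - y) = c *\<^sub>C x - c *\<^sub>C y"
  using scaleC_add_right[of c x "-y"] by (simp add: scaleC_uminus_right)

lemma scaleC_diff_left: "(a - b) *\<^sub>C x = a *\<^sub>C x - b *\<^sub>C x"
  using scaleC_add_left[of a "-b" x] by (simp add: scaleC_uminus_left)

lemma cinner_L2_uminus_left: "cinner_L2 (- f) g = - cinner_L2 f g"
  unfolding scaleC_minus_one by (simp add: cinner_L2_scaleC_left)

lemma cinner_L2_uminus_right: "cinner_L2 f (- g) = - cinner_L2 f g"
  unfolding scaleC_minus_one by (simp add: cinner_L2_scaleC_right)

lemma cinner_L2_diff_left: "cinner_L2 (f - g) h = cinner_L2 f h - cinner_L2 g h"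
  using cinner_L2_add_left[of f "- g" h] by (simp add: cinner_L2_uminus_left)

lemma cinner_L2_diff_right: "cinner_L2 h (f - g) = cinner_L2 h f - cinner_L2 h g"
  using cinner_L2_add_right[of h f "- g"] by (simp add: cinner_L2_uminus_right)

lemma cinner_L2_zero_left [simp]: "cinner_L2 0 g = 0"
  using cinner_L2_scaleC_left[of 0 0 g] by simp

lemma cinner_L2_zero_right [simp]: "cinner_L2 g 0 = 0"
  using cinner_L2_scaleC_right[of g 0 0] by simp

lemmas cinner_simps = cinner_L2_add_left cinner_L2_add_right cinner_L2_diff_left cinner_L2_diff_right
  cinner_L2_scaleC_left cinner_L2_scaleC_right cinner_L2_uminus_left cinner_L2_uminus_right

lemma norm_L2_sq: "(norm x)\<^sup>2 = Re (cinner_L2 x x)"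
  using cinner_L2_self[of x] by (auto simp: norm_L2_circle_def)

lemma cinner_self_eq_norm: "cinner_L2 x x = of_real ((norm x)\<^sup>2)"
  using cinner_L2_self[of x] by (auto simp: norm_L2_circle_def simp del: of_real_power)

lemma cinner_eq_0_self [simp]: "cinner_L2 x x = 0 \<longleftrightarrow> x = 0"
  by (simp add: cinner_self_eq_norm)

lemma Re_cinner: "Re (cinner_L2 x y) = inner x y"
  by (simp add: inner_L2_circle_def)

lemma Im_cinner: "Im (cinner_L2 x y) = inner x (\<i> *\<^sub>C y)"
  by (simp add: inner_L2_circle_def cinner_simps)

lemma norm_scaleC: "norm (c *\<^sub>C x) = cmod c * norm x"
proof -
  have "cinner_L2 (c *\<^sub>C x) (c *\<^sub>C x) = of_real ((cmod c * norm x)\<^sup>2)"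
    using complex_norm_square[of c]
    by (simp add: cinner_L2_scaleC_left cinner_L2_scaleC_right cinner_self_eq_norm[of x] power_mult_distrib mult.assoc)
  then have "(norm (c *\<^sub>C x))\<^sup>2 = (cmod c * norm x)\<^sup>2"
    by (simp add: norm_L2_sq)
  then show ?thesis by (simp add: power2_eq_iff_nonneg)
qed

lemma cinner_Cauchy_Schwarz: "cmod (cinner_L2 x y) \<le> norm x * norm y"
proof -
  \<comment> \<open>A unimodular factor that makes the inner product real and non-negative, so the
    real inequality applies; the value 1 in the degenerate case keeps the modulus equal to 1, as
    \<open>sgn 0 = 0\<close>.\<close>
  define c where "c = (if cinner_L2 x y = 0 then 1 else cnj (sgn (cinner_L2 x y)))"
  have c: "cmod c = 1" by (simp add: c_def norm_sgn)
  have "c * cinner_L2 x y = of_real (cmod (cinner_L2 x y))"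
    by (simp add: c_def sgn_eq complex_norm_square[symmetric] power2_eq_square field_simps)
  then have "cmod (cinner_L2 x y) = Re (cinner_L2 (c *\<^sub>C x) y)"
    by (simp add: cinner_simps)
  also have "\<dots> \<le> norm (c *\<^sub>C x) * norm y"
    unfolding Re_cinner by (rule norm_cauchy_schwarz)
  finally show ?thesis by (simp add: norm_scaleC c)
qed

lemma bounded_linear_cinner_left: "bounded_linear (\<lambda>x. cinner_L2 x y)"
  by (rule bounded_linear_intro[where K = "norm y"])
     (auto simp: cinner_simps scaleR_L2_circle_def scaleR_conv_of_real cinner_Cauchy_Schwarz)

lemma continuous_on_cinner_left [continuous_intros]:
  "continuous_on S f \<Longrightarrow> continuous_on S (\<lambda>x. cinner_L2 (f x) y)"
  by (rule bounded_linear.continuous_on[OF bounded_linear_cinner_left])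

lemma mult_L2_not_Linf: "u \<notin> Linf_fun \<Longrightarrow> mult_L2 u x = 0"
  by (transfer fixing: u) (auto simp: L2_rel_def L2_fun_zero)

lemma mult_L2_add: "mult_L2 u (x + y) = mult_L2 u x + mult_L2 u y"
proof (cases "u \<in> Linf_fun")
  case True
  show ?thesis
    by (rule L2_eqI)
      (use fn_add[of "mult_L2 u x" "mult_L2 u y"] fn_add[of x y] True[THEN fn_mult_L2, of "x + y"]
        True[THEN fn_mult_L2, of x] True[THEN fn_mult_L2, of y] in eventually_elim, simp add: distrib_left)
qed (simp add: mult_L2_not_Linf)

lemma mult_L2_scaleC: "mult_L2 u (c *\<^sub>C x) = c *\<^sub>C mult_L2 u x"
proof (cases "u \<in> Linf_fun")
  case True
  show ?thesis
    by (rule L2_eqI)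
      (use fn_scaleC[of c "mult_L2 u x"] fn_scaleC[of c x] True[THEN fn_mult_L2, of "c *\<^sub>C x"]
        True[THEN fn_mult_L2, of x] in eventually_elim, simp)
qed (simp add: mult_L2_not_Linf)

lemma mult_L2_zero [simp]: "mult_L2 u 0 = 0"
  using mult_L2_scaleC[of u 0 0] by simp

lemma mult_L2_uminus: "mult_L2 u (- x) = - mult_L2 u x"
  unfolding scaleC_minus_one by (rule mult_L2_scaleC)

lemma mult_L2_diff: "mult_L2 u (x - y) = mult_L2 u x - mult_L2 u y"
  using mult_L2_add[of u x "-y"] by (simp add: mult_L2_uminus)

lemmas mult_L2_simps = mult_L2_add mult_L2_scaleC mult_L2_diff mult_L2_uminus

lemma mult_L2_mult:
  assumes "u \<in> Linf_fun" "v \<in> Linf_fun"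
  shows "mult_L2 u (mult_L2 v x) = mult_L2 (\<lambda>z. u z * v z) x"
  using mult_L2_of[of v "fn x"] mult_L2_of[of u "\<lambda>z. v z * fn x z"] mult_L2_of[of "\<lambda>z. u z * v z" "fn x"] assms
  by (simp add: Linf_fun_mult L2_fun_mult mult.assoc)

lemma mult_L2_cong:
  assumes "u \<in> Linf_fun" "v \<in> Linf_fun" "AE z in circle_measure. u z = v z"
  shows "mult_L2 u x = mult_L2 v x"
proof -
  have "L2_of (\<lambda>z. u z * fn x z) = L2_of (\<lambda>z. v z * fn x z)"
    using assms by (subst L2_of_eq_iff) (auto simp: L2_fun_mult elim: eventually_mono)
  then show ?thesis using mult_L2_of[of u "fn x"] mult_L2_of[of v "fn x"] assms by simp
qed

lemma mult_L2_const: "mult_L2 (\<lambda>_. c) x = c *\<^sub>C x"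
  by (transfer fixing: c) (auto simp: L2_rel_def Linf_fun_const intro!: L2_fun_scale)

lemma mult_L2_add_symbol:
  assumes "u \<in> Linf_fun" "v \<in> Linf_fun"
  shows "mult_L2 (\<lambda>z. u z + v z) x = mult_L2 u x + mult_L2 v x"
  using assms by (transfer fixing: u v) (auto simp: L2_rel_def Linf_fun_add distrib_right intro!: L2_fun_mult L2_fun_add)

lemma mult_L2_diff_symbol:
  assumes "u \<in> Linf_fun" "v \<in> Linf_fun"
  shows "mult_L2 (\<lambda>z. u z - v z) x = mult_L2 u x - mult_L2 v x"
  using assms by (transfer fixing: u v) (auto simp: L2_rel_def Linf_fun_diff left_diff_distrib intro!: L2_fun_mult L2_fun_diff)

lemma mult_L2_scale_symbol:
  assumes "u \<in> Linf_fun"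
  shows "mult_L2 (\<lambda>z. c * u z) x = c *\<^sub>C mult_L2 u x"
  using mult_L2_mult[OF Linf_fun_const assms, of c x] by (simp add: mult_L2_const)

lemma cinner_mult_left:
  assumes "u \<in> Linf_fun"
  shows "cinner_L2 (mult_L2 u x) y = cinner_L2 x (mult_L2 (\<lambda>z. cnj (u z)) y)"
  using mult_L2_of[of u "fn x"] mult_L2_of[of "\<lambda>z. cnj (u z)" "fn y"]
    cinner_L2_of[of "\<lambda>z. u z * fn x z" "fn y"] cinner_L2_of[of "fn x" "\<lambda>z. cnj (u z) * fn y z"] assms
  by (simp add: Linf_fun_cnj L2_fun_mult ac_simps)

lemma cinner_mult_right:
  assumes "u \<in> Linf_fun"
  shows "cinner_L2 x (mult_L2 u y) = cinner_L2 (mult_L2 (\<lambda>z. cnj (u z)) x) y"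
  using cinner_mult_left[of "\<lambda>z. cnj (u z)" x y] assms by (simp add: Linf_fun_cnj)

lemma norm_mult_L2_le:
  assumes u: "u \<in> Linf_fun" and C: "AE z in circle_measure. norm (u z) \<le> C" "C \<ge> 0"
  shows "norm (mult_L2 u x) \<le> C * norm x"
proof -
  have [measurable]: "u \<in> borel_measurable borel" by (rule Linf_fun_measurable[OF u])
  have sq: "(norm (L2_of f))\<^sup>2 = (LINT z|circle_measure. (cmod (f z))\<^sup>2)" if "f \<in> L2_fun" for f
    unfolding norm_L2_sq cinner_L2_of[OF that that] complex_norm_square[symmetric]
    by (simp only: of_real_power[symmetric] integral_complex_of_real Re_complex_of_real)
  have "(norm (mult_L2 u x))\<^sup>2 = (LINT z|circle_measure. (cmod (u z * fn x z))\<^sup>2)"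
    using sq[of "\<lambda>z. u z * fn x z"] mult_L2_of[of u "fn x"] u by (simp add: L2_fun_mult)
  also have "\<dots> \<le> (LINT z|circle_measure. C\<^sup>2 * (cmod (fn x z))\<^sup>2)"
  proof (rule integral_mono_AE)
    show "AE z in circle_measure. (cmod (u z * fn x z))\<^sup>2 \<le> C\<^sup>2 * (cmod (fn x z))\<^sup>2"
      using C(1) by eventually_elim (auto simp: norm_mult power_mult_distrib intro!: mult_right_mono power_mono)
  qed (use L2_fun_mult[OF u fn_L2, of x] fn_L2[of x] in \<open>auto simp: L2_fun_def\<close>)
  also have "\<dots> = (C * norm x)\<^sup>2"
    by (simp only: power_mult_distrib integral_mult_right_zero sq[OF fn_L2, symmetric] L2_of_fn)
  finally show ?thesis by (rule power2_le_imp_le) (use C(2) in simp)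
qed

lemma cinner_unimodular_mult:
  assumes "unimodular u" shows "cinner_L2 (mult_L2 u x) (mult_L2 u y) = cinner_L2 x y"
proof -
  have u: "u \<in> Linf_fun" using assms by (simp add: unimodular_def)
  have "AE z in circle_measure. cnj (u z) * u z = 1"
    using assms unfolding unimodular_def by (auto elim!: eventually_mono simp: complex_norm_square[symmetric] mult.commute)
  then have "mult_L2 (\<lambda>z. cnj (u z) * u z) y = y"
    using mult_L2_cong[of "\<lambda>z. cnj (u z) * u z" "\<lambda>_. 1" y] u by (simp add: mult_L2_const Linf_fun_intros)
  then show ?thesis using u by (simp add: cinner_mult_left mult_L2_mult Linf_fun_cnj)
qed

lemma norm_unimodular_mult: "unimodular u \<Longrightarrow> norm (mult_L2 u x) = norm x"
  by (simp add: norm_L2_circle_def cinner_unimodular_mult)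

lemma bounded_linear_mult_L2: assumes u: "u \<in> Linf_fun" shows "bounded_linear (mult_L2 u)"
proof -
  obtain C where C: "AE z in circle_measure. norm (u z) \<le> C" using u by (auto simp: Linf_fun_def)
  then have "AE z in circle_measure. norm (u z) \<le> \<bar>C\<bar>" by eventually_elim auto
  from norm_mult_L2_le[OF u this] show ?thesis
    by (intro bounded_linear_intro[where K = "\<bar>C\<bar>"])
       (auto simp: mult_L2_simps scaleR_L2_circle_def mult.commute)
qed

lemma bounded_linear_scaleC: "bounded_linear (\<lambda>x. c *\<^sub>C x)"
  by (rule bounded_linear_intro[where K = "cmod c"])
     (auto simp: scaleC_add_right scaleR_L2_circle_def scaleC_scaleC mult.commute norm_scaleC)

subsection \<open>Completeness\<close>

lemma L2_of_add: "f \<in> L2_fun \<Longrightarrow> g \<in> L2_fun \<Longrightarrow> L2_of (\<lambda>z. f z + g z) = L2_of f + L2_of g"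
  using plus_L2_circle.abs_eq[of f g] by (simp add: L2_rel_refl)

lemma L2_of_diff: "f \<in> L2_fun \<Longrightarrow> g \<in> L2_fun \<Longrightarrow> L2_of (\<lambda>z. f z - g z) = L2_of f - L2_of g"
  using minus_L2_circle.abs_eq[of f g] by (simp add: L2_rel_refl)

lemma L2_of_scale: "f \<in> L2_fun \<Longrightarrow> L2_of (\<lambda>z. c * f z) = c *\<^sub>C L2_of f"
  using scaleC_L2.abs_eq[of f c] by (simp add: L2_rel_refl)

lemma L2_fun_borel: "f \<in> L2_fun \<Longrightarrow> f \<in> borel_measurable borel"
  by (simp add: L2_fun_def measurable_def)

lemma norm_L2_of_sq:
  assumes "f \<in> L2_fun"
  shows "(norm (L2_of f))\<^sup>2 = (LINT z|circle_measure. (cmod (f z))\<^sup>2)"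
  unfolding norm_L2_sq cinner_L2_of[OF assms assms] complex_norm_square[symmetric]
  by (simp only: of_real_power[symmetric] integral_complex_of_real Re_complex_of_real)

lemma L2_fun_nn_integral:
  assumes [measurable]: "f \<in> borel_measurable borel" and C: "C \<ge> 0"
    and le: "(\<integral>\<^sup>+z. ennreal ((cmod (f z))\<^sup>2) \<partial>circle_measure) \<le> ennreal (C\<^sup>2)"
  shows "f \<in> L2_fun" "norm (L2_of f) \<le> C"
proof -
  have int: "integrable circle_measure (\<lambda>z. (cmod (f z))\<^sup>2)"
    using le by (intro integrableI_bounded) (auto simp: top.extremum_strict intro: le_less_trans)
  then show f: "f \<in> L2_fun" by (simp add: L2_fun_def)
  have "ennreal ((norm (L2_of f))\<^sup>2) \<le> ennreal (C\<^sup>2)"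
    using le nn_integral_eq_integral[OF int] by (simp add: norm_L2_of_sq[OF f])
  then have "(norm (L2_of f))\<^sup>2 \<le> C\<^sup>2" by (subst (asm) ennreal_le_iff) auto
  then show "norm (L2_of f) \<le> C" using C by (rule power2_le_imp_le)
qed

lemma nn_integral_L2_fun:
  assumes "f \<in> L2_fun"
  shows "(\<integral>\<^sup>+z. ennreal ((cmod (f z))\<^sup>2) \<partial>circle_measure) = ennreal ((norm (L2_of f))\<^sup>2)"
  using nn_integral_eq_integral[OF L2_fun_integrable[OF assms]] by (simp add: norm_L2_of_sq[OF assms])

text \<open>Fatou's lemma for the squared moduli. It plays the part of weak compactness whenever a
  pointwise limit has to be shown square integrable.\<close>

lemma L2_Fatou:
  assumes g: "\<And>m::nat. g m \<in> L2_fun" and le: "\<And>m. norm (L2_of (g m)) \<le> C"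
    and G [measurable]: "G \<in> borel_measurable borel"
    and lim: "AE z in circle_measure. (\<lambda>m. g m z) \<longlonglongrightarrow> G z"
  shows "G \<in> L2_fun" "norm (L2_of G) \<le> C"
proof -
  have [measurable]: "g m \<in> borel_measurable borel" for m by (rule L2_fun_borel[OF g])
  have C: "C \<ge> 0" using le[of 0] norm_ge_zero order_trans by blast
  have "(\<integral>\<^sup>+z. ennreal ((cmod (G z))\<^sup>2) \<partial>circle_measure)
      = (\<integral>\<^sup>+z. liminf (\<lambda>m. ennreal ((cmod (g m z))\<^sup>2)) \<partial>circle_measure)"
  proof (rule nn_integral_cong_AE)
    show "AE z in circle_measure. ennreal ((cmod (G z))\<^sup>2) = liminf (\<lambda>m. ennreal ((cmod (g m z))\<^sup>2))"
      using lim
    proof eventually_elim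
      case (elim z)
      have "(\<lambda>m. ennreal ((cmod (g m z))\<^sup>2)) \<longlonglongrightarrow> ennreal ((cmod (G z))\<^sup>2)"
        using elim by (intro tendsto_intros)
      then show ?case using lim_imp_Liminf[OF sequentially_bot] by metis
    qed
  qed
  also have "\<dots> \<le> liminf (\<lambda>m. (\<integral>\<^sup>+z. ennreal ((cmod (g m z))\<^sup>2) \<partial>circle_measure))"
    by (rule nn_integral_liminf) measurable
  also have "\<dots> \<le> ennreal (C\<^sup>2)"
  proof (rule Liminf_le)
    show "sequentially \<noteq> bot" by simp
    show "eventually (\<lambda>m. (\<integral>\<^sup>+z. ennreal ((cmod (g m z))\<^sup>2) \<partial>circle_measure) \<le> ennreal (C\<^sup>2)) sequentially"
      using le by (intro always_eventually allI) (simp add: nn_integral_L2_fun[OF g] ennreal_leI power_mono)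
  qed
  finally have *: "(\<integral>\<^sup>+z. ennreal ((cmod (G z))\<^sup>2) \<partial>circle_measure) \<le> ennreal (C\<^sup>2)" .
  show "G \<in> L2_fun" "norm (L2_of G) \<le> C"
    using L2_fun_nn_integral[OF G C *] by auto
qed

lemma norm_L2_of_one: "norm (L2_of (\<lambda>_. 1)) = 1"
proof -
  have "(norm (L2_of (\<lambda>_. 1)))\<^sup>2 = 1"
    by (subst norm_L2_of_sq) (auto simp: L2_fun_def)
  then show ?thesis using norm_ge_zero[of "L2_of (\<lambda>_. 1)"] by (auto simp: power2_eq_1_iff simp del: norm_ge_zero)
qed

lemma L2_Cauchy_Schwarz_integral:
  assumes u: "u \<in> L2_fun" and v: "v \<in> L2_fun"
  shows "integrable circle_measure (\<lambda>\<zeta>. cmod (u \<zeta>) * cmod (v \<zeta>))"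
    and "(LINT \<zeta>|circle_measure. cmod (u \<zeta>) * cmod (v \<zeta>)) \<le> norm (L2_of u) * norm (L2_of v)"
proof -
  have abs: "(\<lambda>z. complex_of_real (cmod (f z))) \<in> L2_fun" "norm (L2_of (\<lambda>z. complex_of_real (cmod (f z)))) = norm (L2_of f)"
    if f: "f \<in> L2_fun" for f
  proof -
    have [measurable]: "f \<in> borel_measurable borel" by (rule L2_fun_borel[OF f])
    have "(\<lambda>z. complex_of_real (cmod (f z))) \<in> borel_measurable circle_measure" by measurable
    then show a: "(\<lambda>z. complex_of_real (cmod (f z))) \<in> L2_fun" using L2_fun_integrable[OF f] by (simp add: L2_fun_def)
    have "(norm (L2_of (\<lambda>z. complex_of_real (cmod (f z)))))\<^sup>2 = (norm (L2_of f))\<^sup>2"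
      by (simp add: norm_L2_of_sq a f)
    then show "norm (L2_of (\<lambda>z. complex_of_real (cmod (f z)))) = norm (L2_of f)" by (simp add: power2_eq_iff_nonneg)
  qed
  show "integrable circle_measure (\<lambda>\<zeta>. cmod (u \<zeta>) * cmod (v \<zeta>))"
    using integrable_norm[OF L2_fun_integrable_mult_cnj[OF u v]] by (simp add: norm_mult)
  have "cinner_L2 (L2_of (\<lambda>z. complex_of_real (cmod (u z)))) (L2_of (\<lambda>z. complex_of_real (cmod (v z))))
      = of_real (LINT \<zeta>|circle_measure. cmod (u \<zeta>) * cmod (v \<zeta>))"
    unfolding cinner_L2_of[OF abs(1)[OF u] abs(1)[OF v]] by (simp flip: of_real_mult)
  then show "(LINT \<zeta>|circle_measure. cmod (u \<zeta>) * cmod (v \<zeta>)) \<le> norm (L2_of u) * norm (L2_of v)"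
    using cinner_Cauchy_Schwarz[of "L2_of (\<lambda>z. complex_of_real (cmod (u z)))" "L2_of (\<lambda>z. complex_of_real (cmod (v z)))"]
    by (simp add: abs u v)
qed

lemma L2_fun_integrable_norm:
  assumes "f \<in> L2_fun"
  shows "integrable circle_measure f" "(LINT z|circle_measure. cmod (f z)) \<le> norm (L2_of f)"
proof -
  have one: "(\<lambda>_. 1) \<in> L2_fun" by (simp add: L2_fun_def)
  show "integrable circle_measure f" using L2_fun_integrable_mult_cnj[OF assms one] by simp
  show "(LINT z|circle_measure. cmod (f z)) \<le> norm (L2_of f)"
    using L2_Cauchy_Schwarz_integral(2)[OF assms one] by (simp add: norm_L2_of_one)
qed

text \<open>Riesz-Fischer: along a subsequence with distances below \<open>(1/2)^n\<close> the sum
  of the increments has finite integral, so it converges almost everywhere, and Fatou turns the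
  pointwise limit into a limit in norm.\<close>

instance L2_circle :: complete_space
proof
  fix X :: "nat \<Rightarrow> L2_circle" assume X: "Cauchy X"
  have "\<forall>n. \<exists>M. \<forall>a\<ge>M. \<forall>b\<ge>M. norm (X a - X b) < (1/2) ^ n"
    using X unfolding Cauchy_iff by (metis zero_less_power zero_less_divide_1_iff zero_less_numeral)
  then obtain M where M: "\<And>n a b. a \<ge> M n \<Longrightarrow> b \<ge> M n \<Longrightarrow> norm (X a - X b) < (1/2) ^ n" by metis
  \<comment> \<open>A sum of thresholds dominates each of them, in whatever order they come.\<close>
  define r where "r n = (\<Sum>i\<le>n. M i)" for n
  have r_ge: "r m \<ge> M n" if "m \<ge> n" for m n
    unfolding r_def using that by (intro member_le_sum) auto
  define f where "f n = fn (X (r n))" for n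
  have f: "f n \<in> L2_fun" for n by (simp add: f_def)
  have [measurable]: "f n \<in> borel_measurable borel" for n by (simp add: f_def)
  have close: "norm (L2_of (\<lambda>z. f a z - f b z)) \<le> (1/2) ^ n" if "a \<ge> n" "b \<ge> n" for a b n
    using M[OF r_ge[OF that(1)] r_ge[OF that(2)]] by (simp add: L2_of_diff f f_def[symmetric]) (simp add: f_def)
  define d where "d n z = cmod (f (Suc n) z - f n z)" for n z
  have d_meas [measurable]: "d n \<in> borel_measurable borel" for n unfolding d_def by measurable
  have d_int: "(\<integral>\<^sup>+z. ennreal (d n z) \<partial>circle_measure) \<le> ennreal ((1/2) ^ n)" for n
  proof -
    have L: "(\<lambda>z. f (Suc n) z - f n z) \<in> L2_fun" using f by (intro L2_fun_diff)
    have "(\<integral>\<^sup>+z. ennreal (d n z) \<partial>circle_measure) = ennreal (LINT z|circle_measure. d n z)"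
      unfolding d_def by (intro nn_integral_eq_integral integrable_norm L2_fun_integrable_norm(1)[OF L]) auto
    also have "\<dots> \<le> ennreal ((1/2) ^ n)"
      unfolding d_def by (intro ennreal_leI order_trans[OF L2_fun_integrable_norm(2)[OF L]] close) auto
    finally show ?thesis .
  qed
  have "(\<integral>\<^sup>+z. (\<Sum>n. ennreal (d n z)) \<partial>circle_measure) = (\<Sum>n. \<integral>\<^sup>+z. ennreal (d n z) \<partial>circle_measure)"
    by (rule nn_integral_suminf) measurable
  also have "\<dots> \<le> (\<Sum>n. ennreal ((1/2) ^ n))" by (intro suminf_le d_int) auto
  also have "\<dots> = ennreal (\<Sum>n. (1/2) ^ n)"
    by (rule suminf_ennreal2) (auto intro: summable_geometric)
  finally have "(\<integral>\<^sup>+z. (\<Sum>n. ennreal (d n z)) \<partial>circle_measure) \<noteq> \<infinity>"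
    by (auto simp: top_unique)
  then have "AE z in circle_measure. (\<Sum>n. ennreal (d n z)) \<noteq> \<infinity>"
    by (intro nn_integral_PInf_AE) measurable
  then have conv: "AE z in circle_measure. (\<lambda>n. f n z) \<longlonglongrightarrow> lim (\<lambda>n. f n z)"
  proof eventually_elim
    case (elim z)
    have "summable (\<lambda>n. d n z)"
      using elim by (intro summable_suminf_not_top) (auto simp: d_def)
    then have "summable (\<lambda>n. f (Suc n) z - f n z)" unfolding d_def by (rule summable_norm_cancel)
    then have "(\<lambda>n. (\<Sum>i<n. f (Suc i) z - f i z) + f 0 z) \<longlonglongrightarrow> (\<Sum>n. f (Suc n) z - f n z) + f 0 z"
      by (intro tendsto_intros summable_LIMSEQ)
    moreover have "(\<Sum>i<n. f (Suc i) z - f i z) + f 0 z = f n z" for n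
      using sum_lessThan_telescope[of "\<lambda>i. f i z" n] by simp
    ultimately have "convergent (\<lambda>n. f n z)" by (auto simp: convergent_def)
    then show ?case by (simp add: convergent_LIMSEQ_iff)
  qed
  define G where "G z = lim (\<lambda>n. f n z)" for z
  have G [measurable]: "G \<in> borel_measurable borel" unfolding G_def by measurable
  have near: "(\<lambda>z. G z - f n z) \<in> L2_fun" "norm (L2_of (\<lambda>z. G z - f n z)) \<le> (1/2) ^ n" for n
  proof (rule_tac [!] L2_Fatou[where g = "\<lambda>m z. f (m + n) z - f n z"])
    show "AE z in circle_measure. (\<lambda>m. f (m + n) z - f n z) \<longlonglongrightarrow> G z - f n z"
      using conv
    proof eventually_elim
      case (elim z)
      from LIMSEQ_ignore_initial_segment[OF elim, of n] show ?case
        unfolding G_def by (intro tendsto_intros)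
    qed
    then show "AE z in circle_measure. (\<lambda>m. f (m + n) z - f n z) \<longlonglongrightarrow> G z - f n z" .
  qed (auto intro!: L2_fun_diff f close)
  have GL: "G \<in> L2_fun" using L2_fun_add[OF near(1)[of 0] f[of 0]] by simp
  have near': "norm (L2_of G - X (r n)) \<le> (1/2) ^ n" for n
    using near(2)[of n] by (simp add: L2_of_diff GL f) (simp add: f_def)
  have "X \<longlonglongrightarrow> L2_of G"
  proof (rule LIMSEQ_I)
    fix e :: real assume "e > 0"
    then obtain n where n: "(1/2) ^ n < e / 2" using real_arch_pow_inv[of "e/2" "1/2"] by auto
    have "norm (X a - L2_of G) < e" if "a \<ge> M n" for a
    proof -
      have "norm (X a - L2_of G) \<le> norm (X a - X (r n)) + norm (L2_of G - X (r n))"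
        using norm_triangle_ineq4[of "X a - X (r n)" "L2_of G - X (r n)"] by simp
      also have "\<dots> < e" using M[OF that r_ge[OF order_refl]] near'[of n] n by linarith
      finally show ?thesis .
    qed
    then show "\<exists>no. \<forall>a\<ge>no. norm (X a - L2_of G) < e" by blast
  qed
  then show "convergent X" by (auto simp: convergent_def)
qed

subsection \<open>Fourier monomials\<close>

definition zpow :: "int \<Rightarrow> L2_circle" where
  "zpow n = L2_of (\<lambda>z. z powi n)"

lemma AE_circle_cnj: "AE z in circle_measure. cnj z = inverse z"
  using AE_circle_norm by eventually_elim (metis complex_norm_square inverse_unique of_real_1 power_one)

lemma cnj_powi: "cmod z = 1 \<Longrightarrow> cnj (z powi n) = z powi (- n)"
  by (metis complex_cnj_power_int complex_norm_square inverse_unique of_real_1 power_one power_int_inverse power_int_minus)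

lemma fourier_coeff_L2_eq: "fourier_coeff_L2 x n = cinner_L2 x (zpow n)"
proof -
  have "fourier_coeff_L2 x n = fourier_coeff (fn x) n"
    using fourier_coeff_L2.abs_eq[of "fn x"] by (simp add: L2_rel_refl)
  also have "\<dots> = cinner_L2 (L2_of (fn x)) (zpow n)"
    unfolding fourier_coeff_def zpow_def by (subst cinner_L2_of) (auto simp: Linf_fun_L2 Linf_fun_powi)
  finally show ?thesis by simp
qed

lemma fourier_coeff_L2_of: "f \<in> L2_fun \<Longrightarrow> fourier_coeff f n = cinner_L2 (L2_of f) (zpow n)"
  unfolding fourier_coeff_def zpow_def by (subst cinner_L2_of) (auto simp: Linf_fun_L2 Linf_fun_powi)

lemma cinner_zpow_zpow: "cinner_L2 (zpow m) (zpow n) = (if m = n then 1 else 0)"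
proof -
  have "cinner_L2 (zpow m) (zpow n) = (LINT z|circle_measure. z powi m * cnj (z powi n))"
    unfolding zpow_def by (rule cinner_L2_of) (auto simp: Linf_fun_L2 Linf_fun_powi)
  also have "\<dots> = (LINT z|circle_measure. z powi (m - n))"
  proof (rule integral_cong_AE)
    show "AE z in circle_measure. z powi m * cnj (z powi n) = z powi (m - n)"
      using AE_circle_norm
    proof eventually_elim
      case (elim z)
      then have "z \<noteq> 0" by auto
      then show ?case using elim by (subst cnj_powi) (auto simp: power_int_add[symmetric])
    qed
  qed auto
  finally show ?thesis by (simp add: integral_circle_powi)
qed

lemma mult_powi_zpow: "mult_L2 (\<lambda>z. z powi k) (zpow n) = zpow (k + n)"
proof -
  have "AE z in circle_measure. z powi k * z powi n = z powi (k + n)"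
    using AE_circle_neq[of 0] by eventually_elim (simp add: power_int_add)
  then show ?thesis
    unfolding zpow_def by (subst mult_L2_of) (auto simp: Linf_fun_powi Linf_fun_L2 L2_of_eq_iff L2_fun_mult)
qed

abbreviation Zop :: "L2_circle \<Rightarrow> L2_circle" where
  "Zop \<equiv> mult_L2 (\<lambda>z. z)"

lemma Zop_zpow: "Zop (zpow n) = zpow (n + 1)"
  using mult_powi_zpow[of 1 n] by (simp add: add.commute)

lemma cinner_Zop_zpow: "cinner_L2 (Zop x) (zpow n) = cinner_L2 x (zpow (n - 1))"
proof -
  have "cinner_L2 (Zop x) (Zop (zpow (n - 1))) = cinner_L2 x (zpow (n - 1))"
    by (rule cinner_unimodular_mult[OF unimodular_id])
  then show ?thesis by (simp add: Zop_zpow)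
qed

lemma mult_L2_commute: "u \<in> Linf_fun \<Longrightarrow> v \<in> Linf_fun \<Longrightarrow> mult_L2 u (mult_L2 v x) = mult_L2 v (mult_L2 u x)"
  by (simp add: mult_L2_mult mult.commute)

section \<open>Bessel's inequality and uniqueness of Fourier coefficients\<close>

lemma Bessel_inequality:
  assumes "finite F" and orth: "\<And>i j. i \<in> F \<Longrightarrow> j \<in> F \<Longrightarrow> cinner_L2 (e i) (e j) = (if i = j then 1 else 0)"
  shows "(\<Sum>i\<in>F. (cmod (cinner_L2 x (e i)))\<^sup>2) \<le> (norm x)\<^sup>2"
proof -
  define y where "y = (\<Sum>i\<in>F. cinner_L2 x (e i) *\<^sub>C e i)"
  have suml: "cinner_L2 (\<Sum>i\<in>G. g i) h = (\<Sum>i\<in>G. cinner_L2 (g i) h)" if "finite G" for G h and g :: "'a \<Rightarrow> L2_circle"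
    using that by induction (auto simp: cinner_simps)
  have sumr: "cinner_L2 h (\<Sum>i\<in>G. g i) = (\<Sum>i\<in>G. cinner_L2 h (g i))" if "finite G" for G h and g :: "'a \<Rightarrow> L2_circle"
    using that by induction (auto simp: cinner_simps)
  let ?S = "\<Sum>i\<in>F. (cmod (cinner_L2 x (e i)))\<^sup>2"
  have sq: "(complex_of_real (cmod c))\<^sup>2 = c * cnj c" for c
    using complex_norm_square[of c] by simp
  have xy: "cinner_L2 x y = of_real ?S"
    unfolding y_def sumr[OF assms(1)] by (simp add: cinner_L2_scaleC_right sq mult.commute)
  have ye: "cinner_L2 y (e j) = cinner_L2 x (e j)" if "j \<in> F" for j
  proof -
    have "cinner_L2 y (e j) = (\<Sum>i\<in>F. if i = j then cinner_L2 x (e j) else 0)"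
      unfolding y_def suml[OF assms(1)] by (intro sum.cong) (auto simp: cinner_L2_scaleC_left orth that)
    then show ?thesis using that assms(1) by simp
  qed
  have yy: "cinner_L2 y y = of_real ?S"
  proof -
    have "cinner_L2 y y = (\<Sum>i\<in>F. cnj (cinner_L2 x (e i)) * cinner_L2 y (e i))"
      by (subst (2) y_def) (simp add: sumr[OF assms(1)] cinner_L2_scaleC_right)
    also have "\<dots> = of_real ?S" by (simp add: ye sq mult.commute)
    finally show ?thesis .
  qed
  have "0 \<le> Re (cinner_L2 (x - y) (x - y))" using norm_L2_sq[of "x - y"] by (metis zero_le_power2)
  also have "\<dots> = Re (cinner_L2 x x) - Re (cinner_L2 x y) - Re (cinner_L2 y x) + Re (cinner_L2 y y)"
    by (simp add: cinner_simps)
  also have "Re (cinner_L2 y x) = Re (cinner_L2 x y)" by (subst cinner_L2_commute) simp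
  finally show ?thesis unfolding xy yy norm_L2_sq by simp
qed

text \<open>The form in which Bessel's inequality is applied below: a coefficient whose modulus is
  dominated by the moduli along an infinite orthonormal sequence must vanish.\<close>

lemma Bessel_const_modulus:
  fixes e :: "nat \<Rightarrow> L2_circle"
  assumes orth: "\<And>i j. cinner_L2 (e i) (e j) = (if i = j then 1 else 0)"
    and "\<And>i. cmod (cinner_L2 x (e i)) \<ge> a"
  shows "a \<le> 0"
proof (rule ccontr)
  assume "\<not> a \<le> 0"
  then have a: "a\<^sup>2 > 0" "a > 0" by auto
  obtain N where N: "(norm x)\<^sup>2 / a\<^sup>2 < real N" using reals_Archimedean2 by blast
  have "real N * a\<^sup>2 = (\<Sum>i<N. a\<^sup>2)" by simp
  also have "\<dots> \<le> (\<Sum>i<N. (cmod (cinner_L2 x (e i)))\<^sup>2)" using a assms(2) by (intro sum_mono power_mono) auto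
  also have "\<dots> \<le> (norm x)\<^sup>2" using orth by (intro Bessel_inequality) auto
  finally show False using N a by (simp add: field_simps)
qed

text \<open>On the circle a polynomial in the real and imaginary parts is a Laurent polynomial in
  \<open>z\<close>, and multiplication by a monomial only shifts Fourier coefficients.
  Stone-Weierstrass needs it for real polynomials.\<close>

lemma real_polynomial_preserves_null:
  assumes "real_polynomial_function p"
  shows "(\<lambda>z. of_real (p z)) \<in> Linf_fun \<and>
    (\<forall>x. (\<forall>n. cinner_L2 x (zpow n) = 0) \<longrightarrow> (\<forall>n. cinner_L2 (mult_L2 (\<lambda>z. of_real (p z)) x) (zpow n) = 0))"
  using assms
proof induction
  case (linear f)
  interpret bounded_linear f by fact
  \<comment> \<open>The Wirtinger coefficients of the real-linear \<open>f\<close>; on the circle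
    \<open>cnj z\<close> is then replaced by \<open>z powi -1\<close>.\<close>
  define a where "a = (of_real (f 1) - \<i> * of_real (f \<i>)) / 2"
  define b where "b = (of_real (f 1) + \<i> * of_real (f \<i>)) / 2"
  have eq: "of_real (f z) = a * z + b * cnj z" for z
  proof -
    have "z = Re z *\<^sub>R 1 + Im z *\<^sub>R \<i>" by (simp add: complex_eq_iff)
    then have "f z = Re z * f 1 + Im z * f \<i>" by (metis add scaleR real_scaleR_def)
    then show ?thesis by (simp add: a_def b_def complex_eq_iff field_simps)
  qed
  have L: "(\<lambda>z. a * z + b * cnj z) \<in> Linf_fun" by (intro Linf_fun_intros)
  define k l :: int where "k = 1" and "l = -1"
  have ae: "AE z in circle_measure. a * z + b * cnj z = a * z powi k + b * z powi l"
    using AE_circle_cnj by eventually_elim (simp add: k_def l_def power_int_minus)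
  have m: "mult_L2 (\<lambda>z. a * z + b * cnj z) x = a *\<^sub>C mult_L2 (\<lambda>z. z powi k) x + b *\<^sub>C mult_L2 (\<lambda>z. z powi l) x" for x
    by (subst mult_L2_cong[OF L _ ae])
       (simp_all add: mult_L2_add_symbol mult_L2_scale_symbol Linf_fun_powi Linf_fun_mult Linf_fun_const Linf_fun_add)
  have sh: "cinner_L2 (mult_L2 (\<lambda>z. z powi k) x) (zpow n) = cinner_L2 x (zpow (n - k))" for k x n
    using cinner_unimodular_mult[OF unimodular_powi, of k x "zpow (n - k)"] by (simp add: mult_powi_zpow)
  show ?case unfolding eq using L by (auto simp: m cinner_simps sh)
next
  case (const c)
  show ?case by (auto simp: mult_L2_const cinner_simps Linf_fun_const)
next
  case (add f g)
  then show ?case by (auto simp: mult_L2_add_symbol cinner_simps Linf_fun_add)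
next
  case (mult f g)
  then show ?case by (auto simp: mult_L2_mult[symmetric] Linf_fun_mult)
qed

lemma continuous_Linf:
  assumes "continuous_on UNIV (\<phi> :: complex \<Rightarrow> complex)"
  shows "\<phi> \<in> Linf_fun"
proof -
  have "compact (\<phi> ` sphere 0 1)" using assms by (intro compact_continuous_image) (auto intro: continuous_on_subset)
  then obtain B where "\<forall>y\<in>\<phi> ` sphere 0 1. norm y \<le> B" using compact_imp_bounded bounded_iff by blast
  then have B: "norm (\<phi> z) \<le> B" if "norm z = 1" for z using that by auto
  show ?thesis using AE_circle_norm
    by (intro Linf_funI[where C = B] borel_measurable_continuous_onI assms) (auto elim!: eventually_mono simp: B)
qed

lemma continuous_mult_null:
  fixes \<phi> :: "complex \<Rightarrow> real"
  assumes c: "continuous_on UNIV \<phi>" and x: "\<And>n. cinner_L2 x (zpow n) = 0"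
  shows "cinner_L2 (mult_L2 (\<lambda>z. of_real (\<phi> z)) x) (zpow 0) = 0"
proof (rule ccontr)
  have cL: "(\<lambda>z. of_real (\<phi> z)) \<in> Linf_fun" using c by (intro continuous_Linf continuous_intros)
  let ?a = "cinner_L2 (mult_L2 (\<lambda>z. of_real (\<phi> z)) x) (zpow 0)"
  assume "?a \<noteq> 0"
  \<comment> \<open>An error \<open>e * norm x\<close> stays below half of the supposedly non-zero
    value; the summand 1 covers \<open>x = 0\<close>.\<close>
  define e where "e = cmod ?a / (2 * (norm x + 1))"
  have e: "e > 0" using \<open>?a \<noteq> 0\<close> by (auto simp: e_def intro!: divide_pos_pos add_nonneg_pos)
  obtain p where p: "real_polynomial_function p" "\<And>z. z \<in> sphere 0 1 \<Longrightarrow> \<bar>\<phi> z - p z\<bar> < e"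
    using Stone_Weierstrass_real_polynomial_function[of "sphere 0 1" \<phi> e] c e continuous_on_subset by (metis compact_sphere subset_UNIV)
  note pp = real_polynomial_preserves_null[OF p(1)]
  have d: "(\<lambda>z. of_real (\<phi> z) - of_real (p z)) \<in> Linf_fun" using cL pp by (intro Linf_fun_diff) auto
  have "?a = cinner_L2 (mult_L2 (\<lambda>z. of_real (\<phi> z) - of_real (p z)) x) (zpow 0)"
    using pp x by (subst mult_L2_diff_symbol[OF cL]) (auto simp: cinner_simps)
  then have "cmod ?a \<le> norm (mult_L2 (\<lambda>z. of_real (\<phi> z) - of_real (p z)) x) * norm (zpow 0)"
    by (metis cinner_Cauchy_Schwarz)
  also have "norm (zpow 0) = 1" using norm_L2_of_one by (simp add: zpow_def)
  also have "norm (mult_L2 (\<lambda>z. of_real (\<phi> z) - of_real (p z)) x) \<le> e * norm x"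
  proof (rule norm_mult_L2_le[OF d])
    show "AE z in circle_measure. cmod (of_real (\<phi> z) - of_real (p z)) \<le> e"
      using AE_circle_norm
    proof eventually_elim
      case (elim z)
      then have "\<bar>\<phi> z - p z\<bar> < e" using p(2) by simp
      then show ?case by (metis less_imp_le norm_of_real of_real_diff)
    qed
  qed (use e in auto)
  finally have "cmod ?a \<le> e * norm x" by simp
  also have "\<dots> \<le> cmod ?a / 2"
  proof -
    have np: "norm x + 1 > 0" by (simp add: add_nonneg_pos)
    have "e * (norm x + 1) = cmod ?a / 2" using np by (simp add: e_def field_simps)
    then show ?thesis using e by (simp add: distrib_left)
  qed
  finally show False using \<open>?a \<noteq> 0\<close> by simp
qed

text \<open>Integrals of \<open>x\<close> against continuous weights vanish, hence those over closed
  sets, hence by the pi-lambda theorem those over all Borel sets, and this forces the integrand to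
  be zero almost everywhere.\<close>

theorem fourier_uniqueness:
  assumes x: "\<And>n. cinner_L2 x (zpow n) = 0"
  shows "x = 0"
proof -
  let ?f = "fn x"
  have int: "integrable circle_measure ?f" by (rule L2_fun_integrable_norm(1)) simp
  have cont: "(LINT z|circle_measure. \<phi> z *\<^sub>R ?f z) = 0" if c: "continuous_on UNIV \<phi>" for \<phi> :: "complex \<Rightarrow> real"
  proof -
    have cL: "(\<lambda>z. of_real (\<phi> z)) \<in> Linf_fun" using c by (intro continuous_Linf continuous_intros)
    have "0 = cinner_L2 (mult_L2 (\<lambda>z. of_real (\<phi> z)) x) (zpow 0)" using continuous_mult_null[OF c x] by simp
    also have "mult_L2 (\<lambda>z. of_real (\<phi> z)) x = L2_of (\<lambda>z. of_real (\<phi> z) * ?f z)"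
      using mult_L2_of[OF cL, of ?f] by simp
    also have "cinner_L2 \<dots> (zpow 0) = (LINT z|circle_measure. of_real (\<phi> z) * ?f z)"
      unfolding zpow_def using cL by (subst cinner_L2_of) (auto intro!: L2_fun_mult simp: Linf_fun_L2 Linf_fun_const)
    finally show ?thesis by (simp add: scaleR_conv_of_real)
  qed
  have closed: "set_lebesgue_integral circle_measure A ?f = 0" if A: "closed A" for A
  proof (cases "A = {}")
    case False
    have [measurable]: "A \<in> sets borel" using A by auto
    have [measurable]: "(\<lambda>z. infdist z A) \<in> borel_measurable borel"
      by (intro borel_measurable_continuous_onI continuous_intros)
    \<comment> \<open>Truncated multiples of the distance to \<open>A\<close> are continuous and
      decrease to the indicator of the closed set.\<close>
    have "(\<lambda>k. LINT z|circle_measure. max 0 (1 - real k * infdist z A) *\<^sub>R ?f z) \<longlonglongrightarrow> (LINT z|circle_measure. indicator A z *\<^sub>R ?f z)"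
    proof (rule integral_dominated_convergence[where w = "\<lambda>z. cmod (?f z)"])
      show "AE z in circle_measure. (\<lambda>k. max 0 (1 - real k * infdist z A) *\<^sub>R ?f z) \<longlonglongrightarrow> indicator A z *\<^sub>R ?f z"
      proof (rule AE_I2, rule tendsto_scaleR[OF _ tendsto_const])
        fix z
        show "(\<lambda>k. max 0 (1 - real k * infdist z A)) \<longlonglongrightarrow> indicator A z"
        proof (cases "z \<in> A")
          case True then show ?thesis by simp
        next
          case z: False
          have pos: "infdist z A > 0" using infdist_pos_not_in_closed[OF A False z] .
          obtain N where N: "1 / infdist z A < real N" using reals_Archimedean2 by blast
          have "max 0 (1 - real k * infdist z A) = 0" if "k \<ge> N" for k
          proof -
            have "1 < real N * infdist z A" using N pos by (simp add: field_simps)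
            also have "\<dots> \<le> real k * infdist z A" using that pos by (intro mult_right_mono) auto
            finally show ?thesis by simp
          qed
          then have "eventually (\<lambda>k. max 0 (1 - real k * infdist z A) = 0) sequentially"
            using eventually_sequentially by blast
          then show ?thesis using z by (simp add: tendsto_eventually)
        qed
      qed
      show "AE z in circle_measure. norm (max 0 (1 - real k * infdist z A) *\<^sub>R ?f z) \<le> cmod (?f z)" for k
        by (rule AE_I2) (auto simp: infdist_nonneg intro!: mult_left_le_one_le)
    qed (use int in \<open>auto intro: integrable_norm\<close>)
    moreover have "(LINT z|circle_measure. max 0 (1 - real k * infdist z A) *\<^sub>R ?f z) = 0" for k
      by (rule cont) (intro continuous_intros)
    ultimately have "(\<lambda>k::nat. 0) \<longlonglongrightarrow> (LINT z|circle_measure. indicator A z *\<^sub>R ?f z)" by simp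
    then show ?thesis unfolding set_lebesgue_integral_def
      using LIMSEQ_unique[OF tendsto_const] by metis
  qed (simp add: set_lebesgue_integral_def)
  have si: "set_integrable circle_measure A ?f" if "A \<in> sets borel" for A
    using int that unfolding set_integrable_def by (intro integrable_mult_indicator) auto
  have all: "set_lebesgue_integral circle_measure A ?f = 0" if "A \<in> sets borel" for A
  proof -
    have sets: "sets borel = sigma_sets UNIV (Collect closed :: complex set set)"
      by (simp add: borel_eq_closed)
    have "Int_stable (Collect closed :: complex set set)" "Collect closed \<subseteq> Pow (UNIV :: complex set)"
      "A \<in> sigma_sets UNIV (Collect closed)" using that sets by (auto simp: Int_stable_def)
    then show ?thesis
    proof (induction rule: sigma_sets_induct_disjoint)
      case (basic A) then show ?case using closed by simp
    next
      case empty then show ?case by (simp add: set_lebesgue_integral_def)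
    next
      case (compl A)
      have A: "A \<in> sets borel" using compl(1) sets by simp
      have "set_lebesgue_integral circle_measure (A \<union> (UNIV - A)) ?f
          = set_lebesgue_integral circle_measure A ?f + set_lebesgue_integral circle_measure (UNIV - A) ?f"
        using A by (intro set_integral_Un si) auto
      then show ?case using compl(2) closed[of UNIV] by simp
    next
      case (union A)
      have A: "A i \<in> sets borel" for i using union(2) sets by auto
      have "set_lebesgue_integral circle_measure (\<Union>i. A i) ?f = (\<Sum>i. set_lebesgue_integral circle_measure (A i) ?f)"
        using union(1) A by (intro lebesgue_integral_countable_add si) (auto simp: disjoint_family_on_def)
      then show ?case using union(3) by simp
    qed
  qed
  have "AE z in circle_measure. ?f z = 0"
    by (rule circle.density_zero[OF int]) (use all in simp)
  then have "L2_of ?f = L2_of (\<lambda>_. 0)" by (subst L2_of_eq_iff) (auto simp: L2_fun_zero)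
  then show "x = 0" by (simp only: L2_of_fn zero_L2_circle_def)
qed

subsection \<open>The Hardy space\<close>

lemma Hardy2_iff: "x \<in> Hardy2 \<longleftrightarrow> (\<forall>n<0. cinner_L2 x (zpow n) = 0)"
  by (simp add: Hardy2_def fourier_coeff_L2_eq)

lemma Hardy2_intros:
  "0 \<in> Hardy2" "x \<in> Hardy2 \<Longrightarrow> y \<in> Hardy2 \<Longrightarrow> x + y \<in> Hardy2"
  "x \<in> Hardy2 \<Longrightarrow> c *\<^sub>C x \<in> Hardy2" "x \<in> Hardy2 \<Longrightarrow> y \<in> Hardy2 \<Longrightarrow> x - y \<in> Hardy2"
  by (auto simp: Hardy2_iff cinner_simps)

lemma zpow_Hardy2: "n \<ge> 0 \<Longrightarrow> zpow n \<in> Hardy2"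
  by (auto simp: Hardy2_iff cinner_zpow_zpow)

lemma Zop_Hardy2: "x \<in> Hardy2 \<Longrightarrow> Zop x \<in> Hardy2"
  by (auto simp: Hardy2_iff cinner_Zop_zpow)

lemma closed_cinner_zero: "closed {x. cinner_L2 x y = 0}"
  by (intro closed_Collect_eq continuous_intros)

lemma closed_Hardy2: "closed Hardy2"
proof -
  have eq: "Hardy2 = (\<Inter>n\<in>{..<0}. {x. cinner_L2 x (zpow n) = 0})" by (auto simp: Hardy2_iff)
  show ?thesis unfolding eq by (intro closed_INT ballI closed_cinner_zero)
qed

text \<open>The non-negative monomials span a dense subspace: the part of \<open>x\<close>
  orthogonal to \<open>S \<inter> Hardy2\<close> has no Fourier coefficient left. Put as an
  induction rule, it lets identities on the Hardy space be checked on monomials.\<close>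

lemma Hardy2_induct [consumes 1, case_names closed zero add scale monomial]:
  assumes "x \<in> Hardy2" and S: "closed S" "0 \<in> S" "\<And>x y. x \<in> S \<Longrightarrow> y \<in> S \<Longrightarrow> x + y \<in> S"
    "\<And>c x. x \<in> S \<Longrightarrow> c *\<^sub>C x \<in> S" and mono: "\<And>n. n \<ge> 0 \<Longrightarrow> zpow n \<in> S"
  shows "x \<in> S"
proof -
  have sub: "subspace (S \<inter> Hardy2)"
    by (auto intro!: subspaceI S Hardy2_intros simp: scaleR_L2_circle_def)
  obtain p where p: "p \<in> S \<inter> Hardy2" and orth: "\<And>y. y \<in> S \<inter> Hardy2 \<Longrightarrow> inner (x - p) y = 0"
    using orthogonal_projection_exists[OF closed_Int[OF S(1) closed_Hardy2] sub, of x] by blast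
  \<comment> \<open>The projection is orthogonal for the real inner product only; testing with
    \<open>\<i> *\<^sub>C y\<close> as well gives complex orthogonality.\<close>
  have corth: "cinner_L2 (x - p) y = 0" if "y \<in> S \<inter> Hardy2" for y
    using orth[OF that] orth[of "\<i> *\<^sub>C y"] that by (auto simp: complex_eq_iff Re_cinner Im_cinner S Hardy2_intros)
  have "x - p = 0"
  proof (rule fourier_uniqueness)
    fix n show "cinner_L2 (x - p) (zpow n) = 0"
    proof (cases "n < 0")
      case True
      have "x - p \<in> Hardy2" using assms(1) p by (intro Hardy2_intros) auto
      then show ?thesis using True by (auto simp: Hardy2_iff)
    qed (auto intro!: corth mono zpow_Hardy2)
  qed
  then show ?thesis using p by simp
qed

subsection \<open>Point evaluations\<close>

lemma cinner_mult_powi_zpow: "cinner_L2 (mult_L2 (\<lambda>z. z powi k) x) (zpow n) = cinner_L2 x (zpow (n - k))"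
  using cinner_unimodular_mult[OF unimodular_powi, of k x "zpow (n - k)"] by (simp add: mult_powi_zpow)

lemma norm_zpow [simp]: "norm (zpow n) = 1"
  using cinner_zpow_zpow[of n n] norm_L2_sq[of "zpow n"] norm_ge_zero[of "zpow n"]
  by (auto simp: power2_eq_1_iff simp del: norm_ge_zero)

definition szego :: "complex \<Rightarrow> L2_circle" where
  "szego z = L2_of (\<lambda>\<zeta>. 1 / (1 - cnj z * \<zeta>))"

lemma szego_symbol_Linf:
  assumes "cmod z < 1" shows "(\<lambda>\<zeta>. 1 / (1 - cnj z * \<zeta>)) \<in> Linf_fun"
proof (rule Linf_funI)
  show "AE \<zeta> in circle_measure. cmod (1 / (1 - cnj z * \<zeta>)) \<le> 1 / (1 - cmod z)"
    using AE_circle_norm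
  proof eventually_elim
    case (elim \<zeta>)
    have "1 - cmod z \<le> cmod (1 - cnj z * \<zeta>)"
      using norm_triangle_ineq2[of 1 "cnj z * \<zeta>"] elim by (simp add: norm_mult)
    then show ?case using assms by (simp add: norm_divide frac_le)
  qed
qed measurable

text \<open>Defined on all of L2: outside the Hardy space it evaluates the projection of
  \<open>x\<close> to \<open>Hardy2\<close>. Resolvents are evaluated in this way before it is known
  where they lie.\<close>

definition ev :: "complex \<Rightarrow> L2_circle \<Rightarrow> complex" where
  "ev z x = cinner_L2 x (szego z)"

lemma ev_simps: "ev z (x + y) = ev z x + ev z y" "ev z (x - y) = ev z x - ev z y"
  "ev z (c *\<^sub>C x) = c * ev z x" "ev z 0 = 0"
  by (simp_all add: ev_def cinner_simps)

text \<open>One step of the geometric series. The power series of \<open>ev\<close>, the shift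
  formula and the norm of the kernel are all read off from it.\<close>

lemma szego_rec:
  assumes "cmod z < 1" shows "szego z = zpow 0 + cnj z *\<^sub>C Zop (szego z)"
proof -
  note L = szego_symbol_Linf[OF assms]
  have "Zop (szego z) = L2_of (\<lambda>\<zeta>. \<zeta> * (1 / (1 - cnj z * \<zeta>)))"
    unfolding szego_def by (rule mult_L2_of) (auto intro: L Linf_fun_id Linf_fun_L2)
  also have "cnj z *\<^sub>C \<dots> = L2_of (\<lambda>\<zeta>. cnj z * (\<zeta> * (1 / (1 - cnj z * \<zeta>))))"
    by (rule L2_of_scale[symmetric]) (intro Linf_fun_L2 Linf_fun_mult Linf_fun_id L)
  also have "zpow 0 + \<dots> = L2_of (\<lambda>\<zeta>. \<zeta> powi 0 + cnj z * (\<zeta> * (1 / (1 - cnj z * \<zeta>))))"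
    unfolding zpow_def by (rule L2_of_add[symmetric]) (intro Linf_fun_L2 Linf_fun_intros L)+
  also have "\<dots> = szego z"
    unfolding szego_def
  proof (subst L2_of_eq_iff)
    show "AE \<zeta> in circle_measure. \<zeta> powi 0 + cnj z * (\<zeta> * (1 / (1 - cnj z * \<zeta>))) = 1 / (1 - cnj z * \<zeta>)"
      using AE_circle_norm
    proof eventually_elim
      case (elim \<zeta>)
      have "cnj z * \<zeta> \<noteq> 1"
      proof
        assume "cnj z * \<zeta> = 1"
        then have "cmod (cnj z * \<zeta>) = 1" by simp
        then show False using elim assms by (simp add: norm_mult)
      qed
      then show ?case by (simp add: field_simps)
    qed
  qed (intro Linf_fun_L2 Linf_fun_intros L)+
  finally show ?thesis by simp
qed

lemma ev_sums:
  assumes "cmod z < 1" shows "(\<lambda>n. cinner_L2 x (zpow (int n)) * z ^ n) sums ev z x"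
proof -
  have step: "cinner_L2 x (mult_L2 (\<lambda>\<zeta>. \<zeta> powi int n) (szego z))
      = cinner_L2 x (zpow (int n)) + z * cinner_L2 x (mult_L2 (\<lambda>\<zeta>. \<zeta> powi int (Suc n)) (szego z))" for n
  proof -
    have a: "mult_L2 (\<lambda>\<zeta>. \<zeta> powi int n) (Zop y) = mult_L2 (\<lambda>\<zeta>. \<zeta> powi int (Suc n)) y" for y
    proof -
      have ae: "AE z in circle_measure. z powi int n * z = z powi int (Suc n)"
        using AE_circle_neq[of 0] by eventually_elim (simp add: power_int_add)
      show ?thesis
        unfolding mult_L2_mult[OF Linf_fun_powi Linf_fun_id]
        by (rule mult_L2_cong[OF Linf_fun_mult[OF Linf_fun_powi Linf_fun_id] Linf_fun_powi ae])
    qed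
    have "mult_L2 (\<lambda>\<zeta>. \<zeta> powi int n) (szego z) = zpow (int n) + cnj z *\<^sub>C mult_L2 (\<lambda>\<zeta>. \<zeta> powi int (Suc n)) (szego z)"
      by (subst szego_rec[OF assms]) (simp only: mult_L2_add mult_L2_scaleC mult_powi_zpow a add_0_right)
    then show ?thesis by (simp add: cinner_simps)
  qed
  \<comment> \<open>The recursion used \<open>N\<close> times; monomials act isometrically, so the
    remainder is at most \<open>cmod z ^ N\<close> times a constant.\<close>
  have part: "ev z x = (\<Sum>n<N. cinner_L2 x (zpow (int n)) * z ^ n)
      + z ^ N * cinner_L2 x (mult_L2 (\<lambda>\<zeta>. \<zeta> powi int N) (szego z))" for N
  proof (induction N)
    case 0
    have "mult_L2 (\<lambda>\<zeta>. \<zeta> powi int 0) (szego z) = szego z" using mult_L2_const[of 1 "szego z"] by simp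
    then show ?case by (simp add: ev_def)
  next
    case (Suc N) then show ?case by (subst Suc, subst step) (simp add: algebra_simps)
  qed
  have "(\<lambda>N. z ^ N * cinner_L2 x (mult_L2 (\<lambda>\<zeta>. \<zeta> powi int N) (szego z))) \<longlonglongrightarrow> 0"
  proof (rule Lim_null_comparison)
    show "\<forall>\<^sub>F N in sequentially. norm (z ^ N * cinner_L2 x (mult_L2 (\<lambda>\<zeta>. \<zeta> powi int N) (szego z))) \<le> cmod z ^ N * (norm x * norm (szego z))"
      using cinner_Cauchy_Schwarz[of x "mult_L2 (\<lambda>\<zeta>. \<zeta> powi int N) (szego z)" for N]
      by (intro always_eventually allI) (simp only: norm_mult norm_power norm_unimodular_mult[OF unimodular_powi] mult_left_mono zero_le_power norm_ge_zero)
    show "(\<lambda>N. cmod z ^ N * (norm x * norm (szego z))) \<longlonglongrightarrow> 0"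
      using tendsto_mult_left_zero[OF LIMSEQ_realpow_zero[of "cmod z"]] assms by simp
  qed
  from tendsto_diff[OF tendsto_const[of "ev z x"] this]
  have "(\<lambda>N. ev z x - z ^ N * cinner_L2 x (mult_L2 (\<lambda>\<zeta>. \<zeta> powi int N) (szego z))) \<longlonglongrightarrow> ev z x"
    by (simp only: diff_zero)
  moreover have "ev z x - z ^ N * cinner_L2 x (mult_L2 (\<lambda>\<zeta>. \<zeta> powi int N) (szego z))
      = (\<Sum>n<N. cinner_L2 x (zpow (int n)) * z ^ n)" for N
    using part[of N] by (simp only: add_diff_cancel_right')
  ultimately show ?thesis unfolding sums_def by (simp only:)
qed

lemma disc_ext_eq_ev:
  assumes "f \<in> L2_fun" "cmod z < 1"
  shows "disc_ext f z = ev z (L2_of f)"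
  unfolding disc_ext_def using ev_sums[OF assms(2), of "L2_of f"]
  by (simp add: fourier_coeff_L2_of[OF assms(1)] sums_iff)

lemma ev_zero: "ev 0 x = cinner_L2 x (zpow 0)"
  by (simp add: ev_def szego_def zpow_def)

text \<open>The extra term is the coefficient that the shift moves from frequency -1 to 0. It
  vanishes on \<open>Hardy2\<close>, and for resolvents it is what evaluation at \<open>l\<close>
  tests.\<close>

lemma ev_Zop:
  assumes "cmod z < 1" shows "ev z (Zop x) = z * ev z x + cinner_L2 x (zpow (-1))"
proof -
  have "ev z (Zop x) = cinner_L2 (Zop x) (zpow 0) + z * cinner_L2 (Zop x) (Zop (szego z))"
    unfolding ev_def by (subst szego_rec[OF assms]) (simp add: cinner_simps)
  then show ?thesis by (simp add: cinner_Zop_zpow cinner_unimodular_mult[OF unimodular_id] ev_def)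
qed

lemma ev_zpow:
  assumes "cmod z < 1" shows "ev z (zpow k) = (if k < 0 then 0 else z ^ nat k)"
proof -
  have "(\<lambda>n. cinner_L2 (zpow k) (zpow (int n)) * z ^ n) = (\<lambda>n. if k \<ge> 0 \<and> n = nat k then z ^ nat k else 0)"
    by (auto simp: cinner_zpow_zpow fun_eq_iff)
  moreover have "(\<lambda>n. if k \<ge> 0 \<and> n = nat k then z ^ nat k else 0) sums (if k < 0 then 0 else z ^ nat k)"
    using sums_single[of "nat k" "\<lambda>_. z ^ nat k"] by auto
  ultimately show ?thesis using sums_unique2[OF ev_sums[OF assms, of "zpow k"]] by (simp only:)
qed

lemma szego_Hardy2: "cmod z < 1 \<Longrightarrow> szego z \<in> Hardy2"
  using ev_zpow[of z] cinner_L2_commute[of "szego z"] by (auto simp: Hardy2_iff ev_def)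

lemma norm_szego_sq:
  assumes "cmod z < 1" shows "(norm (szego z))\<^sup>2 = 1 / (1 - (cmod z)\<^sup>2)"
proof -
  let ?s = "ev z (szego z)"
  have s: "?s = of_real ((norm (szego z))\<^sup>2)" by (simp add: ev_def cinner_self_eq_norm)
  have "?s = ev z (zpow 0) + cnj z * ev z (Zop (szego z))"
    by (subst szego_rec[OF assms]) (simp add: ev_simps)
  also have "ev z (Zop (szego z)) = z * ?s"
    using szego_Hardy2[OF assms] by (simp add: ev_Zop assms Hardy2_iff)
  finally have "?s = 1 + (z * cnj z) * ?s"
    by (simp add: ev_zpow[OF assms] ac_simps)
  then have "?s = 1 + complex_of_real ((cmod z)\<^sup>2) * ?s"
    by (simp only: complex_norm_square)
  then have "complex_of_real ((norm (szego z))\<^sup>2) = of_real (1 + (cmod z)\<^sup>2 * (norm (szego z))\<^sup>2)"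
    unfolding s by (simp only: of_real_add of_real_mult of_real_1)
  then have "(norm (szego z))\<^sup>2 = 1 + (cmod z)\<^sup>2 * (norm (szego z))\<^sup>2" by (simp only: of_real_eq_iff)
  moreover have "(cmod z)\<^sup>2 < 1" using assms by (simp add: abs_square_less_1)
  ultimately show ?thesis by (simp add: field_simps)
qed

subsection \<open>Multiplication by bounded analytic functions\<close>

lemma Hinf_Linf: "f \<in> Hinf \<Longrightarrow> f \<in> Linf_fun"
  by (simp add: Hinf_def)

lemma Hinf_Hardy2: "f \<in> Hinf \<Longrightarrow> L2_of f \<in> Hardy2"
  by (auto simp: Hinf_def Hardy2_iff fourier_coeff_L2_of[symmetric] Linf_fun_L2)

lemma mult_zpow_zero: "u \<in> Linf_fun \<Longrightarrow> mult_L2 u (zpow 0) = L2_of u"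
  unfolding zpow_def by (subst mult_L2_of) (auto simp: Linf_fun_L2 Linf_fun_const)

lemma mult_zpow:
  assumes "u \<in> Linf_fun"
  shows "mult_L2 u (zpow n) = mult_L2 (\<lambda>z. z powi n) (L2_of u)"
proof -
  have "mult_L2 u (zpow n) = mult_L2 u (mult_L2 (\<lambda>z. z powi n) (zpow 0))" by (simp add: mult_powi_zpow)
  also have "\<dots> = mult_L2 (\<lambda>z. z powi n) (mult_L2 u (zpow 0))"
    by (rule mult_L2_commute[OF assms Linf_fun_powi])
  finally show ?thesis by (simp add: mult_zpow_zero assms)
qed

lemma Hinf_mult_Hardy2:
  assumes f: "f \<in> Hinf" and x: "x \<in> Hardy2"
  shows "mult_L2 f x \<in> Hardy2"
proof -
  note L = Hinf_Linf[OF f]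
  have "x \<in> {x. mult_L2 f x \<in> Hardy2}"
    using x
  proof (induction rule: Hardy2_induct)
    case closed
    show ?case using continuous_closed_vimage[OF closed_Hardy2, of "mult_L2 f"]
      linear_continuous_at[OF bounded_linear_mult_L2[OF L]] by (simp add: vimage_def)
  next
    case (monomial n)
    then show ?case using Hinf_Hardy2[OF f]
      by (auto simp: mult_zpow[OF L] Hardy2_iff cinner_mult_powi_zpow)
  qed (auto simp: mult_L2_simps intro: Hardy2_intros)
  then show ?thesis by simp
qed

text \<open>On monomials this is the shift formula for evaluations, iterated; linearity and
  continuity extend it to the Hardy space.\<close>

lemma ev_mult_Hinf:
  assumes f: "f \<in> Hinf" and x: "x \<in> Hardy2" and z: "cmod z < 1"
  shows "ev z (mult_L2 f x) = disc_ext f z * ev z x"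
proof -
  note L = Hinf_Linf[OF f]
  have mono: "ev z (mult_L2 f (zpow (int n))) = ev z (L2_of f) * z ^ n" for n
  proof (induction n)
    case (Suc n)
    have "mult_L2 f (zpow (int (Suc n))) = Zop (mult_L2 f (zpow (int n)))"
      using mult_L2_commute[OF L Linf_fun_id, of "zpow (int n)"] by (simp add: Zop_zpow add.commute)
    moreover have "mult_L2 f (zpow (int n)) \<in> Hardy2" by (intro Hinf_mult_Hardy2 f zpow_Hardy2) auto
    ultimately show ?case using Suc by (simp add: ev_Zop z Hardy2_iff)
  qed (simp add: mult_zpow_zero L)
  have "x \<in> {x. ev z (mult_L2 f x) = ev z (L2_of f) * ev z x}"
    using x
  proof (induction rule: Hardy2_induct)
    case closed
    show ?case unfolding ev_def
      by (intro closed_Collect_eq continuous_intros bounded_linear.continuous_on[OF bounded_linear_mult_L2[OF L]])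
  next
    case (monomial n)
    then show ?case using mono[of "nat n"] by (simp add: ev_zpow z)
  qed (auto simp: mult_L2_simps ev_simps algebra_simps)
  then show ?thesis by (simp add: disc_ext_eq_ev Linf_fun_L2 L z)
qed

lemma disc_ext_zero: "f \<in> Linf_fun \<Longrightarrow> disc_ext f 0 = cinner_L2 (L2_of f) (zpow 0)"
  using disc_ext_eq_ev[of f 0] by (simp add: Linf_fun_L2 ev_zero)

subsection \<open>Resolvents of the bilateral shift\<close>

definition resolv :: "complex \<Rightarrow> L2_circle \<Rightarrow> L2_circle" where
  "resolv l = mult_L2 (\<lambda>\<zeta>. 1 / (\<zeta> - l))"

lemma resolv_symbol_Linf:
  assumes "cmod l \<noteq> 1" shows "(\<lambda>\<zeta>. 1 / (\<zeta> - l)) \<in> Linf_fun"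
proof (rule Linf_funI)
  show "AE \<zeta> in circle_measure. cmod (1 / (\<zeta> - l)) \<le> 1 / \<bar>1 - cmod l\<bar>"
    using AE_circle_norm
  proof eventually_elim
    case (elim \<zeta>)
    have "\<bar>1 - cmod l\<bar> \<le> cmod (\<zeta> - l)" using norm_triangle_ineq3[of \<zeta> l] elim by simp
    then show ?case using assms by (simp add: norm_divide frac_le)
  qed
qed measurable

lemma Zop_diff_eq_mult: "Zop x - l *\<^sub>C x = mult_L2 (\<lambda>\<zeta>. \<zeta> - l) x"
  by (subst mult_L2_diff_symbol) (auto simp: Linf_fun_id Linf_fun_const mult_L2_const)

lemma diff_symbol_Linf: "(\<lambda>\<zeta>. \<zeta> - l) \<in> Linf_fun"
  by (intro Linf_fun_intros)

lemma
  assumes "cmod l \<noteq> 1"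
  shows Zop_resolv: "Zop (resolv l x) - l *\<^sub>C resolv l x = x"
    and resolv_Zop: "resolv l (Zop x - l *\<^sub>C x) = x"
proof -
  note L = resolv_symbol_Linf[OF assms]
  have "AE \<zeta> in circle_measure. (\<zeta> - l) * (1 / (\<zeta> - l)) = 1"
    using AE_circle_neq[of l] by eventually_elim simp
  from mult_L2_cong[OF Linf_fun_mult[OF diff_symbol_Linf L] Linf_fun_const this]
  have *: "mult_L2 (\<lambda>\<zeta>. (\<zeta> - l) * (1 / (\<zeta> - l))) x = x"
    by (simp only: mult_L2_const scaleC_one)
  show "Zop (resolv l x) - l *\<^sub>C resolv l x = x"
    unfolding Zop_diff_eq_mult resolv_def mult_L2_mult[OF diff_symbol_Linf L] by (rule *)
  then show "resolv l (Zop x - l *\<^sub>C x) = x"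
    unfolding Zop_diff_eq_mult resolv_def using mult_L2_commute[OF L diff_symbol_Linf, of l x] by simp
qed

lemma bounded_linear_resolv: "cmod l \<noteq> 1 \<Longrightarrow> bounded_linear (resolv l)"
  unfolding resolv_def by (intro bounded_linear_mult_L2 resolv_symbol_Linf)

text \<open>Since \<open>1 / (\<zeta> - l) = - (1 / l) / (1 - \<zeta> / l)\<close>, the resolvent of
  1 is a Szego kernel at the point reflected in the circle. This is how \<open>1 / cnj l\<close>
  enters the exterior determinant.\<close>

lemma resolv_one_exterior:
  assumes "cmod l > 1" shows "resolv l (zpow 0) = (- 1 / l) *\<^sub>C szego (1 / cnj l)"
proof -
  have w: "cmod (1 / cnj l) < 1" using assms by (simp add: norm_divide divide_less_eq_1)
  have l: "l \<noteq> 0" using assms by auto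
  have "resolv l (zpow 0) = L2_of (\<lambda>\<zeta>. 1 / (\<zeta> - l))"
    unfolding resolv_def using assms by (intro mult_zpow_zero resolv_symbol_Linf) auto
  also have "(\<lambda>\<zeta>. 1 / (\<zeta> - l)) = (\<lambda>\<zeta>. (- 1 / l) * (1 / (1 - cnj (1 / cnj l) * \<zeta>)))"
  proof
    fix \<zeta>
    show "1 / (\<zeta> - l) = (- 1 / l) * (1 / (1 - cnj (1 / cnj l) * \<zeta>))"
    proof (cases "\<zeta> = l")
      case False
      then have "1 - \<zeta> / l \<noteq> 0" "\<zeta> - l \<noteq> 0" using l by auto
      then show ?thesis using l by (simp add: divide_simps)
    qed (use l in simp)
  qed
  also have "L2_of \<dots> = (- 1 / l) *\<^sub>C szego (1 / cnj l)"
    unfolding szego_def by (rule L2_of_scale) (intro Linf_fun_L2 szego_symbol_Linf w)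
  finally show ?thesis .
qed

section \<open>Model spaces\<close>

locale inner_function =
  fixes \<theta> :: "complex \<Rightarrow> complex"
  assumes inner: "inner_fun \<theta>"
begin

lemma \<theta>_Hinf: "\<theta> \<in> Hinf" and \<theta>_unimodular: "unimodular \<theta>"
  using inner by (auto simp: inner_fun_def)

lemma \<theta>_Linf: "\<theta> \<in> Linf_fun" by (rule Hinf_Linf[OF \<theta>_Hinf])

definition tpow :: "int \<Rightarrow> L2_circle" where
  "tpow n = mult_L2 \<theta> (zpow n)"

lemma tpow_0: "tpow 0 = L2_of \<theta>"
  by (simp add: tpow_def mult_zpow_zero \<theta>_Linf)

lemma cinner_tpow_tpow: "cinner_L2 (tpow m) (tpow n) = (if m = n then 1 else 0)"
  by (simp add: tpow_def cinner_unimodular_mult[OF \<theta>_unimodular] cinner_zpow_zpow)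

lemma norm_tpow [simp]: "norm (tpow n) = 1"
  by (simp add: tpow_def norm_unimodular_mult[OF \<theta>_unimodular])

lemma Zop_tpow: "Zop (tpow n) = tpow (n + 1)"
  using mult_L2_commute[OF \<theta>_Linf Linf_fun_id, of "zpow n"] by (simp add: tpow_def Zop_zpow)

lemma cinner_Zop_tpow: "cinner_L2 (Zop x) (tpow n) = cinner_L2 x (tpow (n - 1))"
  using cinner_unimodular_mult[OF unimodular_id, of x "tpow (n - 1)"] by (simp add: Zop_tpow)

lemma tpow_Hardy2: "n \<ge> 0 \<Longrightarrow> tpow n \<in> Hardy2"
  unfolding tpow_def by (intro Hinf_mult_Hardy2 \<theta>_Hinf zpow_Hardy2)

lemma cinner_zpow_0_tpow: "cinner_L2 (zpow 0) (tpow n) = cnj (cinner_L2 (tpow 0) (zpow (- n)))"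
proof -
  have "cinner_L2 (tpow n) (zpow 0) = cinner_L2 (tpow 0) (zpow (- n))"
    unfolding tpow_0 tpow_def mult_zpow[OF \<theta>_Linf] cinner_mult_powi_zpow by simp
  then show ?thesis by (subst cinner_L2_commute) simp
qed

abbreviation \<theta>0 :: complex where "\<theta>0 \<equiv> disc_ext \<theta> 0"

lemma \<theta>0_eq: "\<theta>0 = cinner_L2 (tpow 0) (zpow 0)"
  by (simp add: tpow_0 disc_ext_zero \<theta>_Linf)

abbreviation K :: "L2_circle set" where "K \<equiv> model_space \<theta>"

text \<open>Membership in \<open>K\<close> becomes countably many conditions on coefficients, on
  which shifts and resolvents act by simple recursions.\<close>

lemma K_iff: "x \<in> K \<longleftrightarrow> (\<forall>n<0. cinner_L2 x (zpow n) = 0) \<and> (\<forall>n\<ge>0. cinner_L2 x (tpow n) = 0)"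
proof
  assume "x \<in> K"
  then show "(\<forall>n<0. cinner_L2 x (zpow n) = 0) \<and> (\<forall>n\<ge>0. cinner_L2 x (tpow n) = 0)"
    by (auto simp: model_space_def Hardy2_iff[symmetric] zpow_Hardy2 tpow_def)
next
  assume r: "(\<forall>n<0. cinner_L2 x (zpow n) = 0) \<and> (\<forall>n\<ge>0. cinner_L2 x (tpow n) = 0)"
  have "cinner_L2 x (mult_L2 \<theta> g) = 0" if "g \<in> Hardy2" for g
  proof -
    have "g \<in> {g. cinner_L2 (mult_L2 \<theta> g) x = 0}"
      using that
    proof (induction rule: Hardy2_induct)
      case closed
      show ?case
        by (intro closed_Collect_eq continuous_intros bounded_linear.continuous_on[OF bounded_linear_mult_L2[OF \<theta>_Linf]])
    next
      case (monomial n)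
      then show ?case using r cinner_L2_commute[of "mult_L2 \<theta> (zpow n)" x] by (auto simp: tpow_def)
    qed (auto simp: mult_L2_simps cinner_simps)
    then show ?thesis by (subst cinner_L2_commute) simp
  qed
  then show "x \<in> K" using r by (simp add: model_space_def Hardy2_iff)
qed

lemma K_Hardy2: "x \<in> K \<Longrightarrow> x \<in> Hardy2"
  by (simp add: model_space_def)

lemma K_orth: "x \<in> K \<Longrightarrow> g \<in> Hardy2 \<Longrightarrow> cinner_L2 x (mult_L2 \<theta> g) = 0"
  by (simp add: model_space_def)

lemma K_intros: "0 \<in> K" "x \<in> K \<Longrightarrow> y \<in> K \<Longrightarrow> x + y \<in> K" "x \<in> K \<Longrightarrow> y \<in> K \<Longrightarrow> x - y \<in> K"
  "x \<in> K \<Longrightarrow> c *\<^sub>C x \<in> K"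
  by (auto simp: K_iff cinner_simps)

lemma subspace_K: "subspace K"
  by (auto intro!: subspaceI K_intros simp: scaleR_L2_circle_def)

lemma closed_K: "closed K"
proof -
  have eq: "K = (\<Inter>n\<in>{..<0}. {x. cinner_L2 x (zpow n) = 0}) \<inter> (\<Inter>n\<in>{0..}. {x. cinner_L2 x (tpow n) = 0})"
    by (auto simp: K_iff)
  show ?thesis unfolding eq by (intro closed_Int closed_INT ballI closed_cinner_zero)
qed

text \<open>The reproducing kernel of \<open>K\<close> at 0, that is, the projection of the constant
  1 to \<open>K\<close>.\<close>

definition k0 :: L2_circle where "k0 = zpow 0 - cnj \<theta>0 *\<^sub>C tpow 0"

lemma tpow_0_coeff: "n < 0 \<Longrightarrow> cinner_L2 (tpow 0) (zpow n) = 0"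
  using tpow_Hardy2[of 0] by (simp add: Hardy2_iff)

lemma k0_K: "k0 \<in> K"
  using tpow_0_coeff
  by (auto simp: K_iff k0_def cinner_simps cinner_zpow_zpow cinner_tpow_tpow cinner_zpow_0_tpow \<theta>0_eq)

text \<open>The coefficient that the shift moves to \<open>tpow 0\<close>. For \<open>x\<close> in
  \<open>K\<close> it measures exactly what leaves \<open>K\<close>:
  \<open>Zop x - c x *\<^sub>C tpow 0\<close> is the compressed shift of \<open>x\<close>.\<close>

abbreviation c :: "L2_circle \<Rightarrow> complex" where "c x \<equiv> cinner_L2 x (tpow (-1))"

lemma k0_symbol: "a *\<^sub>C tpow 0 - b *\<^sub>C k0 = (a + b * cnj \<theta>0) *\<^sub>C tpow 0 - b *\<^sub>C zpow 0"
  by (simp add: k0_def scaleC_diff_right scaleC_scaleC scaleC_add_left)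

subsection \<open>When a resolvent stays in the model space\<close>

text \<open>Solving \<open>(\<zeta> - l) f = H\<close> makes the coefficients of \<open>f\<close> geometric sequences outside the
  range where those of \<open>H\<close> live; Bessel's inequality kills them when they do not decay.  The
  predicate \<open>rhs b\<close> singles out the right-hand sides \<open>h + b \<theta> - b' k\<^sub>0\<close> with \<open>h\<close> in \<open>K\<close> by their
  coefficients.\<close>

definition rhs :: "complex \<Rightarrow> L2_circle \<Rightarrow> bool" where
  "rhs b H \<longleftrightarrow> (\<forall>n<0. cinner_L2 H (zpow n) = 0) \<and> (\<forall>n\<ge>1. cinner_L2 H (tpow n) = 0) \<and> cinner_L2 H (tpow 0) = b"

lemma rhs_add: "rhs a x \<Longrightarrow> rhs b y \<Longrightarrow> rhs (a + b) (x + y)"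
  and rhs_scale: "rhs a x \<Longrightarrow> rhs (d * a) (d *\<^sub>C x)"
  and rhs_K: "x \<in> K \<Longrightarrow> rhs 0 x"
  and rhs_tpow: "rhs 1 (tpow 0)"
  and rhs_one: "rhs (cnj \<theta>0) (zpow 0)"
  using tpow_0_coeff
  by (auto simp: rhs_def cinner_simps K_iff cinner_tpow_tpow cinner_zpow_zpow cinner_zpow_0_tpow \<theta>0_eq)

lemma rhs_eq:
  assumes "h \<in> K" shows "rhs a (h + a *\<^sub>C tpow 0 - b *\<^sub>C k0)"
proof -
  have "rhs (0 + a * 1) (h + a *\<^sub>C tpow 0)" by (intro rhs_add rhs_scale rhs_tpow rhs_K assms)
  then have "rhs (a + (-b) * 0) ((h + a *\<^sub>C tpow 0) + (-b) *\<^sub>C k0)"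
    using k0_K by (intro rhs_add rhs_scale rhs_K) auto
  then show ?thesis by (simp add: scaleC_uminus_left)
qed

lemma resolvent_coeff:
  assumes "Zop f - l *\<^sub>C f = H"
  shows "cinner_L2 H (zpow n) = cinner_L2 f (zpow (n - 1)) - l * cinner_L2 f (zpow n)"
    "cinner_L2 H (tpow n) = cinner_L2 f (tpow (n - 1)) - l * cinner_L2 f (tpow n)"
  unfolding assms[symmetric] by (simp_all add: cinner_simps cinner_Zop_zpow cinner_Zop_tpow)

lemma resolvent_Hardy2:
  assumes eq: "Zop f - l *\<^sub>C f = H" and H: "H \<in> Hardy2"
    and l: "cmod l \<ge> 1 \<or> cinner_L2 f (zpow (-1)) = 0"
  shows "f \<in> Hardy2"
proof -
  define p where "p m = cinner_L2 f (zpow (- 1 - int m))" for m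
  have "p (Suc m) = l * p m" for m
    using resolvent_coeff(1)[OF eq, of "- 1 - int m"] H by (simp add: p_def Hardy2_iff algebra_simps)
  then have pm: "p m = l ^ m * p 0" for m by (induction m) auto
  \<comment> \<open>For \<open>cmod l \<ge> 1\<close> the moduli of the sequence do not decrease,
    which Bessel allows only for zero; for \<open>cmod l < 1\<close> decay is possible and the first
    term is zero by assumption.\<close>
  have p0: "p 0 = 0"
  proof (cases "cmod l \<ge> 1")
    case True
    have "cmod (p 0) \<le> cmod (p m)" for m
      using True by (subst (2) pm) (auto simp: norm_mult norm_power intro!: mult_right_le_one_le mult_le_cancel_right1[THEN iffD2] one_le_power)
    then have "cmod (p 0) \<le> 0"
      by (intro Bessel_const_modulus[where e = "\<lambda>m. zpow (- 1 - int m)" and x = f])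
        (auto simp: cinner_zpow_zpow p_def)
    then show ?thesis by simp
  qed (use l in \<open>simp add: p_def\<close>)
  have "cinner_L2 f (zpow n) = 0" if "n < 0" for n
    using pm[of "nat (- 1 - n)"] p0 that by (simp add: p_def)
  then show ?thesis by (simp add: Hardy2_iff)
qed

text \<open>Of the last two conditions only the first restricts \<open>f\<close> inside the disc,
  only the second outside, and neither on the circle, where every square integrable solution lies in
  \<open>K\<close>. The conclusion \<open>c f = b\<close> closes the loop: the constant put into the
  right-hand side is the one that the solution returns.\<close>

lemma resolvent_K:
  assumes eq: "Zop f - l *\<^sub>C f = H" and H: "rhs b H"
    and l1: "cmod l \<ge> 1 \<or> cinner_L2 f (zpow (-1)) = 0"
    and l2: "cmod l \<le> 1 \<or> cinner_L2 f (tpow 0) = 0"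
  shows "f \<in> K \<and> c f = b"
proof -
  have "f \<in> Hardy2" using resolvent_Hardy2[OF eq _ l1] H by (auto simp: rhs_def Hardy2_iff)
  moreover
  have q: "cinner_L2 f (tpow n) = l * cinner_L2 f (tpow (n + 1))" if "n \<ge> 0" for n
    using resolvent_coeff(2)[OF eq, of "n + 1"] H that by (simp add: rhs_def)
  \<comment> \<open>Here the recursion runs the other way: for \<open>cmod l \<le> 1\<close> the
    moduli do not decrease as the index grows, otherwise the zero at index 0 propagates
    upwards.\<close>
  have zero: "cinner_L2 f (tpow (int n)) = 0" for n
  proof (cases "cmod l \<le> 1")
    case True
    have "cmod (cinner_L2 f (tpow (int n))) \<le> cmod (cinner_L2 f (tpow (int (n + m))))" for m
    proof (induction m)
      case (Suc m)
      have "cmod (cinner_L2 f (tpow (int (n + m)))) = cmod l * cmod (cinner_L2 f (tpow (int (n + m) + 1)))"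
        using q[of "int (n + m)"] by (simp add: norm_mult)
      also have "\<dots> \<le> cmod (cinner_L2 f (tpow (int (n + m) + 1)))"
        using True by (intro mult_left_le_one_le) auto
      finally show ?case using Suc by (simp add: add.commute add.left_commute)
    qed simp
    then have "cmod (cinner_L2 f (tpow (int n))) \<le> 0"
      by (intro Bessel_const_modulus[where e = "\<lambda>m. tpow (int (n + m))" and x = f])
        (auto simp: cinner_tpow_tpow)
    then show ?thesis by simp
  next
    case False
    show ?thesis
    proof (induction n)
      case (Suc n)
      then show ?case using q[of "int n"] False by (auto simp: add.commute)
    qed (use False l2 in simp)
  qed
  have "cinner_L2 f (tpow n) = 0" if "n \<ge> 0" for n
    using zero[of "nat n"] that by simp
  moreover have "c f = b"
    using resolvent_coeff(2)[OF eq, of 0] H zero[of 0] by (simp add: rhs_def)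
  ultimately show ?thesis by (auto simp: K_iff Hardy2_iff)
qed

end

section \<open>The matrix model of the dual-band shift\<close>

text \<open>Cramer's rule for the matrix with rows \<open>(p, - a q)\<close> and
  \<open>(- b q, p)\<close>.\<close>

lemma linear_system_2:
  fixes p q a b :: complex
  assumes "p\<^sup>2 - a * b * q\<^sup>2 \<noteq> 0"
  shows "c1 * p - a * c2 * q = - u \<and> c2 * p - b * c1 * q = - v \<longleftrightarrow>
    c1 = - (p * u + a * q * v) / (p\<^sup>2 - a * b * q\<^sup>2) \<and> c2 = - (p * v + b * q * u) / (p\<^sup>2 - a * b * q\<^sup>2)"
  (is "?L \<longleftrightarrow> ?R")
proof
  assume ?L
  then have u: "u = - (c1 * p - a * c2 * q)" and v: "v = - (c2 * p - b * c1 * q)" by auto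
  have "- (p * u + a * q * v) = c1 * (p\<^sup>2 - a * b * q\<^sup>2)" "- (p * v + b * q * u) = c2 * (p\<^sup>2 - a * b * q\<^sup>2)"
    unfolding u v by (simp_all add: algebra_simps power2_eq_square)
  then show ?R using assms by simp
next
  assume R: ?R
  let ?D = "p\<^sup>2 - a * b * q\<^sup>2"
  let ?N1 = "- (p * u + a * q * v)" and ?N2 = "- (p * v + b * q * u)"
  have "c1 * p - a * c2 * q = (?N1 * p - a * ?N2 * q) / ?D" "c2 * p - b * c1 * q = (?N2 * p - b * ?N1 * q) / ?D"
    unfolding R[THEN conjunct1] R[THEN conjunct2] diff_divide_distrib by simp_all
  moreover have "?N1 * p - a * ?N2 * q = - u * ?D" "?N2 * p - b * ?N1 * q = - v * ?D"
    by (simp_all add: algebra_simps power2_eq_square)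
  ultimately show ?L using assms by simp
qed

lemma linear_system_2_kernel:
  fixes p q a b :: complex
  assumes "p\<^sup>2 - a * b * q\<^sup>2 = 0"
  shows "\<exists>c1 c2. (c1 \<noteq> 0 \<or> c2 \<noteq> 0) \<and> c1 * p - a * c2 * q = 0 \<and> c2 * p - b * c1 * q = 0"
proof (cases "p = 0 \<and> a * q = 0")
  case True
  then show ?thesis by (intro exI[of _ 0] exI[of _ 1]) auto
next
  case False
  then show ?thesis using assms
    by (intro exI[of _ "a * q"] exI[of _ p]) (auto simp: algebra_simps power2_eq_square)
qed

text \<open>The parameters \<open>\<alpha>\<close> and \<open>\<beta>\<close> are the conjugates of \<open>A\<^sub>+(0)\<close> and of the value at \<open>0\<close> of
  the conjugate of \<open>A\<^sub>-\<close>; the dual-band shift acts on pairs as the compressed shift perturbed by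
  the rank-one off-diagonal entries \<open>\<alpha> c(\<cdot>) k\<^sub>0\<close> and \<open>\<beta> c(\<cdot>) k\<^sub>0\<close>.\<close>

locale matrix_model = inner_function +
  fixes \<alpha> \<beta> :: complex
begin

definition Tc :: "complex \<Rightarrow> L2_circle \<Rightarrow> L2_circle \<Rightarrow> L2_circle" where
  "Tc a f g = Zop f - c f *\<^sub>C tpow 0 + (a * c g) *\<^sub>C k0"

definition Lop :: "complex \<Rightarrow> L2_circle \<times> L2_circle \<Rightarrow> L2_circle \<times> L2_circle" where
  "Lop l x = (Tc \<alpha> (fst x) (snd x) - l *\<^sub>C fst x, Tc \<beta> (snd x) (fst x) - l *\<^sub>C snd x)"

abbreviation KK :: "(L2_circle \<times> L2_circle) set" where "KK \<equiv> K \<times> K"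

definition regular :: "complex \<Rightarrow> bool" where
  "regular l \<longleftrightarrow> bij_betw (Lop l) KK KK \<and> (\<exists>C. \<forall>x\<in>KK. norm x \<le> C * norm (Lop l x))"

definition eigen :: "complex \<Rightarrow> bool" where
  "eigen l \<longleftrightarrow> (\<exists>x\<in>KK. x \<noteq> 0 \<and> Lop l x = 0)"

lemma Tc_K: assumes "f \<in> K" "g \<in> K" shows "Tc a f g \<in> K"
proof -
  have "Zop f - c f *\<^sub>C tpow 0 \<in> K"
    using assms tpow_0_coeff by (auto simp: K_iff cinner_simps cinner_Zop_zpow cinner_Zop_tpow cinner_tpow_tpow)
  then show ?thesis unfolding Tc_def by (rule K_intros(2)) (rule K_intros(4)[OF k0_K])
qed

lemma Lop_KK: "x \<in> KK \<Longrightarrow> Lop l x \<in> KK"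
  by (auto simp: Lop_def intro!: Tc_K K_intros)

lemma Lop_image_subset: "Lop l ` KK \<subseteq> KK"
  by (rule image_subsetI) (rule Lop_KK)

lemma Tc_eq_iff: "Tc a f g - l *\<^sub>C f = h \<longleftrightarrow> Zop f - l *\<^sub>C f = h + c f *\<^sub>C tpow 0 - (a * c g) *\<^sub>C k0"
  by (auto simp: Tc_def algebra_simps)

lemma bounded_linear_c: "bounded_linear c"
  by (rule bounded_linear_cinner_left)

lemma bounded_linear_scaleC_const: "bounded_linear (\<lambda>z. z *\<^sub>C (y :: L2_circle))"
  by (rule bounded_linear_intro[where K = "norm y"])
     (auto simp: scaleC_add_left scaleR_L2_circle_def scaleC_scaleC scaleR_conv_of_real norm_scaleC)

lemma bounded_linear_Lop: "bounded_linear (Lop l)"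
proof -
  have cy: "bounded_linear (\<lambda>x. c (F x) *\<^sub>C y)" if "bounded_linear F" for y and F :: "L2_circle \<times> L2_circle \<Rightarrow> L2_circle"
    using bounded_linear_compose[OF bounded_linear_scaleC_const bounded_linear_compose[OF bounded_linear_c that]] .
  have sc: "bounded_linear (\<lambda>x. a *\<^sub>C F x)" if "bounded_linear F" for a and F :: "L2_circle \<times> L2_circle \<Rightarrow> L2_circle"
    using bounded_linear_compose[OF bounded_linear_scaleC that] .
  have z: "bounded_linear (\<lambda>x. Zop (F x))" if "bounded_linear F" for F :: "L2_circle \<times> L2_circle \<Rightarrow> L2_circle"
    using bounded_linear_compose[OF bounded_linear_mult_L2[OF Linf_fun_id] that] .
  show ?thesis unfolding Lop_def Tc_def scaleC_scaleC[symmetric]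
    by (intro bounded_linear_Pair bounded_linear_sub bounded_linear_add sc cy z bounded_linear_fst bounded_linear_snd)
qed

lemma KK_diff: "x \<in> KK \<Longrightarrow> y \<in> KK \<Longrightarrow> x - y \<in> KK"
  by (auto intro: K_intros)

lemma subspace_KK: "subspace KK"
  by (auto intro!: subspaceI K_intros simp: scaleR_L2_circle_def zero_prod_def)

lemma closed_KK: "closed KK"
  by (intro closed_Times closed_K)

lemma inj_on_Lop_iff: "inj_on (Lop l) KK \<longleftrightarrow> \<not> eigen l"
proof -
  interpret L: bounded_linear "Lop l" by (rule bounded_linear_Lop)
  have "0 \<in> KK" using K_intros(1) by (simp add: zero_prod_def)
  then have "\<not> inj_on (Lop l) KK" if "eigen l"
    using that unfolding eigen_def by (metis L.zero inj_onD)
  moreover have "inj_on (Lop l) KK" if "\<not> eigen l"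
  proof (rule inj_onI)
    fix x y assume xy: "x \<in> KK" "y \<in> KK" "Lop l x = Lop l y"
    have "x - y \<in> KK" "Lop l (x - y) = 0" using KK_diff[OF xy(1,2)] xy(3) by (auto simp: L.diff)
    then have "eigen l" if "x - y \<noteq> 0" unfolding eigen_def using that by (intro bexI[of _ "x - y"] conjI)
    then have "x - y = 0" using \<open>\<not> eigen l\<close> by argo
    then show "x = y" by simp
  qed
  ultimately show ?thesis by blast
qed

lemma regularI:
  assumes "\<And>x. x \<in> KK \<Longrightarrow> norm x \<le> C * norm (Lop l x)" and "KK \<subseteq> Lop l ` KK"
  shows "regular l"
proof -
  have "\<not> eigen l" using assms(1) by (force simp: eigen_def)
  then have "bij_betw (Lop l) KK KK"
    using assms(2) Lop_image_subset by (simp add: bij_betw_def inj_on_Lop_iff antisym)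
  then show ?thesis using assms(1) unfolding regular_def by blast
qed

text \<open>By \<open>sys\<close> and Cramer's rule the constants \<open>c f\<close> and
  \<open>c g\<close> are bounded in terms of \<open>Lop l x\<close>; then so are the right-hand
  sides, and \<open>B\<close> bounds both components. The data \<open>p\<close>, \<open>q\<close>,
  \<open>u\<close> are left open so that the lemma serves off the circle and at regular boundary
  points alike.\<close>

lemma matrix_bounded_below:
  assumes B: "B \<ge> 0" "\<And>f. f \<in> K \<Longrightarrow> norm f \<le> B * norm (Zop f - l *\<^sub>C f)"
    and D: "p\<^sup>2 - \<alpha> * \<beta> * q\<^sup>2 \<noteq> 0"
    and sys: "\<And>f h b. f \<in> K \<Longrightarrow> h \<in> K \<Longrightarrow> Zop f - l *\<^sub>C f = h + c f *\<^sub>C tpow 0 - b *\<^sub>C k0 \<Longrightarrow>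
       c f * p - b * q = - cinner_L2 h u"
  shows "\<exists>C. \<forall>x\<in>KK. norm x \<le> C * norm (Lop l x)"
proof -
  let ?D = "p\<^sup>2 - \<alpha> * \<beta> * q\<^sup>2"
  \<comment> \<open>The sum of both off-diagonal moduli lets one constant bound \<open>c f\<close>
    and \<open>c g\<close> together.\<close>
  define A where "A = (cmod p + cmod (\<alpha> * q) + cmod (\<beta> * q)) * norm u / cmod ?D"
  have A0: "A \<ge> 0" by (simp add: A_def)
  define C where "C = B * (1 + A + cmod \<alpha> * A * norm k0) + B * (1 + A + cmod \<beta> * A * norm k0)"
  have "norm x \<le> C * norm (Lop l x)" if x: "x \<in> KK" for x
  proof -
    obtain f g where fg: "x = (f, g)" "f \<in> K" "g \<in> K" using x by auto
    obtain h k where hk: "Lop l x = (h, k)" by fastforce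
    have hkK: "h \<in> K" "k \<in> K" using Lop_KK[OF x, of l] hk by auto
    let ?n = "norm (Lop l x)"
    have hn: "norm h \<le> ?n" "norm k \<le> ?n" using norm_fst_le[of h k] norm_snd_le[of k h] hk by auto
    have eqs: "Zop f - l *\<^sub>C f = h + c f *\<^sub>C tpow 0 - (\<alpha> * c g) *\<^sub>C k0" "Zop g - l *\<^sub>C g = k + c g *\<^sub>C tpow 0 - (\<beta> * c f) *\<^sub>C k0"
      using hk by (simp_all add: Lop_def Tc_eq_iff fg)
    have "c f * p - \<alpha> * c g * q = - cinner_L2 h u" "c g * p - \<beta> * c f * q = - cinner_L2 k u"
      using sys[OF fg(2) hkK(1) eqs(1)] sys[OF fg(3) hkK(2) eqs(2)] by simp_all
    then have cfg: "c f = - (p * cinner_L2 h u + \<alpha> * q * cinner_L2 k u) / ?D" "c g = - (p * cinner_L2 k u + \<beta> * q * cinner_L2 h u) / ?D"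
      using linear_system_2[OF D] by blast+
    have hu: "cmod (cinner_L2 h u) \<le> norm u * ?n" "cmod (cinner_L2 k u) \<le> norm u * ?n"
      using cinner_Cauchy_Schwarz[of h u] cinner_Cauchy_Schwarz[of k u] hn
      by (metis mult.commute mult_left_mono norm_ge_zero order_trans)+
    have gen: "cmod (- (p * s + a * q * t) / ?D) \<le> A * ?n"
      if "cmod s \<le> norm u * ?n" "cmod t \<le> norm u * ?n" "a = \<alpha> \<or> a = \<beta>" for a s t
    proof -
      have "cmod (- (p * s + a * q * t) / ?D) \<le> (cmod p * cmod s + cmod (a * q) * cmod t) / cmod ?D"
        using norm_triangle_ineq[of "p * s" "a * q * t"] by (simp only: norm_divide norm_minus_cancel norm_mult divide_right_mono norm_ge_zero)
      also have "\<dots> \<le> (cmod p * (norm u * ?n) + cmod (a * q) * (norm u * ?n)) / cmod ?D"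
        using that by (intro divide_right_mono add_mono mult_left_mono) auto
      also have "\<dots> = (cmod p + cmod (a * q)) * (norm u * ?n) / cmod ?D" by (simp only: distrib_right)
      also have "\<dots> \<le> (cmod p + cmod (\<alpha> * q) + cmod (\<beta> * q)) * (norm u * ?n) / cmod ?D"
        using that(3) by (intro divide_right_mono mult_right_mono) auto
      finally show ?thesis by (simp add: A_def)
    qed
    have cb: "cmod (c f) \<le> A * ?n" "cmod (c g) \<le> A * ?n"
      unfolding cfg by (intro gen hu; simp)+
    have bd: "norm F \<le> B * (1 + A + cmod s * A * norm k0) * ?n"
      if "F \<in> K" "Zop F - l *\<^sub>C F = h' + a *\<^sub>C tpow 0 - (s * b) *\<^sub>C k0" "norm h' \<le> ?n" "cmod a \<le> A * ?n" "cmod b \<le> A * ?n" for F h' a b s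
    proof -
      have "norm (h' + a *\<^sub>C tpow 0 - (s * b) *\<^sub>C k0) \<le> norm h' + cmod a + cmod s * cmod b * norm k0"
        by (intro order_trans[OF norm_triangle_ineq4] add_mono order_trans[OF norm_triangle_ineq])
           (auto simp: norm_scaleC norm_mult)
      also have "\<dots> \<le> ?n + A * ?n + cmod s * (A * ?n) * norm k0"
        using that by (intro add_mono mult_right_mono mult_left_mono) auto
      also have "\<dots> = (1 + A + cmod s * A * norm k0) * ?n" by (simp add: algebra_simps)
      finally have "B * norm (Zop F - l *\<^sub>C F) \<le> B * ((1 + A + cmod s * A * norm k0) * ?n)"
        unfolding that(2) using B(1) by (intro mult_left_mono)
      with B(2)[OF that(1)] show ?thesis by (simp only: mult.assoc)
    qed
    have "norm f \<le> B * (1 + A + cmod \<alpha> * A * norm k0) * ?n" "norm g \<le> B * (1 + A + cmod \<beta> * A * norm k0) * ?n"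
      using bd[OF fg(2) eqs(1) hn(1) cb] bd[OF fg(3) eqs(2) hn(2) cb(2,1)] by simp_all
    then show "norm x \<le> C * ?n"
      using norm_Pair_le[of f g] unfolding fg C_def by (simp add: distrib_right)
  qed
  then show ?thesis by blast
qed

text \<open>Away from the circle, solvability of \<open>(\<zeta> - l) f = H\<close> inside \<open>K\<close> is the vanishing of one
  functional \<open>u\<close> on \<open>H\<close>, which turns the spectral problem into a \<open>2 \<times> 2\<close> linear system.\<close>

context
  fixes l :: complex and u :: L2_circle
  assumes l: "cmod l \<noteq> 1"
    and P1: "\<And>f. f \<in> K \<Longrightarrow> cinner_L2 (Zop f - l *\<^sub>C f) u = 0"
    and P2: "\<And>H b. rhs b H \<Longrightarrow> cinner_L2 H u = 0 \<Longrightarrow> resolv l H \<in> K \<and> c (resolv l H) = b"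
begin

private abbreviation (input) "p \<equiv> cinner_L2 (tpow 0) u"
private abbreviation (input) "q \<equiv> cinner_L2 k0 u"

text \<open>The constants are prescribed first: the system says that both right-hand sides are
  annihilated by \<open>u\<close>, whereupon \<open>P2\<close> gives solutions in \<open>K\<close>
  that return these constants as \<open>c f\<close> and \<open>c g\<close>.\<close>

lemma off_circle_solve:
  assumes "h \<in> K" "k \<in> K" "c1 * p - \<alpha> * c2 * q = - cinner_L2 h u" "c2 * p - \<beta> * c1 * q = - cinner_L2 k u"
  defines "f \<equiv> resolv l (h + c1 *\<^sub>C tpow 0 - (\<alpha> * c2) *\<^sub>C k0)"
    and "g \<equiv> resolv l (k + c2 *\<^sub>C tpow 0 - (\<beta> * c1) *\<^sub>C k0)"
  shows "f \<in> K" "g \<in> K" "c f = c1" "c g = c2" "Lop l (f, g) = (h, k)"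
proof -
  have "cinner_L2 (h + c1 *\<^sub>C tpow 0 - (\<alpha> * c2) *\<^sub>C k0) u = 0" "cinner_L2 (k + c2 *\<^sub>C tpow 0 - (\<beta> * c1) *\<^sub>C k0) u = 0"
    unfolding cinner_simps add_diff_eq[symmetric] assms(3,4) by simp_all
  from P2[OF rhs_eq[OF assms(1)] this(1)] P2[OF rhs_eq[OF assms(2)] this(2)]
  show fg: "f \<in> K" "g \<in> K" "c f = c1" "c g = c2" by (auto simp: f_def g_def)
  have "Zop f - l *\<^sub>C f = h + c f *\<^sub>C tpow 0 - (\<alpha> * c g) *\<^sub>C k0" "Zop g - l *\<^sub>C g = k + c g *\<^sub>C tpow 0 - (\<beta> * c f) *\<^sub>C k0"
    unfolding fg by (simp_all add: f_def g_def Zop_resolv[OF l])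
  then show "Lop l (f, g) = (h, k)" by (simp add: Lop_def Tc_eq_iff)
qed

lemma off_circle_eigen:
  assumes "p\<^sup>2 - \<alpha> * \<beta> * q\<^sup>2 = 0" shows "eigen l"
proof -
  obtain c1 c2 where c12: "c1 \<noteq> 0 \<or> c2 \<noteq> 0" "c1 * p - \<alpha> * c2 * q = 0" "c2 * p - \<beta> * c1 * q = 0"
    using linear_system_2_kernel[OF assms] by blast
  note s = off_circle_solve[OF K_intros(1) K_intros(1), of c1 c2]
  let ?f = "resolv l (0 + c1 *\<^sub>C tpow 0 - (\<alpha> * c2) *\<^sub>C k0)" and ?g = "resolv l (0 + c2 *\<^sub>C tpow 0 - (\<beta> * c1) *\<^sub>C k0)"
  have "?f \<in> K" "?g \<in> K" "c ?f = c1" "c ?g = c2" "Lop l (?f, ?g) = (0, 0)"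
    using c12 by (intro s; simp)+
  then show ?thesis using c12(1) unfolding eigen_def
    by (intro bexI[of _ "(?f, ?g)"]) (auto simp: zero_prod_def)
qed

lemma off_circle_regular:
  assumes D: "p\<^sup>2 - \<alpha> * \<beta> * q\<^sup>2 \<noteq> 0" shows "regular l"
proof -
  let ?D = "p\<^sup>2 - \<alpha> * \<beta> * q\<^sup>2"
  obtain B where B: "B > 0" "\<And>x. norm (resolv l x) \<le> norm x * B"
    using bounded_linear.pos_bounded[OF bounded_linear_resolv[OF l]] by blast
  have "\<exists>C. \<forall>x\<in>KK. norm x \<le> C * norm (Lop l x)"
  proof (rule matrix_bounded_below[OF _ _ D])
    show "B \<ge> 0" using B(1) by simp
    show "norm f \<le> B * norm (Zop f - l *\<^sub>C f)" for f
      using B(2)[of "Zop f - l *\<^sub>C f"] by (simp add: resolv_Zop[OF l] mult.commute)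
    show "c f * p - b * q = - cinner_L2 h u" if "f \<in> K" "Zop f - l *\<^sub>C f = h + c f *\<^sub>C tpow 0 - b *\<^sub>C k0" for f h b
      using P1[OF that(1)] unfolding that(2) by (simp add: cinner_simps algebra_simps add_eq_0_iff)
  qed
  then obtain C where C: "\<And>x. x \<in> KK \<Longrightarrow> norm x \<le> C * norm (Lop l x)" by blast
  show ?thesis
  proof (rule regularI[OF C])
    show "KK \<subseteq> Lop l ` KK"
    proof
      fix y assume "y \<in> KK"
      then obtain h k where hk: "y = (h, k)" "h \<in> K" "k \<in> K" by auto
      define c1 where "c1 = - (p * cinner_L2 h u + \<alpha> * q * cinner_L2 k u) / ?D"
      define c2 where "c2 = - (p * cinner_L2 k u + \<beta> * q * cinner_L2 h u) / ?D"
      have "c1 * p - \<alpha> * c2 * q = - cinner_L2 h u" "c2 * p - \<beta> * c1 * q = - cinner_L2 k u"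
        using linear_system_2[OF D, of c1 c2 "cinner_L2 h u" "cinner_L2 k u"] by (auto simp: c1_def c2_def)
      note s = off_circle_solve[OF hk(2,3) this]
      show "y \<in> Lop l ` KK" unfolding hk s(5)[symmetric] by (intro imageI SigmaI s(1,2))
    qed
  qed
qed

end

section \<open>Eigenvalues and regular points off the circle\<close>

lemma cinner_k0: "cinner_L2 k0 u = cinner_L2 (zpow 0) u - cnj \<theta>0 * cinner_L2 (tpow 0) u"
  by (simp add: k0_def cinner_simps)

definition DeltaM :: "complex \<Rightarrow> complex" where
  "DeltaM w = w\<^sup>2 - \<alpha> * \<beta> * (1 - cnj \<theta>0 * w)\<^sup>2"

text \<open>The functional is evaluation at \<open>l\<close>: it kills
  \<open>(\<zeta> - l) f\<close> for \<open>f\<close> in \<open>K\<close>, and conversely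
  \<open>H(l) = 0\<close> removes the frequency -1 of the resolvent. Then
  \<open>p = \<theta>(l)\<close> and \<open>q = 1 - cnj \<theta>(0) \<theta>(l)\<close>, so the
  determinant is \<open>DeltaM\<close>.\<close>

lemma
  assumes l: "cmod l < 1"
  shows disc_eigen: "DeltaM (disc_ext \<theta> l) = 0 \<Longrightarrow> eigen l"
    and disc_regular: "DeltaM (disc_ext \<theta> l) \<noteq> 0 \<Longrightarrow> regular l"
proof -
  have l': "cmod l \<noteq> 1" using l by simp
  have P1: "cinner_L2 (Zop f - l *\<^sub>C f) (szego l) = 0" if "f \<in> K" for f
    using that ev_Zop[OF l, of f] by (simp add: ev_def cinner_simps K_iff)
  have P2: "resolv l H \<in> K \<and> c (resolv l H) = b" if "rhs b H" "cinner_L2 H (szego l) = 0" for H b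
  proof (rule resolvent_K[OF Zop_resolv[OF l'] that(1)])
    have "ev l (Zop (resolv l H) - l *\<^sub>C resolv l H) = 0"
      unfolding Zop_resolv[OF l'] using that(2) by (simp add: ev_def)
    then show "1 \<le> cmod l \<or> cinner_L2 (resolv l H) (zpow (-1)) = 0"
      by (simp add: ev_simps ev_Zop l)
  qed (use l in simp)
  have p: "cinner_L2 (tpow 0) (szego l) = disc_ext \<theta> l"
    using disc_ext_eq_ev[OF Linf_fun_L2[OF \<theta>_Linf] l] by (simp add: ev_def tpow_0)
  have q: "cinner_L2 k0 (szego l) = 1 - cnj \<theta>0 * disc_ext \<theta> l"
    unfolding cinner_k0 p using ev_zpow[OF l, of 0] by (simp add: ev_def)
  show "DeltaM (disc_ext \<theta> l) = 0 \<Longrightarrow> eigen l" "DeltaM (disc_ext \<theta> l) \<noteq> 0 \<Longrightarrow> regular l"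
    using off_circle_eigen[of l "szego l", OF l' P1 P2] off_circle_regular[of l "szego l", OF l' P1 P2]
    by (simp_all add: p q DeltaM_def)
qed

definition DeltaM_ext :: "complex \<Rightarrow> complex" where
  "DeltaM_ext w = 1 - \<alpha> * \<beta> * (cnj \<theta>0 - cnj w)\<^sup>2"

text \<open>Outside the disc the obstruction is at the other end: the resolvent must be orthogonal
  to \<open>tpow 0\<close>, and \<open>u\<close> expresses that coefficient as a functional of
  \<open>H\<close>. Its values on \<open>tpow 0\<close> and \<open>k0\<close> carry a common factor
  \<open>- 1 / l\<close>, so the determinant is \<open>DeltaM_ext\<close> divided by the square of
  \<open>l\<close>.\<close>

lemma
  assumes l: "cmod l > 1"
  shows exterior_eigen: "DeltaM_ext (disc_ext \<theta> (1 / cnj l)) = 0 \<Longrightarrow> eigen l"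
    and exterior_regular: "DeltaM_ext (disc_ext \<theta> (1 / cnj l)) \<noteq> 0 \<Longrightarrow> regular l"
proof -
  have l': "cmod l \<noteq> 1" "l \<noteq> 0" using l by auto
  let ?w = "1 / cnj l"
  have w: "cmod ?w < 1" using l by (simp add: norm_divide divide_less_eq_1)
  define u where "u = mult_L2 (\<lambda>\<zeta>. cnj (1 / (\<zeta> - l))) (tpow 0)"
  have u: "cinner_L2 x u = cinner_L2 (resolv l x) (tpow 0)" for x
    unfolding u_def resolv_def by (rule cinner_mult_left[OF resolv_symbol_Linf[OF l'(1)], symmetric])
  have P1: "cinner_L2 (Zop f - l *\<^sub>C f) u = 0" if "f \<in> K" for f
    unfolding u resolv_Zop[OF l'(1)] using that by (simp add: K_iff)
  have P2: "resolv l H \<in> K \<and> c (resolv l H) = b" if "rhs b H" "cinner_L2 H u = 0" for H b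
    using that l u by (intro resolvent_K[OF Zop_resolv[OF l'(1)] that(1)]) auto
  have p: "cinner_L2 (tpow 0) u = - 1 / l"
  proof -
    have "resolv l (tpow 0) = mult_L2 \<theta> (resolv l (zpow 0))"
      unfolding tpow_def resolv_def by (rule mult_L2_commute[OF resolv_symbol_Linf[OF l'(1)] \<theta>_Linf])
    then have "cinner_L2 (tpow 0) u = cinner_L2 (resolv l (zpow 0)) (zpow 0)"
      unfolding u by (simp add: tpow_def cinner_unimodular_mult[OF \<theta>_unimodular])
    also have "\<dots> = (- 1 / l) * cnj (ev ?w (zpow 0))"
      unfolding resolv_one_exterior[OF l] ev_def by (subst cinner_L2_commute[of "zpow 0"]) (simp add: cinner_simps)
    finally show ?thesis by (simp add: ev_zpow[OF w])
  qed
  have "cinner_L2 (zpow 0) u = (- 1 / l) * cnj (ev ?w (tpow 0))"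
    unfolding u resolv_one_exterior[OF l] ev_def by (subst (2) cinner_L2_commute) (simp add: cinner_simps)
  then have q: "cinner_L2 k0 u = (- 1 / l) * (cnj (disc_ext \<theta> ?w) - cnj \<theta>0)"
    unfolding cinner_k0 p using disc_ext_eq_ev[OF Linf_fun_L2[OF \<theta>_Linf] w] by (simp add: tpow_0 algebra_simps)
  have D: "(cinner_L2 (tpow 0) u)\<^sup>2 - \<alpha> * \<beta> * (cinner_L2 k0 u)\<^sup>2 = DeltaM_ext (disc_ext \<theta> ?w) / l\<^sup>2"
  proof -
    have "((- 1 / l) * X)\<^sup>2 = X\<^sup>2 / l\<^sup>2" "(- 1 / l)\<^sup>2 = 1 / l\<^sup>2" for X by (simp_all add: power_divide)
    then show ?thesis unfolding p q DeltaM_ext_def power2_commute[of "cnj \<theta>0"]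
      by (simp only: diff_divide_distrib times_divide_eq_right)
  qed
  show "DeltaM_ext (disc_ext \<theta> ?w) = 0 \<Longrightarrow> eigen l" "DeltaM_ext (disc_ext \<theta> ?w) \<noteq> 0 \<Longrightarrow> regular l"
    using off_circle_eigen[of l u, OF l'(1) P1 P2] off_circle_regular[of l u, OF l'(1) P1 P2] l'(2)
    by (simp_all add: D)
qed

end

section \<open>Boundary points and angular derivatives\<close>

lemma fn_resolvent_eq:
  assumes "Zop f - l *\<^sub>C f = L2_of u" "u \<in> L2_fun"
  shows "AE \<zeta> in circle_measure. fn f \<zeta> = u \<zeta> / (\<zeta> - l)"
proof -
  have "AE \<zeta> in circle_measure. fn (Zop f - l *\<^sub>C f) \<zeta> = u \<zeta>" using fn_L2_of[OF assms(2)] assms(1) by simp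
  then show ?thesis
    using fn_mult_L2[OF diff_symbol_Linf[of l], of f] AE_circle_neq[of l]
    unfolding Zop_diff_eq_mult by eventually_elim (auto simp: field_simps)
qed

lemma Zop_diff_inj: "Zop f - l *\<^sub>C f = 0 \<Longrightarrow> f = 0"
proof (rule L2_eqI)
  assume "Zop f - l *\<^sub>C f = 0"
  then have "AE \<zeta> in circle_measure. fn f \<zeta> = 0 / (\<zeta> - l)"
    by (intro fn_resolvent_eq[where u = "\<lambda>_. 0"]) (auto simp: L2_fun_zero zero_L2_circle_def)
  moreover have "AE \<zeta> in circle_measure. fn 0 \<zeta> = 0"
    using fn_L2_of[OF L2_fun_zero] by (simp add: zero_L2_circle_def)
  ultimately show "AE \<zeta> in circle_measure. fn f \<zeta> = fn 0 \<zeta>" by eventually_elim simp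
qed

text \<open>The radius ends up in every such region, since along it
  \<open>cmod (z - l) = 1 - cmod z\<close>. Nontangential limits are therefore unique, as the
  definite description in \<open>inner_value\<close> requires.\<close>

lemma at_within_Stolz_nontrivial:
  assumes l: "cmod l = 1" and a: "\<alpha> > 1" shows "at l within Stolz_region l \<alpha> \<noteq> bot"
proof -
  define z where "z n = of_real (1 - 1 / real (n + 2)) * l" for n
  have "z n \<in> Stolz_region l \<alpha> - {l}" for n
  proof -
    define r where "r = 1 / real (n + 2)"
    have r: "0 < r" "r < 1" by (auto simp: r_def)
    have zr: "z n = of_real (1 - r) * l" by (simp only: z_def r_def)
    have nz: "cmod (z n) = 1 - r" using r l unfolding zr norm_mult norm_of_real by simp
    have "z n - l = of_real (- r) * l" by (simp add: zr algebra_simps)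
    then have "cmod (z n - l) = r" using r l by (simp add: norm_mult)
    then show ?thesis using nz r a l by (auto simp: Stolz_region_def)
  qed
  moreover have "z \<longlonglongrightarrow> l"
  proof -
    have "(\<lambda>n. 1 / real (n + 2)) \<longlonglongrightarrow> 0"
      using LIMSEQ_ignore_initial_segment[OF lim_1_over_n, of 2] by simp
    then have "(\<lambda>n. of_real (1 - 1 / real (n + 2)) * l) \<longlonglongrightarrow> of_real (1 - 0) * l"
      by (intro tendsto_intros)
    then show ?thesis by (simp add: z_def[abs_def])
  qed
  ultimately have "l islimpt Stolz_region l \<alpha>" unfolding islimpt_sequential by blast
  then show ?thesis by (simp add: trivial_limit_within)
qed

lemma nontangential_limit_unique:
  assumes "cmod l = 1" "nontangential_limit F l a" "nontangential_limit F l b"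
  shows "a = b"
  using assms at_within_Stolz_nontrivial[OF assms(1), of 2]
  unfolding nontangential_limit_def by (meson one_less_numeral_iff semiring_norm(76) tendsto_unique)

context inner_function
begin

text \<open>\<open>1 / (\<zeta> - l)\<close> is not square integrable: the non-negative coefficients
  of a solution all have the same modulus, so Bessel makes them zero.\<close>

lemma circle_resolvent_one:
  assumes l: "cmod l = 1" and eq: "Zop f - l *\<^sub>C f = b *\<^sub>C zpow 0"
  shows "b = 0"
proof -
  have f: "f \<in> Hardy2" using resolvent_Hardy2[OF eq] l by (auto intro: Hardy2_intros zpow_Hardy2)
  have rec: "cinner_L2 f (zpow (int n)) = l * cinner_L2 f (zpow (int (Suc n)))" for n
    using resolvent_coeff(1)[OF eq, of "int (Suc n)"] by (simp add: cinner_simps cinner_zpow_zpow)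
  have "cmod (cinner_L2 f (zpow 0)) = cmod (cinner_L2 f (zpow (int n)))" for n
  proof (induction n)
    case (Suc n) then show ?case using rec[of n] l by (simp add: norm_mult)
  qed simp
  then have "cmod (cinner_L2 f (zpow 0)) \<le> 0"
    by (intro Bessel_const_modulus[where e = "\<lambda>n. zpow (int n)" and x = f]) (auto simp: cinner_zpow_zpow)
  then show "b = 0"
    using resolvent_coeff(1)[OF eq, of 0] f by (simp add: Hardy2_iff cinner_simps cinner_zpow_zpow)
qed

text \<open>If the moduli of \<open>a\<close> and \<open>b\<close> differ,
  \<open>a \<theta> - b\<close> is bounded away from zero on the circle, and dividing
  \<open>f\<close> by it would make \<open>1 / (\<zeta> - l)\<close> square integrable.\<close>

lemma circle_resolvent_dichotomy:
  assumes l: "cmod l = 1" and eq: "Zop f - l *\<^sub>C f = a *\<^sub>C tpow 0 - b *\<^sub>C zpow 0"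
  shows "(a = 0 \<and> b = 0) \<or> (a \<noteq> 0 \<and> cmod (b / a) = 1)"
proof -
  have "b = 0" if "a = 0"
    using circle_resolvent_one[OF l, of f "- b"] eq that by (simp add: scaleC_uminus_left)
  moreover have "cmod b = cmod a" if "a \<noteq> 0"
  proof (rule ccontr)
    assume ne: "cmod b \<noteq> cmod a"
    define d where "d = \<bar>cmod a - cmod b\<bar>"
    have d: "d > 0" using ne by (simp add: d_def)
    let ?s = "\<lambda>\<zeta>. a * \<theta> \<zeta> - b"
    have sL: "?s \<in> Linf_fun" by (intro Linf_fun_intros \<theta>_Linf)
    have "AE \<zeta> in circle_measure. cmod (\<theta> \<zeta>) = 1" using \<theta>_unimodular by (simp add: unimodular_def)
    then have ae: "AE \<zeta> in circle_measure. cmod (?s \<zeta>) \<ge> d"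
    proof eventually_elim
      case (elim \<zeta>)
      then show ?case using norm_triangle_ineq3[of "a * \<theta> \<zeta>" b] by (simp add: norm_mult d_def)
    qed
    have [measurable]: "\<theta> \<in> borel_measurable borel" by (rule Linf_fun_measurable[OF \<theta>_Linf])
    have uL: "(\<lambda>\<zeta>. 1 / ?s \<zeta>) \<in> Linf_fun"
    proof (rule Linf_funI)
      show "AE \<zeta> in circle_measure. cmod (1 / ?s \<zeta>) \<le> 1 / d"
        using ae by eventually_elim (use d in \<open>auto simp: norm_divide intro!: frac_le\<close>)
    qed measurable
    let ?g = "mult_L2 (\<lambda>\<zeta>. 1 / ?s \<zeta>) f"
    have "Zop ?g - l *\<^sub>C ?g = mult_L2 (\<lambda>\<zeta>. 1 / ?s \<zeta>) (Zop f - l *\<^sub>C f)"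
      unfolding Zop_diff_eq_mult by (rule mult_L2_commute[OF diff_symbol_Linf uL])
    also have "Zop f - l *\<^sub>C f = mult_L2 ?s (zpow 0)"
      unfolding eq tpow_def by (subst mult_L2_diff_symbol)
        (auto simp: mult_L2_scale_symbol \<theta>_Linf mult_L2_const intro!: Linf_fun_intros)
    also have "mult_L2 (\<lambda>\<zeta>. 1 / ?s \<zeta>) (mult_L2 ?s (zpow 0)) = 1 *\<^sub>C zpow 0"
    proof -
      have one: "AE \<zeta> in circle_measure. 1 / ?s \<zeta> * ?s \<zeta> = 1" using ae by eventually_elim (use d in auto)
      show ?thesis unfolding mult_L2_mult[OF uL sL] mult_L2_cong[OF Linf_fun_mult[OF uL sL] Linf_fun_const one] mult_L2_const ..
    qed
    finally have "(1::complex) = 0" by (rule circle_resolvent_one[OF l])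
    then show False by simp
  qed
  ultimately show ?thesis by (cases "a = 0") (simp_all add: norm_divide)
qed

subsection \<open>Difference quotients of an inner function\<close>

text \<open>The difference quotient \<open>(\<theta> - \<theta>(z)) / (\<zeta> - z)\<close>, which
  is the reproducing kernel of \<open>K\<close> at \<open>z\<close> under the conjugation
  \<open>f \<mapsto> \<theta> cnj (\<zeta> f)\<close>.\<close>

definition dq :: "complex \<Rightarrow> L2_circle" where
  "dq z = resolv z (tpow 0 - disc_ext \<theta> z *\<^sub>C zpow 0)"

lemma ev_tpow_0: "cmod z < 1 \<Longrightarrow> ev z (tpow 0) = disc_ext \<theta> z"
  using disc_ext_eq_ev[OF Linf_fun_L2[OF \<theta>_Linf]] by (simp add: tpow_0)

lemma Zop_dq: "cmod z < 1 \<Longrightarrow> Zop (dq z) - z *\<^sub>C dq z = tpow 0 - disc_ext \<theta> z *\<^sub>C zpow 0"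
  unfolding dq_def by (rule Zop_resolv) simp

lemma rhs_symbol: "rhs (a - b * cnj \<theta>0) (a *\<^sub>C tpow 0 - b *\<^sub>C zpow 0)"
  using rhs_add[OF rhs_scale[OF rhs_tpow, of a] rhs_scale[OF rhs_one, of "- b"]] by (simp add: scaleC_uminus_left)

lemma dq_K: assumes z: "cmod z < 1" shows "dq z \<in> K"
proof -
  have r: "rhs (1 - disc_ext \<theta> z * cnj \<theta>0) (tpow 0 - disc_ext \<theta> z *\<^sub>C zpow 0)"
    using rhs_symbol[of 1 "disc_ext \<theta> z"] by simp
  have "cinner_L2 (dq z) (zpow (-1)) = 0"
  proof -
    have "ev z (Zop (dq z) - z *\<^sub>C dq z) = 0"
      unfolding Zop_dq[OF z] by (simp add: ev_simps ev_tpow_0 ev_zpow z)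
    then show ?thesis by (simp add: ev_simps ev_Zop z)
  qed
  then show ?thesis using resolvent_K[OF Zop_dq[OF z] r] z by simp
qed

text \<open>Expand the norm of \<open>\<zeta> g = \<theta> + z g - \<theta>(z)\<close>, which equals
  that of \<open>g\<close>. The identity gives the bound 1 for \<theta> in the disc and translates
  between norms of difference quotients and the Julia quotient
  \<open>(1 - |\<theta>(z)|^2) / (1 - |z|^2)\<close>.\<close>

lemma norm_dq_sq:
  assumes z: "cmod z < 1"
  shows "(norm (dq z))\<^sup>2 * (1 - (cmod z)\<^sup>2) = 1 - (cmod (disc_ext \<theta> z))\<^sup>2"
proof -
  let ?g = "dq z" and ?t = "disc_ext \<theta> z"
  let ?a = "cinner_L2 ?g (zpow 0)" and ?N = "cinner_L2 ?g ?g"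
  have Zg: "Zop ?g = tpow 0 + z *\<^sub>C ?g - ?t *\<^sub>C zpow 0" using Zop_dq[OF z] by (simp add: algebra_simps)
  have gK: "?g \<in> K" by (rule dq_K[OF z])
  have o: "cinner_L2 ?g (tpow 0) = 0" "cinner_L2 (tpow 0) ?g = 0"
    using gK cinner_L2_commute[of "tpow 0" ?g] by (auto simp: K_iff)
  have za: "z * ?a = ?t - \<theta>0"
    using resolvent_coeff(1)[OF Zop_dq[OF z], of 0] gK
    by (simp add: cinner_simps cinner_zpow_zpow \<theta>0_eq K_iff algebra_simps)
  have za': "cnj z * cnj ?a = cnj ?t - cnj \<theta>0" using za by (metis complex_cnj_mult complex_cnj_diff)
  have ga: "cinner_L2 (zpow 0) ?g = cnj ?a" by (rule cinner_L2_commute)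
  have "?N = cinner_L2 (Zop ?g) (Zop ?g)" by (rule cinner_unimodular_mult[OF unimodular_id, symmetric])
  also have "\<dots> = 1 + z * cnj z * ?N + ?t * cnj ?t - cnj ?t * \<theta>0 - ?t * cnj \<theta>0
      - cnj ?t * (z * ?a) - ?t * (cnj z * cnj ?a)"
    unfolding Zg by (simp add: cinner_simps o cinner_tpow_tpow cinner_zpow_zpow ga cinner_zpow_0_tpow \<theta>0_eq[symmetric] algebra_simps)
  also have "\<dots> = 1 + z * cnj z * ?N - ?t * cnj ?t" unfolding za za' by (simp add: algebra_simps)
  finally have "?N * (1 - z * cnj z) = 1 - ?t * cnj ?t" by (simp add: algebra_simps)
  then have "complex_of_real ((norm ?g)\<^sup>2 * (1 - (cmod z)\<^sup>2)) = of_real (1 - (cmod ?t)\<^sup>2)"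
    by (simp only: cinner_self_eq_norm complex_norm_square[symmetric] of_real_mult of_real_diff of_real_1)
  then show ?thesis by (simp only: of_real_eq_iff)
qed

lemma norm_disc_ext_le: assumes z: "cmod z < 1" shows "cmod (disc_ext \<theta> z) \<le> 1"
proof -
  have "0 \<le> (norm (dq z))\<^sup>2 * (1 - (cmod z)\<^sup>2)" using z by (intro mult_nonneg_nonneg) (auto simp: abs_square_le_1)
  then show ?thesis unfolding norm_dq_sq[OF z] by (simp add: abs_square_le_1)
qed

text \<open>The difference quotients converge almost everywhere to an explicit function, so a norm
  bound and Fatou's lemma make the limit square integrable.\<close>

lemma dq_limit:
  assumes l: "cmod l = 1" and z: "\<And>n. cmod (z n) < 1" and lim: "z \<longlonglongrightarrow> l" "(\<lambda>n. disc_ext \<theta> (z n)) \<longlonglongrightarrow> w"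
    and C: "\<And>n. norm (dq (z n)) \<le> C"
  shows "\<exists>g. Zop g - l *\<^sub>C g = tpow 0 - w *\<^sub>C zpow 0"
proof -
  define G where "G \<zeta> = (\<theta> \<zeta> - w) / (\<zeta> - l)" for \<zeta>
  have [measurable]: "\<theta> \<in> borel_measurable borel" by (rule Linf_fun_measurable[OF \<theta>_Linf])
  have fL: "(\<lambda>\<zeta>. \<theta> \<zeta> - t) \<in> L2_fun" for t by (intro Linf_fun_L2 Linf_fun_intros \<theta>_Linf)
  have sym: "tpow 0 - t *\<^sub>C zpow 0 = L2_of (\<lambda>\<zeta>. \<theta> \<zeta> - t)" for t
  proof -
    have "tpow 0 - t *\<^sub>C zpow 0 = mult_L2 (\<lambda>\<zeta>. \<theta> \<zeta> - t) (zpow 0)"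
      unfolding tpow_def by (subst mult_L2_diff_symbol) (auto simp: \<theta>_Linf mult_L2_const Linf_fun_const)
    then show ?thesis by (simp add: mult_zpow_zero Linf_fun_diff \<theta>_Linf Linf_fun_const)
  qed
  have "AE \<zeta> in circle_measure. fn (dq (z n)) \<zeta> = (\<theta> \<zeta> - disc_ext \<theta> (z n)) / (\<zeta> - z n)" for n
    by (rule fn_resolvent_eq[OF _ fL]) (simp only: Zop_dq[OF z] sym)
  then have ae: "AE \<zeta> in circle_measure. \<forall>n. fn (dq (z n)) \<zeta> = (\<theta> \<zeta> - disc_ext \<theta> (z n)) / (\<zeta> - z n)"
    by (simp add: AE_all_countable)
  have lim': "AE \<zeta> in circle_measure. (\<lambda>n. fn (dq (z n)) \<zeta>) \<longlonglongrightarrow> G \<zeta>"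
    using ae AE_circle_neq[of l]
  proof eventually_elim
    case (elim \<zeta>)
    have "(\<lambda>n. (\<theta> \<zeta> - disc_ext \<theta> (z n)) / (\<zeta> - z n)) \<longlonglongrightarrow> (\<theta> \<zeta> - w) / (\<zeta> - l)"
      using elim lim by (intro tendsto_intros) auto
    then show ?case using elim by (simp add: G_def)
  qed
  have GL: "G \<in> L2_fun"
    by (rule L2_Fatou(1)[OF _ _ _ lim', where C = C]) (auto simp: C G_def[abs_def])
  have "Zop (L2_of G) - l *\<^sub>C L2_of G = L2_of (\<lambda>\<zeta>. (\<zeta> - l) * G \<zeta>)"
    unfolding Zop_diff_eq_mult by (rule mult_L2_of[OF diff_symbol_Linf GL])
  also have "\<dots> = L2_of (\<lambda>\<zeta>. \<theta> \<zeta> - w)"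
  proof (subst L2_of_eq_iff[OF L2_fun_mult[OF diff_symbol_Linf GL] fL])
    show "AE \<zeta> in circle_measure. (\<zeta> - l) * G \<zeta> = \<theta> \<zeta> - w"
      using AE_circle_neq[of l] by eventually_elim (simp add: G_def)
  qed
  finally show ?thesis unfolding sym by blast
qed

subsection \<open>Caratheodory's theorem\<close>

text \<open>The difference quotient of \<theta> at \<open>z\<close> is \<open>ev z g\<close>, so
  everything rests on a nontangential limit of \<open>ev z g\<close>. The Szego kernels have
  unbounded norm near \<open>l\<close>, hence the rewriting of \<open>ev z g\<close> as an integral
  of \<open>|g|^2\<close> against a kernel that stays bounded in Stolz regions.\<close>

lemma boundary_quotient_imp_ADC:
  assumes l: "cmod l = 1" and eq: "Zop g - l *\<^sub>C g = tpow 0 - w *\<^sub>C zpow 0"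
  shows "l \<in> T_ADC \<theta> \<and> inner_value \<theta> l = w"
proof -
  have w: "cmod w = 1" using circle_resolvent_dichotomy[OF l, of g 1 w] eq by simp
  have gK: "g \<in> K" using resolvent_K[OF eq, of "1 - w * cnj \<theta>0"] rhs_symbol[of 1 w] l by simp
  have quot: "disc_ext \<theta> z - w = (z - l) * ev z g" if z: "cmod z < 1" for z
  proof -
    have "ev z (Zop g - l *\<^sub>C g) = disc_ext \<theta> z - w"
      unfolding eq by (simp add: ev_simps ev_tpow_0 ev_zpow z)
    moreover have "ev z (Zop g - l *\<^sub>C g) = (z - l) * ev z g"
      using gK by (simp add: ev_simps ev_Zop z K_iff algebra_simps)
    ultimately show ?thesis by simp
  qed
  \<comment> \<open>As \<open>g\<close> is orthogonal to \<open>\<theta> H^2\<close>, it may be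
    paired with \<open>(1 - cnj w \<theta>) / (1 - cnj z \<zeta>)\<close> instead of the Szego
    kernel, and \<open>1 - cnj w \<theta> = - cnj w (\<zeta> - l) g\<close> because
    \<open>|w| = 1\<close>. \<open>G\<close> is the resulting integrand.\<close>
  define G where "G z \<zeta> = - w * (fn g \<zeta> * cnj (fn g \<zeta>)) * cnj (\<zeta> - l) / cnj (1 - cnj z * \<zeta>)" for z \<zeta>
  have [measurable]: "G z \<in> borel_measurable borel" for z unfolding G_def by measurable
  have intg: "ev z g = (LINT \<zeta>|circle_measure. G z \<zeta>)" if z: "cmod z < 1" for z
  proof -
    note sL = szego_symbol_Linf[OF z]
    have "ev z g = cinner_L2 g (szego z - cnj w *\<^sub>C mult_L2 \<theta> (szego z))"
      using K_orth[OF gK szego_Hardy2[OF z]] by (simp add: ev_def cinner_simps)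
    also have "szego z - cnj w *\<^sub>C mult_L2 \<theta> (szego z) = mult_L2 (\<lambda>\<zeta>. 1 / (1 - cnj z * \<zeta>)) ((- cnj w) *\<^sub>C (Zop g - l *\<^sub>C g))"
    proof -
      have s: "szego z = mult_L2 (\<lambda>\<zeta>. 1 / (1 - cnj z * \<zeta>)) (zpow 0)" by (simp add: szego_def mult_zpow_zero[OF sL])
      have "(- cnj w) *\<^sub>C (Zop g - l *\<^sub>C g) = zpow 0 - cnj w *\<^sub>C tpow 0"
        unfolding eq using w complex_norm_square[of w] by (simp add: scaleC_diff_right scaleC_uminus_left scaleC_scaleC mult.commute)
      then show ?thesis unfolding tpow_def by (simp add: mult_L2_simps s mult_L2_commute[OF sL \<theta>_Linf])
    qed
    also have "cinner_L2 g \<dots> = (LINT \<zeta>|circle_measure. G z \<zeta>)"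
      unfolding cinner_fn
    proof (rule integral_cong_AE)
      let ?y = "(- cnj w) *\<^sub>C (Zop g - l *\<^sub>C g)"
      show "AE \<zeta> in circle_measure. fn g \<zeta> * cnj (fn (mult_L2 (\<lambda>\<zeta>. 1 / (1 - cnj z * \<zeta>)) ?y) \<zeta>) = G z \<zeta>"
        using fn_mult_L2[OF sL, of ?y] fn_scaleC[of "- cnj w" "Zop g - l *\<^sub>C g"] fn_mult_L2[OF diff_symbol_Linf, of l g]
        unfolding Zop_diff_eq_mult by eventually_elim (simp add: G_def)
    qed measurable
    finally show ?thesis .
  qed
  define d where "d = (LINT \<zeta>|circle_measure. G l \<zeta>)"
  have lim: "((\<lambda>z. ev z g) \<longlongrightarrow> d) (at l within Stolz_region l \<alpha>)" if \<alpha>: "\<alpha> > 1" for \<alpha>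
    unfolding tendsto_at_iff_sequentially
  proof (intro allI impI)
    fix X :: "nat \<Rightarrow> complex" assume X: "\<forall>i. X i \<in> Stolz_region l \<alpha> - {l}" "X \<longlonglongrightarrow> l"
    have X1: "cmod (X i) < 1" and X2: "cmod (X i - l) < \<alpha> * (1 - cmod (X i))" for i
      using X(1) by (auto simp: Stolz_region_def)
    \<comment> \<open>In the Stolz region
      \<open>|X - l| < \<alpha> (1 - |X|) \<le> \<alpha> |\<zeta> - X|\<close>, so the quotient
      \<open>|\<zeta> - l| / |\<zeta> - X|\<close> is at most \<open>1 + \<alpha>\<close>.\<close>
    have "(\<lambda>i. LINT \<zeta>|circle_measure. G (X i) \<zeta>) \<longlonglongrightarrow> (LINT \<zeta>|circle_measure. G l \<zeta>)"
    proof (rule integral_dominated_convergence[where w = "\<lambda>\<zeta>. (1 + \<alpha>) * (cmod (fn g \<zeta>))\<^sup>2"])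
      show "integrable circle_measure (\<lambda>\<zeta>. (1 + \<alpha>) * (cmod (fn g \<zeta>))\<^sup>2)"
        using L2_fun_integrable[OF fn_L2] by simp
      show "AE \<zeta> in circle_measure. (\<lambda>i. G (X i) \<zeta>) \<longlonglongrightarrow> G l \<zeta>"
        using AE_circle_norm AE_circle_neq[of l]
      proof eventually_elim
        case (elim \<zeta>)
        have "cnj l * l = 1" using l complex_norm_square[of l] by (simp add: mult.commute)
        then have "cnj l * \<zeta> \<noteq> 1" using elim(2)
          by (metis mult.commute mult_cancel_right mult.left_neutral zero_neq_one mult_zero_right)
        then have "l * cnj \<zeta> \<noteq> 1" by (metis complex_cnj_cnj complex_cnj_mult complex_cnj_one)
        then show ?case unfolding G_def using X(2) by (intro tendsto_intros) auto
      qed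
      show "AE \<zeta> in circle_measure. norm (G (X i) \<zeta>) \<le> (1 + \<alpha>) * (cmod (fn g \<zeta>))\<^sup>2" for i
        using AE_circle_norm
      proof eventually_elim
        case (elim \<zeta>)
        have e: "cmod (1 - cnj (X i) * \<zeta>) = cmod (\<zeta> - X i)"
        proof -
          have "cmod (1 - cnj (X i) * \<zeta>) = cmod (cnj \<zeta> * \<zeta> - cnj (X i) * \<zeta>)"
            using complex_norm_square[of \<zeta>] elim by (simp add: mult.commute)
          also have "\<dots> = cmod (cnj (\<zeta> - X i) * \<zeta>)" by (simp add: algebra_simps)
          also have "\<dots> = cmod (\<zeta> - X i)" using elim by (simp add: norm_mult del: complex_cnj_diff)
          finally show ?thesis .
        qed
        have pos: "cmod (\<zeta> - X i) \<ge> 1 - cmod (X i)" using norm_triangle_ineq2[of \<zeta> "X i"] elim by simp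
        have "cmod (\<zeta> - l) \<le> cmod (\<zeta> - X i) + cmod (X i - l)" using norm_triangle_ineq[of "\<zeta> - X i" "X i - l"] by simp
        also have "cmod (X i - l) \<le> \<alpha> * cmod (\<zeta> - X i)"
          using X2[of i] mult_left_mono[OF pos, of \<alpha>] \<alpha> by linarith
        finally have b: "cmod (\<zeta> - l) \<le> (1 + \<alpha>) * cmod (\<zeta> - X i)" by (simp add: algebra_simps)
        have pp: "cmod (\<zeta> - X i) > 0" using pos X1[of i] by linarith
        have "norm (G (X i) \<zeta>) = (cmod (fn g \<zeta>))\<^sup>2 * (cmod (\<zeta> - l) / cmod (\<zeta> - X i))"
          unfolding G_def norm_mult norm_divide complex_mod_cnj e norm_minus_cancel w by (simp add: power2_eq_square)
        also have "\<dots> \<le> (cmod (fn g \<zeta>))\<^sup>2 * (1 + \<alpha>)"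
          using b pp by (intro mult_left_mono) (auto simp: divide_le_eq)
        finally show ?case by (simp add: mult.commute)
      qed
    qed measurable
    then show "((\<lambda>z. ev z g) \<circ> X) \<longlonglongrightarrow> d" by (simp add: o_def intg X1 d_def)
  qed
  have inS: "\<forall>\<^sub>F z in at l within Stolz_region l \<alpha>. cmod z < 1 \<and> z \<noteq> l" for \<alpha>
    by (auto simp: eventually_at_filter Stolz_region_def)
  have lim1: "nontangential_limit (disc_ext \<theta>) l w"
    unfolding nontangential_limit_def
  proof (intro allI impI)
    fix \<alpha> :: real assume "\<alpha> > 1"
    have "((\<lambda>z. (z - l) * ev z g + w) \<longlongrightarrow> (l - l) * d + w) (at l within Stolz_region l \<alpha>)"
      by (intro tendsto_intros lim \<open>\<alpha> > 1\<close>)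
    then have "((\<lambda>z. (z - l) * ev z g + w) \<longlongrightarrow> w) (at l within Stolz_region l \<alpha>)" by simp
    then show "(disc_ext \<theta> \<longlongrightarrow> w) (at l within Stolz_region l \<alpha>)"
    proof (rule Lim_transform_eventually)
      show "\<forall>\<^sub>F z in at l within Stolz_region l \<alpha>. (z - l) * ev z g + w = disc_ext \<theta> z"
        using inS by eventually_elim (simp add: quot[symmetric])
    qed
  qed
  have lim2: "nontangential_limit (\<lambda>z. (disc_ext \<theta> z - w) / (z - l)) l d"
    unfolding nontangential_limit_def
  proof (intro allI impI)
    fix \<alpha> :: real assume "\<alpha> > 1"
    show "((\<lambda>z. (disc_ext \<theta> z - w) / (z - l)) \<longlongrightarrow> d) (at l within Stolz_region l \<alpha>)"
    proof (rule Lim_transform_eventually[OF lim[OF \<open>\<alpha> > 1\<close>]])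
      show "\<forall>\<^sub>F z in at l within Stolz_region l \<alpha>. ev z g = (disc_ext \<theta> z - w) / (z - l)"
        using inS by eventually_elim (simp add: quot)
    qed
  qed
  have "l \<in> T_ADC \<theta>" using l w lim1 lim2 by (auto simp: T_ADC_def)
  moreover have "inner_value \<theta> l = w"
    unfolding inner_value_def using l lim1 nontangential_limit_unique[OF l] by (auto intro!: the_equality)
  ultimately show ?thesis by simp
qed

text \<open>An angular derivative bounds the Julia quotient along a nontangential sequence, hence
  the norms of \<open>dq\<close>, and the limit of these difference quotients is the function
  sought.\<close>

lemma ADC_imp_boundary_quotient:
  assumes "l \<in> T_ADC \<theta>"
  shows "\<exists>g. Zop g - l *\<^sub>C g = tpow 0 - inner_value \<theta> l *\<^sub>C zpow 0"
proof -
  obtain w d where l: "cmod l = 1" and lim1: "nontangential_limit (disc_ext \<theta>) l w" and w: "cmod w = 1"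
    and lim2: "nontangential_limit (\<lambda>z. (disc_ext \<theta> z - w) / (z - l)) l d"
    using assms by (auto simp: T_ADC_def)
  have iv: "inner_value \<theta> l = w"
    unfolding inner_value_def using l lim1 nontangential_limit_unique[OF l] by (auto intro!: the_equality)
  let ?S = "Stolz_region l 2"
  have t1: "(disc_ext \<theta> \<longlongrightarrow> w) (at l within ?S)" and t2: "((\<lambda>z. (disc_ext \<theta> z - w) / (z - l)) \<longlongrightarrow> d) (at l within ?S)"
    using lim1 lim2 by (auto simp: nontangential_limit_def)
  have "l islimpt ?S" using at_within_Stolz_nontrivial[OF l, of 2] by (simp add: trivial_limit_within)
  then obtain X where X: "\<And>n. X n \<in> ?S - {l}" "X \<longlonglongrightarrow> l" unfolding islimpt_sequential by blast
  have X1: "cmod (X i) < 1" and X2: "cmod (X i - l) < 2 * (1 - cmod (X i))" for i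
    using X(1) by (auto simp: Stolz_region_def)
  have s1: "(\<lambda>n. disc_ext \<theta> (X n)) \<longlonglongrightarrow> w" and s2: "(\<lambda>n. (disc_ext \<theta> (X n) - w) / (X n - l)) \<longlonglongrightarrow> d"
    using t1 t2 X unfolding tendsto_at_iff_sequentially o_def by blast+
  obtain B where B: "B > 0" "\<And>n. cmod ((disc_ext \<theta> (X n) - w) / (X n - l)) \<le> B"
    using convergent_imp_Bseq[OF convergentI[OF s2]] by (auto elim: BseqE)
  \<comment> \<open>One factor 2 is the aperture of the Stolz region, the other bounds
    \<open>1 + |\<theta>|\<close>.\<close>
  have "norm (dq (X n)) \<le> sqrt (4 * B)" for n
  proof (rule real_le_rsqrt)
    let ?z = "X n" and ?t = "disc_ext \<theta> (X n)"
    have pos: "1 - cmod ?z > 0" using X1 by simp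
    have "cmod (?t - w) = cmod ((?t - w) / (?z - l)) * cmod (?z - l)" using X(1)[of n] by (simp add: norm_divide)
    also have "\<dots> \<le> B * (2 * (1 - cmod ?z))" using B(1) B(2)[of n] X2[of n] by (intro mult_mono) auto
    finally have tw: "cmod (?t - w) \<le> 2 * B * (1 - cmod ?z)" by (simp add: algebra_simps)
    have "1 - cmod ?t \<le> cmod (?t - w)" using norm_triangle_ineq2[of w ?t] w by (simp add: norm_minus_commute)
    then have "(1 - cmod ?t) * (1 + cmod ?t) \<le> (2 * B * (1 - cmod ?z)) * 2"
      using tw norm_disc_ext_le[OF X1, of n] B(1) pos by (intro mult_mono) auto
    then have "1 - (cmod ?t)\<^sup>2 \<le> 4 * B * (1 - cmod ?z)" by (simp add: power2_eq_square algebra_simps)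
    also have "\<dots> \<le> 4 * B * (1 - (cmod ?z)\<^sup>2)"
    proof -
      have "(cmod ?z)\<^sup>2 \<le> cmod ?z" using pos by (simp add: power2_eq_square mult_left_le_one_le)
      then show ?thesis using B(1) by (intro mult_left_mono) auto
    qed
    finally have "(norm (dq ?z))\<^sup>2 * (1 - (cmod ?z)\<^sup>2) \<le> (4 * B) * (1 - (cmod ?z)\<^sup>2)"
      by (simp add: norm_dq_sq X1)
    moreover have "1 - (cmod ?z)\<^sup>2 > 0" using X1[of n] by (simp add: abs_square_less_1)
    ultimately show "(norm (dq ?z))\<^sup>2 \<le> 4 * B" by (rule mult_right_le_imp_le)
  qed
  from dq_limit[OF l X1 X(2) s1 this] show ?thesis by (simp add: iv)
qed

text \<open>A non-trivial symbol can be normalised to \<open>a = 1\<close>, where Caratheodory's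
  theorem applies; a trivial one satisfies its relation for any value of \<theta> at
  \<open>l\<close>, so one non-zero coefficient suffices for both equations.\<close>

lemma boundary_symbols:
  assumes l: "cmod l = 1"
    and eq1: "Zop f - l *\<^sub>C f = a1 *\<^sub>C tpow 0 - b1 *\<^sub>C zpow 0"
    and eq2: "Zop g - l *\<^sub>C g = a2 *\<^sub>C tpow 0 - b2 *\<^sub>C zpow 0"
    and nz: "a1 \<noteq> 0 \<or> b1 \<noteq> 0 \<or> a2 \<noteq> 0 \<or> b2 \<noteq> 0"
  shows "l \<in> T_ADC \<theta>" "b1 = a1 * inner_value \<theta> l" "b2 = a2 * inner_value \<theta> l"
proof -
  have main: "(a = 0 \<and> b = 0) \<or> (l \<in> T_ADC \<theta> \<and> b = a * inner_value \<theta> l)"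
    if eq: "Zop h - l *\<^sub>C h = a *\<^sub>C tpow 0 - b *\<^sub>C zpow 0" for h a b
  proof (cases "a = 0")
    case False
    have "Zop ((1 / a) *\<^sub>C h) - l *\<^sub>C ((1 / a) *\<^sub>C h) = (1 / a) *\<^sub>C (Zop h - l *\<^sub>C h)"
      by (simp add: mult_L2_simps scaleC_diff_right scaleC_scaleC mult.commute)
    also have "\<dots> = tpow 0 - (b / a) *\<^sub>C zpow 0"
      unfolding eq using False by (simp add: scaleC_diff_right scaleC_scaleC)
    finally show ?thesis using boundary_quotient_imp_ADC[OF l] False by fastforce
  qed (use circle_resolvent_dichotomy[OF l eq] in auto)
  show "l \<in> T_ADC \<theta>" "b1 = a1 * inner_value \<theta> l" "b2 = a2 * inner_value \<theta> l"
    using main[OF eq1] main[OF eq2] nz by auto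
qed

end

context matrix_model
begin

subsection \<open>Eigenvalues on the circle\<close>

lemma subspace_closure:
  fixes S :: "'a::real_normed_vector set"
  assumes "subspace S" shows "subspace (closure S)"
proof (rule subspaceI)
  show "0 \<in> closure S" using assms closure_subset subspace_0 by blast
  show "x + y \<in> closure S" if xy: "x \<in> closure S" "y \<in> closure S" for x y
  proof -
    obtain a b where "\<And>n. a n \<in> S" "a \<longlonglongrightarrow> x" "\<And>n. b n \<in> S" "b \<longlonglongrightarrow> y"
      using xy unfolding closure_sequential by blast
    then have "\<forall>n. a n + b n \<in> S" "(\<lambda>n. a n + b n) \<longlonglongrightarrow> x + y"
      using subspace_add[OF assms] by (auto intro: tendsto_add)
    then show ?thesis unfolding closure_sequential by (intro exI[of _ "\<lambda>n. a n + b n"] conjI)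
  qed
  show "r *\<^sub>R x \<in> closure S" if x: "x \<in> closure S" for r x
  proof -
    obtain a where "\<And>n. a n \<in> S" "a \<longlonglongrightarrow> x" using x unfolding closure_sequential by blast
    then have "\<forall>n. r *\<^sub>R a n \<in> S" "(\<lambda>n. r *\<^sub>R a n) \<longlonglongrightarrow> r *\<^sub>R x"
      using subspace_scale[OF assms] by (auto intro: tendsto_scaleR)
    then show ?thesis unfolding closure_sequential by (intro exI[of _ "\<lambda>n. r *\<^sub>R a n"] conjI)
  qed
qed

lemma kernel_determinant:
  fixes p q a b c1 c2 :: complex
  assumes "c1 \<noteq> 0 \<or> c2 \<noteq> 0" "c1 * p - a * c2 * q = 0" "c2 * p - b * c1 * q = 0"
  shows "p\<^sup>2 - a * b * q\<^sup>2 = 0"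
  using linear_system_2[of p a b q c1 c2 0 0] assms by auto

lemma circle_eigen_iff:
  assumes l: "cmod l = 1"
  shows "eigen l \<longleftrightarrow> l \<in> T_ADC \<theta> \<and> DeltaM (inner_value \<theta> l) = 0"
proof
  assume "eigen l"
  then obtain f g where fg: "f \<in> K" "g \<in> K" "(f, g) \<noteq> 0" "Lop l (f, g) = 0" by (auto simp: eigen_def)
  then have "Zop f - l *\<^sub>C f = 0 + c f *\<^sub>C tpow 0 - (\<alpha> * c g) *\<^sub>C k0" "Zop g - l *\<^sub>C g = 0 + c g *\<^sub>C tpow 0 - (\<beta> * c f) *\<^sub>C k0"
    unfolding Tc_eq_iff[symmetric] by (simp_all add: Lop_def zero_prod_def)
  then have eqs: "Zop f - l *\<^sub>C f = (c f + \<alpha> * c g * cnj \<theta>0) *\<^sub>C tpow 0 - (\<alpha> * c g) *\<^sub>C zpow 0"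
     "Zop g - l *\<^sub>C g = (c g + \<beta> * c f * cnj \<theta>0) *\<^sub>C tpow 0 - (\<beta> * c f) *\<^sub>C zpow 0"
    by (simp_all add: k0_symbol)
  have cnz: "c f \<noteq> 0 \<or> c g \<noteq> 0"
  proof (rule ccontr)
    assume "\<not> ?thesis"
    then have "f = 0" "g = 0" using eqs Zop_diff_inj by auto
    then show False using fg(3) by (simp add: zero_prod_def)
  qed
  let ?w = "inner_value \<theta> l"
  have nz: "c f + \<alpha> * c g * cnj \<theta>0 \<noteq> 0 \<or> \<alpha> * c g \<noteq> 0 \<or> c g + \<beta> * c f * cnj \<theta>0 \<noteq> 0 \<or> \<beta> * c f \<noteq> 0"
    using cnz by auto
  note b = boundary_symbols[OF l eqs nz]
  have "c f * ?w - \<alpha> * c g * (1 - cnj \<theta>0 * ?w) = 0" "c g * ?w - \<beta> * c f * (1 - cnj \<theta>0 * ?w) = 0"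
  proof -
    have alg: "x * ?w - y * (1 - cnj \<theta>0 * ?w) = (x + y * cnj \<theta>0) * ?w - y" for x y
      by (simp add: algebra_simps)
    show "c f * ?w - \<alpha> * c g * (1 - cnj \<theta>0 * ?w) = 0" "c g * ?w - \<beta> * c f * (1 - cnj \<theta>0 * ?w) = 0"
      unfolding alg using b(2,3) by simp_all
  qed
  from kernel_determinant[OF cnz this] b(1) show "l \<in> T_ADC \<theta> \<and> DeltaM ?w = 0" by (simp add: DeltaM_def)
next
  let ?w = "inner_value \<theta> l"
  assume *: "l \<in> T_ADC \<theta> \<and> DeltaM ?w = 0"
  then obtain u where u: "Zop u - l *\<^sub>C u = tpow 0 - ?w *\<^sub>C zpow 0" using ADC_imp_boundary_quotient by blast
  obtain c1 c2 where c12: "c1 \<noteq> 0 \<or> c2 \<noteq> 0" "c1 * ?w - \<alpha> * c2 * (1 - cnj \<theta>0 * ?w) = 0" "c2 * ?w - \<beta> * c1 * (1 - cnj \<theta>0 * ?w) = 0"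
    using linear_system_2_kernel[of ?w \<alpha> \<beta> "1 - cnj \<theta>0 * ?w"] * by (auto simp: DeltaM_def)
  \<comment> \<open>Both components of the eigenvector are multiples of the one quotient
    \<open>u\<close>. The second condition says \<open>e * ?w = b\<close>, which makes
    \<open>e u\<close> solve the equation with the constants \<open>a\<close> and
    \<open>b\<close>.\<close>
  have sol: "Zop (e *\<^sub>C u) - l *\<^sub>C (e *\<^sub>C u) = 0 + a *\<^sub>C tpow 0 - b *\<^sub>C k0"
    if "e = a + b * cnj \<theta>0" "a * ?w - b * (1 - cnj \<theta>0 * ?w) = 0" for e a b
  proof -
    have "Zop (e *\<^sub>C u) - l *\<^sub>C (e *\<^sub>C u) = e *\<^sub>C (Zop u - l *\<^sub>C u)"
      by (simp add: mult_L2_simps scaleC_diff_right scaleC_scaleC mult.commute)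
    also have "\<dots> = e *\<^sub>C tpow 0 - (e * ?w) *\<^sub>C zpow 0" unfolding u by (simp add: scaleC_diff_right scaleC_scaleC)
    also have "e * ?w = b" using that by (simp add: algebra_simps)
    finally show ?thesis unfolding that(1) by (simp add: k0_symbol)
  qed
  let ?f = "(c1 + \<alpha> * c2 * cnj \<theta>0) *\<^sub>C u" and ?g = "(c2 + \<beta> * c1 * cnj \<theta>0) *\<^sub>C u"
  note s = sol[OF refl c12(2)] sol[OF refl c12(3)]
  have K: "?f \<in> K \<and> c ?f = c1" "?g \<in> K \<and> c ?g = c2"
    using l by (intro resolvent_K[OF s(1)] resolvent_K[OF s(2)] rhs_eq K_intros; simp)+
  then have "Tc \<alpha> ?f ?g - l *\<^sub>C ?f = 0" "Tc \<beta> ?g ?f - l *\<^sub>C ?g = 0"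
    unfolding Tc_eq_iff using s by simp_all
  moreover have "(?f, ?g) \<noteq> 0" using K c12(1) by (auto simp: zero_prod_def)
  ultimately show "eigen l" using K unfolding eigen_def
    by (intro bexI[of _ "(?f, ?g)"]) (auto simp: Lop_def zero_prod_def)
qed

subsection \<open>Density of the range on the circle\<close>

lemma Lop_scale: "Lop l (d *\<^sub>C f, d *\<^sub>C g) = (d *\<^sub>C fst (Lop l (f, g)), d *\<^sub>C snd (Lop l (f, g)))"
  by (simp add: Lop_def Tc_def mult_L2_simps cinner_simps scaleC_diff_right scaleC_add_right scaleC_scaleC mult.commute mult.left_commute)

text \<open>A vector orthogonal to the range is an eigenvector of the adjoint; in coordinates it solves
  equations of the same shape as an eigenvector of the operator itself.\<close>

lemma adjoint_equation:
  assumes l: "cmod l = 1" and u: "u \<in> K" and v: "v \<in> K"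
    and orth: "\<And>f. f \<in> K \<Longrightarrow> cinner_L2 (Zop f - c f *\<^sub>C tpow 0 - l *\<^sub>C f) u + cinner_L2 ((b * c f) *\<^sub>C k0) v = 0"
  defines "u0 \<equiv> cinner_L2 u (zpow 0)" and "v0 \<equiv> cinner_L2 v (zpow 0)"
  shows "Zop u - l *\<^sub>C u = (l * cnj b * v0) *\<^sub>C tpow 0 - (l * (u0 + cnj b * v0 * \<theta>0)) *\<^sub>C zpow 0"
proof -
  let ?Zb = "mult_L2 (\<lambda>\<zeta>. cnj \<zeta>)"
  \<comment> \<open>The vector of \<open>K\<close> representing the functional in
    \<open>orth\<close>: the last term removes the frequency -1 produced by the backward shift and
    by \<open>tpow (-1)\<close>. Being orthogonal to \<open>K\<close>, it is zero, and applying the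
    shift to it yields the equation.\<close>
  define V where "V = ?Zb u - cnj l *\<^sub>C u + (cnj b * v0) *\<^sub>C tpow (-1) - (u0 + cnj b * v0 * \<theta>0) *\<^sub>C zpow (-1)"
  have ZZb: "Zop (?Zb x) = x" for x
  proof -
    have "AE z in circle_measure. z * cnj z = 1"
      using AE_circle_norm by eventually_elim (metis complex_norm_square of_real_1 power_one)
    then show ?thesis
      using mult_L2_cong[OF Linf_fun_mult[OF Linf_fun_id Linf_fun_cnj[OF Linf_fun_id]] Linf_fun_const, of 1 x]
      by (simp add: mult_L2_mult Linf_fun_id Linf_fun_cnj mult_L2_const)
  qed
  have A: "cinner_L2 (?Zb x) (zpow n) = cinner_L2 x (zpow (n + 1))" for x n
    using cinner_Zop_zpow[of "?Zb x" "n + 1"] by (simp add: ZZb)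
  have B: "cinner_L2 (?Zb x) (tpow n) = cinner_L2 x (tpow (n + 1))" for x n
    using cinner_Zop_tpow[of "?Zb x" "n + 1"] by (simp add: ZZb)
  have Tz: "cinner_L2 (tpow (-1)) (zpow n) = cinner_L2 (tpow 0) (zpow (n + 1))" for n
    using cinner_Zop_zpow[of "tpow (-1)" "n + 1"] by (simp add: Zop_tpow)
  have zT: "cinner_L2 (zpow (-1)) (tpow n) = 0" if "n \<ge> 0" for n
    using tpow_Hardy2[OF that] cinner_L2_commute[of "zpow (-1)" "tpow n"] by (simp add: Hardy2_iff)
  have VK: "V \<in> K"
    unfolding K_iff
  proof safe
    fix n :: int assume n: "n < 0"
    show "cinner_L2 V (zpow n) = 0"
    proof (cases "n = -1")
      case True
      then show ?thesis using u by (simp add: V_def cinner_simps A Tz cinner_zpow_zpow u0_def \<theta>0_eq K_iff)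
    next
      case False
      then show ?thesis using u n tpow_0_coeff by (simp add: V_def cinner_simps A Tz cinner_zpow_zpow K_iff)
    qed
  next
    fix n :: int assume "n \<ge> 0"
    then show "cinner_L2 V (tpow n) = 0"
      using u by (simp add: V_def cinner_simps B cinner_tpow_tpow zT K_iff)
  qed
  have "cinner_L2 f V = 0" if f: "f \<in> K" for f
  proof -
    have "cinner_L2 (Zop f) u = cinner_L2 f (?Zb u)" by (rule cinner_mult_left[OF Linf_fun_id])
    moreover have "cinner_L2 (tpow 0) u = 0" "cinner_L2 (tpow 0) v = 0" "cinner_L2 (zpow 0) v = cnj v0"
      using u v cinner_L2_commute[of "tpow 0" u] cinner_L2_commute[of "tpow 0" v] cinner_L2_commute[of "zpow 0" v]
      by (auto simp: K_iff v0_def)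
    moreover have "cinner_L2 f (zpow (-1)) = 0" using f by (simp add: K_iff)
    ultimately show ?thesis using orth[OF f] by (simp add: V_def cinner_simps k0_def algebra_simps)
  qed
  from this[OF VK] have "Zop V = 0" by simp
  then have "u - cnj l *\<^sub>C Zop u + (cnj b * v0) *\<^sub>C tpow 0 - (u0 + cnj b * v0 * \<theta>0) *\<^sub>C zpow 0 = 0"
    unfolding V_def by (simp add: mult_L2_simps ZZb Zop_tpow Zop_zpow)
  then have "l *\<^sub>C (u - cnj l *\<^sub>C Zop u + (cnj b * v0) *\<^sub>C tpow 0 - (u0 + cnj b * v0 * \<theta>0) *\<^sub>C zpow 0) = 0" by simp
  moreover have "l * cnj l = 1" using l complex_norm_square[of l] by simp
  ultimately show ?thesis
    by (simp add: scaleC_diff_right scaleC_add_right scaleC_scaleC mult.assoc algebra_simps)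
qed

text \<open>A non-zero pair orthogonal to the range solves a system whose determinant is the
  conjugate of \<open>DeltaM w / w^2\<close> with \<open>w = \<theta>(l)\<close> of modulus 1. It
  vanishes together with \<open>DeltaM w\<close>, so \<open>l\<close> would be an
  eigenvalue.\<close>

lemma circle_dense:
  assumes l: "cmod l = 1" and ne: "\<not> eigen l"
  shows "KK \<subseteq> closure (Lop l ` KK)"
proof (rule ccontr)
  interpret L: bounded_linear "Lop l" by (rule bounded_linear_Lop)
  let ?R = "closure (Lop l ` KK)"
  assume "\<not> KK \<subseteq> ?R"
  then obtain x where x: "x \<in> KK" "x \<notin> ?R" by blast
  have subR: "subspace ?R"
  proof (rule subspace_closure)
    show "subspace (Lop l ` KK)"
    proof (rule subspaceI)
      show "0 \<in> Lop l ` KK" using imageI[OF subspace_0[OF subspace_KK], of "Lop l"] by (simp add: L.zero)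
      show "x + y \<in> Lop l ` KK" if xy: "x \<in> Lop l ` KK" "y \<in> Lop l ` KK" for x y
      proof -
        obtain a b where "a \<in> KK" "b \<in> KK" "x = Lop l a" "y = Lop l b" using xy by blast
        then show ?thesis using imageI[OF subspace_add[OF subspace_KK], of a b "Lop l"] by (simp add: L.add)
      qed
      show "r *\<^sub>R x \<in> Lop l ` KK" if x: "x \<in> Lop l ` KK" for r x
      proof -
        obtain a where "a \<in> KK" "x = Lop l a" using x by blast
        then show ?thesis using imageI[OF subspace_scale[OF subspace_KK], of a "Lop l" r] by (simp add: L.scaleR)
      qed
    qed
  qed
  have RK: "?R \<subseteq> KK" by (rule closure_minimal[OF _ closed_KK]) (rule Lop_image_subset)
  obtain p where p: "p \<in> ?R" "\<And>y. y \<in> ?R \<Longrightarrow> inner (x - p) y = 0"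
    using orthogonal_projection_exists[OF closed_closure subR, of x] by blast
  have "x - p \<in> KK" using x p RK KK_diff by blast
  then obtain u v where uv: "x - p = (u, v)" "u \<in> K" "v \<in> K" by auto
  have uvnz: "(u, v) \<noteq> 0" using x p uv by auto
  have orth: "cinner_L2 (fst (Lop l (f, g))) u + cinner_L2 (snd (Lop l (f, g))) v = 0" if "f \<in> K" "g \<in> K" for f g
  proof -
    have re: "Re (cinner_L2 (fst (Lop l (f, g))) u + cinner_L2 (snd (Lop l (f, g))) v) = 0" if "f \<in> K" "g \<in> K" for f g
    proof -
      have "Lop l (f, g) \<in> ?R" by (rule subsetD[OF closure_subset imageI]) (use that in simp)
      from p(2)[OF this] show ?thesis
        unfolding uv by (cases "Lop l (f, g)") (simp add: Re_cinner inner_commute)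
    qed
    \<comment> \<open>The product space carries only a real inner product; testing with the pair
      multiplied by \<open>\<i>\<close> recovers the imaginary part.\<close>
    have "Re (\<i> * (cinner_L2 (fst (Lop l (f, g))) u + cinner_L2 (snd (Lop l (f, g))) v)) = 0"
      using re[OF K_intros(4)[OF that(1), of \<i>] K_intros(4)[OF that(2), of \<i>]]
      by (simp only: Lop_scale fst_conv snd_conv cinner_L2_scaleC_left distrib_left)
    then show ?thesis using re[OF that] by (simp add: complex_eq_iff)
  qed
  have o1: "cinner_L2 (Zop f - c f *\<^sub>C tpow 0 - l *\<^sub>C f) u + cinner_L2 ((\<beta> * c f) *\<^sub>C k0) v = 0" if "f \<in> K" for f
    using orth[OF that K_intros(1)] by (simp add: Lop_def Tc_def)
  have o2: "cinner_L2 (Zop g - c g *\<^sub>C tpow 0 - l *\<^sub>C g) v + cinner_L2 ((\<alpha> * c g) *\<^sub>C k0) u = 0" if "g \<in> K" for g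
    using orth[OF K_intros(1) that] by (simp add: Lop_def Tc_def add.commute)
  let ?u0 = "cinner_L2 u (zpow 0)" and ?v0 = "cinner_L2 v (zpow 0)" and ?w = "inner_value \<theta> l"
  note e1 = adjoint_equation[OF l uv(2,3) o1] and e2 = adjoint_equation[OF l uv(3,2) o2]
  have l0: "l \<noteq> 0" using l by auto
  have nz0: "?u0 \<noteq> 0 \<or> ?v0 \<noteq> 0"
  proof (rule ccontr)
    assume "\<not> ?thesis"
    then have "u = 0" "v = 0" using e1 e2 Zop_diff_inj by auto
    then show False using uvnz by (simp add: zero_prod_def)
  qed
  have nz: "l * cnj \<beta> * ?v0 \<noteq> 0 \<or> l * (?u0 + cnj \<beta> * ?v0 * \<theta>0) \<noteq> 0 \<or> l * cnj \<alpha> * ?u0 \<noteq> 0 \<or> l * (?v0 + cnj \<alpha> * ?u0 * \<theta>0) \<noteq> 0"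
    using nz0 l0 by auto
  note b = boundary_symbols[OF l e1 e2 nz]
  have "?u0 * 1 - cnj \<beta> * ?v0 * (?w - \<theta>0) = 0" "?v0 * 1 - cnj \<alpha> * ?u0 * (?w - \<theta>0) = 0"
  proof -
    have alg: "x * 1 - a * y * (?w - \<theta>0) = (l * (x + a * y * \<theta>0) - l * a * y * ?w) / l" for x a y
      using l0 by (simp add: field_simps)
    show "?u0 * 1 - cnj \<beta> * ?v0 * (?w - \<theta>0) = 0" "?v0 * 1 - cnj \<alpha> * ?u0 * (?w - \<theta>0) = 0"
      unfolding alg using b(2,3) by simp_all
  qed
  from kernel_determinant[OF nz0 this] have D: "1 - cnj \<beta> * cnj \<alpha> * (?w - \<theta>0)\<^sup>2 = 0" by simp
  have w: "?w * cnj ?w = 1"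
  proof -
    obtain u where u: "Zop u - l *\<^sub>C u = tpow 0 - ?w *\<^sub>C zpow 0" using ADC_imp_boundary_quotient[OF b(1)] by blast
    have "cmod ?w = 1" using circle_resolvent_dichotomy[OF l, of u 1 ?w] u by simp
    then show ?thesis using complex_norm_square[of ?w] by simp
  qed
  have "cnj (1 - cnj \<beta> * cnj \<alpha> * (?w - \<theta>0)\<^sup>2) = 0" unfolding D by simp
  then have "?w\<^sup>2 * (1 - \<beta> * \<alpha> * (cnj ?w - cnj \<theta>0)\<^sup>2) = 0" by simp
  moreover have "?w\<^sup>2 * (1 - \<beta> * \<alpha> * (cnj ?w - cnj \<theta>0)\<^sup>2) = ?w\<^sup>2 - \<alpha> * \<beta> * (?w * cnj ?w - cnj \<theta>0 * ?w)\<^sup>2"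
    by (simp add: power2_eq_square algebra_simps)
  ultimately have "DeltaM ?w = 0" unfolding w DeltaM_def by simp
  then show False using ne b(1) circle_eigen_iff[OF l] by blast
qed

end

section \<open>Integration over arcs\<close>

lemma nn_integral_periodic:
  fixes H :: "real \<Rightarrow> ennreal"
  assumes [measurable]: "H \<in> borel_measurable borel" and per: "\<And>t. H (t + p) = H t"
    and a: "- p \<le> a" "a \<le> 0"
  shows "(\<integral>\<^sup>+t. H t * indicator {a..a + p} t \<partial>lborel) = (\<integral>\<^sup>+t. H t * indicator {0..p} t \<partial>lborel)"
proof -
  have "(\<integral>\<^sup>+t. H t * indicator {a..a + p} t \<partial>lborel) = (\<integral>\<^sup>+t. H t * indicator {a<..0} t + H t * indicator {0..a + p} t \<partial>lborel)"
  proof (rule nn_integral_cong_AE)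
    show "AE t in lborel. H t * indicator {a..a + p} t = H t * indicator {a<..0} t + H t * indicator {0..a + p} t"
      using AE_lborel_singleton[of a] AE_lborel_singleton[of 0]
      by eventually_elim (use a in \<open>auto simp: indicator_def\<close>)
  qed
  also have "\<dots> = (\<integral>\<^sup>+t. H t * indicator {a<..0} t \<partial>lborel) + (\<integral>\<^sup>+t. H t * indicator {0..a + p} t \<partial>lborel)"
    by (rule nn_integral_add) auto
  also have "(\<integral>\<^sup>+t. H t * indicator {a<..0} t \<partial>lborel) = (\<integral>\<^sup>+t. H t * indicator {a + p<..p} t \<partial>lborel)"
  proof -
    have "(\<integral>\<^sup>+t. H t * indicator {a + p<..p} t \<partial>lborel) = (\<integral>\<^sup>+t. H (p + 1 * t) * indicator {a + p<..p} (p + 1 * t) \<partial>lborel)"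
      by (subst nn_integral_real_affine[where c = 1 and t = p]) auto
    also have "\<dots> = (\<integral>\<^sup>+t. H t * indicator {a<..0} t \<partial>lborel)"
      using per by (intro nn_integral_cong) (auto simp: indicator_def add.commute)
    finally show ?thesis ..
  qed
  also have "(\<integral>\<^sup>+t. H t * indicator {a + p<..p} t \<partial>lborel) + (\<integral>\<^sup>+t. H t * indicator {0..a + p} t \<partial>lborel)
     = (\<integral>\<^sup>+t. H t * indicator {a + p<..p} t + H t * indicator {0..a + p} t \<partial>lborel)"
    by (rule nn_integral_add[symmetric]) auto
  also have "\<dots> = (\<integral>\<^sup>+t. H t * indicator {0..p} t \<partial>lborel)"
    using a by (intro nn_integral_cong) (auto simp: indicator_def)
  finally show ?thesis .
qed

text \<open>Recentres the parameter at \<open>l\<close>, so that arcs around \<open>l\<close> are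
  symmetric intervals. Periodicity moves the interval first to \<open>{0..2*pi}\<close> and then to
  \<open>{-pi..pi}\<close>.\<close>

lemma nn_integral_circle_rotated:
  fixes G :: "complex \<Rightarrow> ennreal"
  assumes [measurable]: "G \<in> borel_measurable borel" and l: "cmod l = 1"
  shows "(\<integral>\<^sup>+\<zeta>. G \<zeta> \<partial>circle_measure) = (\<integral>\<^sup>+s. G (l * cis s) * indicator {-pi..pi} s \<partial>lborel) / ennreal (2 * pi)"
proof -
  obtain t0 where t0: "0 \<le> t0" "t0 < 2 * pi" "l = cis t0"
  proof -
    have "is_Arg l (Arg2pi l)" using Arg2pi[of l] by blast
    then have "l = cis (Arg2pi l)" using l unfolding is_Arg_def cis_conv_exp by simp
    then show ?thesis using that[of "Arg2pi l"] Arg2pi[of l] by auto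
  qed
  have "emeasure lborel {0..2*pi} \<noteq> 0" "emeasure lborel {0..2*pi} \<noteq> \<infinity>"
    using pi_gt_zero by (auto simp: ennreal_eq_0_iff not_le)
  have "(\<integral>\<^sup>+\<zeta>. G \<zeta> \<partial>circle_measure) = (\<integral>\<^sup>+t. G (cis t) \<partial>uniform_measure lborel {0..2*pi})"
    unfolding circle_measure_def by (subst nn_integral_distr) auto
  also have "\<dots> = (\<integral>\<^sup>+t. G (cis t) * indicator {0..2*pi} t \<partial>lborel) / ennreal (2 * pi)"
    by (subst nn_integral_uniform_measure) auto
  also have "(\<integral>\<^sup>+t. G (cis t) * indicator {0..2*pi} t \<partial>lborel) = (\<integral>\<^sup>+s. G (cis (t0 + 1 * s)) * indicator {0..2*pi} (t0 + 1 * s) \<partial>lborel)"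
    by (subst nn_integral_real_affine[where c = 1 and t = t0]) auto
  also have "\<dots> = (\<integral>\<^sup>+s. G (l * cis s) * indicator {-t0..-t0 + 2*pi} s \<partial>lborel)"
    by (intro nn_integral_cong) (auto simp: indicator_def t0 cis_mult)
  also have "\<dots> = (\<integral>\<^sup>+s. G (l * cis s) * indicator {0..2*pi} s \<partial>lborel)"
    by (rule nn_integral_periodic) (use t0 in \<open>auto simp: cis_mult[symmetric]\<close>)
  also have "\<dots> = (\<integral>\<^sup>+s. G (l * cis s) * indicator {-pi..-pi + 2*pi} s \<partial>lborel)"
    by (rule nn_integral_periodic[symmetric]) (auto simp: cis_mult[symmetric])
  finally show ?thesis by simp
qed

lemma arc_nn_integral_le:
  fixes G :: "complex \<Rightarrow> real"
  assumes [measurable]: "G \<in> borel_measurable borel" and G: "integrable circle_measure G" "\<And>\<zeta>. G \<zeta> \<ge> 0"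
    and l: "cmod l = 1"
  shows "(\<integral>\<^sup>+s. ennreal (G (l * cis s)) * indicator {-pi..pi} s \<partial>lborel) = ennreal (2 * pi * (LINT \<zeta>|circle_measure. G \<zeta>))"
proof -
  let ?I = "\<integral>\<^sup>+s. ennreal (G (l * cis s)) * indicator {-pi..pi} s \<partial>lborel"
  have "ennreal (LINT \<zeta>|circle_measure. G \<zeta>) = ?I / ennreal (2 * pi)"
    using nn_integral_circle_rotated[of "\<lambda>\<zeta>. ennreal (G \<zeta>)", OF _ l] nn_integral_eq_integral[OF G(1)] G(2) by simp
  then have "ennreal (2 * pi) * ennreal (LINT \<zeta>|circle_measure. G \<zeta>) = ?I"
    by (simp add: ennreal_times_divide mult_divide_eq_ennreal mult.commute[of "ennreal (2 * pi)"] mult.commute[of pi])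
  then show ?thesis by (simp add: ennreal_mult' G(2))
qed

text \<open>Carries an integrable majorant from the circle to a short arc; the factor
  \<open>2 * pi\<close> undoes the normalisation of the measure.\<close>

lemma arc_integrable:
  fixes g :: "real \<Rightarrow> complex" and G :: "complex \<Rightarrow> real"
  assumes [measurable]: "G \<in> borel_measurable borel" "g \<in> borel_measurable borel"
    and G: "integrable circle_measure G" "\<And>\<zeta>. G \<zeta> \<ge> 0"
    and l: "cmod l = 1" and e: "e \<le> pi" and le: "\<And>s. s \<in> {-e..e} \<Longrightarrow> cmod (g s) \<le> G (l * cis s)"
  shows "set_integrable lborel {-e..e} g"
    and "norm (LINT s:{-e..e}|lborel. g s) \<le> 2 * pi * (LINT \<zeta>|circle_measure. G \<zeta>)"
proof -
  have "(\<integral>\<^sup>+s. norm (indicator {-e..e} s *\<^sub>R g s) \<partial>lborel) \<le> (\<integral>\<^sup>+s. ennreal (G (l * cis s)) * indicator {-pi..pi} s \<partial>lborel)"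
    using le e by (intro nn_integral_mono) (auto simp: indicator_def ennreal_leI G(2))
  also have "\<dots> = ennreal (2 * pi * (LINT \<zeta>|circle_measure. G \<zeta>))"
    by (rule arc_nn_integral_le[OF _ G l]) measurable
  finally have *: "(\<integral>\<^sup>+s. norm (indicator {-e..e} s *\<^sub>R g s) \<partial>lborel) \<le> ennreal (2 * pi * (LINT \<zeta>|circle_measure. G \<zeta>))" .
  show int: "set_integrable lborel {-e..e} g"
    unfolding set_integrable_def by (rule integrableI_bounded) (use * in \<open>auto intro: le_less_trans\<close>)
  have "ennreal (norm (LINT s:{-e..e}|lborel. g s)) \<le> ennreal (2 * pi * (LINT \<zeta>|circle_measure. G \<zeta>))"
    unfolding set_lebesgue_integral_def
    by (rule order_trans[OF integral_norm_bound_ennreal *]) (use int in \<open>simp add: set_integrable_def\<close>)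
  then show "norm (LINT s:{-e..e}|lborel. g s) \<le> 2 * pi * (LINT \<zeta>|circle_measure. G \<zeta>)"
    using G(2) by (subst (asm) ennreal_le_iff) (auto intro!: mult_nonneg_nonneg)
qed

text \<open>Differentiating in \<open>r\<close> and integrating by parts in \<open>s\<close>: the Cauchy-Riemann equation trades
  the radial derivative for a derivative of the weight \<open>e\<^sup>2 - s\<^sup>2\<close>, which vanishes at the ends.\<close>

lemma arc_integral_variation:
  fixes F :: "complex \<Rightarrow> complex"
  assumes U: "open U" "F holomorphic_on U" and r: "0 < r0" "r0 \<le> r1" and e: "0 < e"
    and inU: "\<And>r s. r \<in> {r0..r1} \<Longrightarrow> s \<in> {-e..e} \<Longrightarrow> of_real r * (l * cis s) \<in> U"
    and B: "\<And>r. r \<in> {r0..r1} \<Longrightarrow> norm (integral {-e..e} (\<lambda>s. (2 * s) *\<^sub>R F (of_real r * (l * cis s)))) \<le> B"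
  shows "norm (integral {-e..e} (\<lambda>s. (e\<^sup>2 - s\<^sup>2) *\<^sub>R F (of_real r1 * (l * cis s)))
     - integral {-e..e} (\<lambda>s. (e\<^sup>2 - s\<^sup>2) *\<^sub>R F (of_real r0 * (l * cis s)))) \<le> B / r0 * (r1 - r0)"
proof -
  define z where "z r s = of_real r * (l * cis s)" for r s
  define I where "I r = integral {-e..e} (\<lambda>s. (e\<^sup>2 - s\<^sup>2) *\<^sub>R F (z r s))" for r
  define D where "D r s = (e\<^sup>2 - s\<^sup>2) *\<^sub>R (l * cis s * deriv F (z r s))" for r s
  have zU: "z r s \<in> U" if "r \<in> {r0..r1}" "s \<in> {-e..e}" for r s using inU that by (simp add: z_def)
  have contF: "continuous_on U F" and contD: "continuous_on U (deriv F)"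
    using U by (auto intro!: holomorphic_on_imp_continuous_on holomorphic_deriv)
  have dF: "(F has_field_derivative deriv F w) (at w within S)" if "w \<in> U" for w S
    using holomorphic_derivI[OF U(2,1) that] .
  have cz: "continuous_on S (\<lambda>x. z (f x) (g x))" if "continuous_on S f" "continuous_on S g" for S and f g :: "'a::topological_space \<Rightarrow> real"
    unfolding z_def using that by (intro continuous_intros)
  have cFs: "continuous_on {-e..e} (\<lambda>s. F (z r s))" if "r \<in> {r0..r1}" for r
    by (rule continuous_on_compose2[OF contF cz]) (use zU that in \<open>auto intro!: continuous_intros\<close>)
  have vd: "(I has_vector_derivative integral {-e..e} (D r)) (at r within {r0..r1})" if "r \<in> {r0..r1}" for r
  proof -
    have "((\<lambda>r. integral (cbox (-e) e) (\<lambda>s. (e\<^sup>2 - s\<^sup>2) *\<^sub>R F (z r s))) has_vector_derivative integral (cbox (-e) e) (D r)) (at r within {r0..r1})"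
    proof (rule leibniz_rule_vector_derivative)
      fix r s assume rs: "r \<in> {r0..r1}" "s \<in> cbox (-e) e"
      have "((\<lambda>r. z r s) has_vector_derivative l * cis s) (at r within {r0..r1})"
        unfolding z_def by (auto intro!: derivative_eq_intros)
      from field_vector_diff_chain_within[OF this dF[of "z r s"]] zU rs
      have "((\<lambda>r. F (z r s)) has_vector_derivative l * cis s * deriv F (z r s)) (at r within {r0..r1})"
        by (auto simp: o_def)
      then show "((\<lambda>r. (e\<^sup>2 - s\<^sup>2) *\<^sub>R F (z r s)) has_vector_derivative D r s) (at r within {r0..r1})"
        unfolding D_def by (rule bounded_linear.has_vector_derivative[OF bounded_linear_scaleR_right])
    next
      fix r assume "r \<in> {r0..r1}"
      then show "(\<lambda>s. (e\<^sup>2 - s\<^sup>2) *\<^sub>R F (z r s)) integrable_on cbox (-e) e"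
        by (intro integrable_continuous continuous_intros) (use cFs in auto)
    next
      have "continuous_on ({r0..r1} \<times> {-e..e}) (\<lambda>x. deriv F (z (fst x) (snd x)))"
        by (rule continuous_on_compose2[OF contD cz]) (use zU in \<open>auto intro!: continuous_intros\<close>)
      then show "continuous_on ({r0..r1} \<times> cbox (-e) e) (\<lambda>(r, s). D r s)"
        unfolding D_def split_beta by (intro continuous_intros) (auto simp: cbox_interval)
    qed (use that in auto)
    then show ?thesis by (simp add: I_def[abs_def])
  qed
  have bound: "norm (integral {-e..e} (D r)) \<le> B / r0" if rr: "r \<in> {r0..r1}" for r
  proof -
    have "((\<lambda>s. (- (2 * s)) *\<^sub>R F (z r s) + (of_real r * \<i>) * D r s) has_integral
        (e\<^sup>2 - e\<^sup>2) *\<^sub>R F (z r e) - (e\<^sup>2 - (-e)\<^sup>2) *\<^sub>R F (z r (-e))) {-e..e}"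
    proof (rule fundamental_theorem_of_calculus)
      fix s assume s: "s \<in> {-e..e}"
      have "(cis has_vector_derivative \<i> * cis s) (at s within {-e..e})"
        unfolding has_vector_derivative_complex_iff by (auto intro!: derivative_eq_intros)
      then have "((\<lambda>s. z r s) has_vector_derivative of_real r * (l * (\<i> * cis s))) (at s within {-e..e})"
        unfolding z_def by (intro has_vector_derivative_mult_right)
      from field_vector_diff_chain_within[OF this dF[of "z r s"]] zU[OF rr s]
      have "((\<lambda>s. F (z r s)) has_vector_derivative of_real r * (l * (\<i> * cis s)) * deriv F (z r s)) (at s within {-e..e})"
        by (auto simp: o_def)
      moreover have "((\<lambda>s. e\<^sup>2 - s\<^sup>2) has_real_derivative - (2 * s)) (at s within {-e..e})"
        by (auto intro!: derivative_eq_intros)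
      ultimately have "((\<lambda>s. (e\<^sup>2 - s\<^sup>2) *\<^sub>R F (z r s)) has_vector_derivative
          (e\<^sup>2 - s\<^sup>2) *\<^sub>R (of_real r * (l * (\<i> * cis s)) * deriv F (z r s)) + (- (2 * s)) *\<^sub>R F (z r s)) (at s within {-e..e})"
        by (intro has_vector_derivative_scaleR)
      then show "((\<lambda>s. (e\<^sup>2 - s\<^sup>2) *\<^sub>R F (z r s)) has_vector_derivative (- (2 * s)) *\<^sub>R F (z r s) + (of_real r * \<i>) * D r s) (at s within {-e..e})"
        by (rule has_vector_derivative_eq_rhs) (simp add: D_def algebra_simps)
    qed (use e in simp)
    then have 0: "((\<lambda>s. (- (2 * s)) *\<^sub>R F (z r s) + (of_real r * \<i>) * D r s) has_integral 0) {-e..e}" by simp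
    have 1: "((\<lambda>s. (2 * s) *\<^sub>R F (z r s)) has_integral integral {-e..e} (\<lambda>s. (2 * s) *\<^sub>R F (z r s))) {-e..e}"
      by (intro integrable_integral integrable_continuous_interval continuous_intros cFs rr)
    have "((\<lambda>s. (of_real r * \<i>) * D r s) has_integral integral {-e..e} (\<lambda>s. (2 * s) *\<^sub>R F (z r s))) {-e..e}"
      using has_integral_add[OF 0 1] by simp
    moreover have "(D r) integrable_on {-e..e}"
    proof -
      have "continuous_on {-e..e} (\<lambda>s. deriv F (z r s))"
        by (rule continuous_on_compose2[OF contD cz]) (use zU rr in \<open>auto intro!: continuous_intros\<close>)
      then show ?thesis unfolding D_def by (intro integrable_continuous_interval continuous_intros)
    qed
    ultimately have "(of_real r * \<i>) * integral {-e..e} (D r) = integral {-e..e} (\<lambda>s. (2 * s) *\<^sub>R F (z r s))"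
      using has_integral_mult_right[OF integrable_integral, of "D r" "{-e..e}" "of_real r * \<i>"] has_integral_unique by blast
    then have "norm ((of_real r * \<i>) * integral {-e..e} (D r)) \<le> B" using B[OF rr] by (simp add: z_def)
    then have le: "r * norm (integral {-e..e} (D r)) \<le> B" using rr r by (simp add: norm_mult)
    have "r0 * norm (integral {-e..e} (D r)) \<le> r * norm (integral {-e..e} (D r))" using rr by (intro mult_right_mono) auto
    then show ?thesis using le r(1) by (simp add: field_simps)
  qed
  have "norm (I r1 - I r0) \<le> B / r0 * norm (r1 - r0)"
  proof (rule differentiable_bound[where S = "{r0..r1}" and f' = "\<lambda>r h. h *\<^sub>R integral {-e..e} (D r)"])
    show "(I has_derivative (\<lambda>h. h *\<^sub>R integral {-e..e} (D r))) (at r within {r0..r1})" if "r \<in> {r0..r1}" for r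
      using vd[OF that] by (simp add: has_vector_derivative_def)
    show "onorm (\<lambda>h. h *\<^sub>R integral {-e..e} (D r)) \<le> B / r0" if "r \<in> {r0..r1}" for r
    proof (rule onorm_le)
      fix h :: real
      show "norm (h *\<^sub>R integral {-e..e} (D r)) \<le> B / r0 * norm h"
        using mult_right_mono[OF bound[OF that], of "\<bar>h\<bar>"] by (simp add: mult.commute)
    qed
  qed (use r in auto)
  then show ?thesis using r by (simp add: I_def z_def)
qed

section \<open>Radial limits\<close>

text \<open>The dilate of \<open>x\<close>. It is written with \<open>disc_ext\<close>, which is
  Borel on the whole plane; inside the disc it agrees with \<open>ev\<close>.\<close>

definition rad :: "real \<Rightarrow> L2_circle \<Rightarrow> complex \<Rightarrow> complex" where
  "rad r x \<zeta> = disc_ext (fn x) (of_real r * \<zeta>)"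

lemma disc_ext_measurable [measurable]: "disc_ext f \<in> borel_measurable borel"
  unfolding disc_ext_def[abs_def] by measurable

lemma rad_measurable [measurable]: "rad r x \<in> borel_measurable borel"
  unfolding rad_def[abs_def] by measurable

lemma disc_ext_fn: "cmod z < 1 \<Longrightarrow> disc_ext (fn x) z = ev z x"
  using disc_ext_eq_ev[of "fn x" z] by simp

text \<open>The factors \<open>r ^ n\<close> only shrink coefficients, so Bessel bounds the partial
  sums of the power series, and Fatou passes to their limit.\<close>

lemma rad_L2:
  assumes r: "0 \<le> r" "r < 1"
  shows "rad r x \<in> L2_fun" "norm (L2_of (rad r x)) \<le> norm x"
proof -
  define a where "a n = cinner_L2 x (zpow (int n)) * of_real r ^ n" for n
  define g where "g N \<zeta> = (\<Sum>n<N. a n * \<zeta> powi int n)" for N \<zeta>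
  have pL: "(\<lambda>\<zeta>. a n * \<zeta> powi int n) \<in> L2_fun" for n by (intro Linf_fun_L2 Linf_fun_intros)
  \<comment> \<open>Orthogonality to the later monomials is carried along so that Pythagoras applies
    to each new term.\<close>
  have g: "g N \<in> L2_fun \<and> (norm (L2_of (g N)))\<^sup>2 \<le> (\<Sum>n<N. (cmod (cinner_L2 x (zpow (int n))))\<^sup>2)
     \<and> (\<forall>m\<ge>N. cinner_L2 (L2_of (g N)) (zpow (int m)) = 0)" for N
  proof (induction N)
    case 0
    have g0: "g 0 = (\<lambda>_. 0)" by (simp add: g_def fun_eq_iff)
    have "L2_of (g 0) = 0" unfolding g0 zero_L2_circle_def ..
    then show ?case by (simp add: g0 L2_fun_zero)
  next
    case (Suc N)
    have eq: "g (Suc N) = (\<lambda>\<zeta>. g N \<zeta> + a N * \<zeta> powi int N)" by (simp add: g_def fun_eq_iff)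
    have z: "L2_of (\<lambda>\<zeta>. a N * \<zeta> powi int N) = a N *\<^sub>C zpow (int N)"
      unfolding zpow_def by (intro L2_of_scale Linf_fun_L2 Linf_fun_powi)
    have L: "L2_of (g (Suc N)) = L2_of (g N) + a N *\<^sub>C zpow (int N)"
      unfolding eq L2_of_add[OF conjunct1[OF Suc] pL] z ..
    have o: "cinner_L2 (L2_of (g N)) (zpow (int N)) = 0" "cinner_L2 (zpow (int N)) (L2_of (g N)) = 0"
      using Suc cinner_L2_commute[of "zpow (int N)" "L2_of (g N)"] by auto
    have "(norm (L2_of (g (Suc N))))\<^sup>2 = (norm (L2_of (g N)))\<^sup>2 + Re (a N * cnj (a N))"
      unfolding norm_L2_sq L by (simp add: cinner_simps o cinner_zpow_zpow)
    also have "Re (a N * cnj (a N)) = (cmod (a N))\<^sup>2" by (metis Re_complex_of_real complex_norm_square)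
    finally have "(norm (L2_of (g (Suc N))))\<^sup>2 = (norm (L2_of (g N)))\<^sup>2 + (cmod (a N))\<^sup>2" .
    moreover have "cmod (a N) \<le> cmod (cinner_L2 x (zpow (int N)))"
      using r by (auto simp: a_def norm_mult norm_power intro!: mult_right_le_one_le power_le_one)
    then have "(cmod (a N))\<^sup>2 \<le> (cmod (cinner_L2 x (zpow (int N))))\<^sup>2" by (intro power_mono) auto
    ultimately have "(norm (L2_of (g (Suc N))))\<^sup>2 \<le> (norm (L2_of (g N)))\<^sup>2 + (cmod (cinner_L2 x (zpow (int N))))\<^sup>2"
      by linarith
    moreover have "g (Suc N) \<in> L2_fun" unfolding eq using Suc pL by (intro L2_fun_add) auto
    moreover have "cinner_L2 (L2_of (g (Suc N))) (zpow (int m)) = 0" if "m \<ge> Suc N" for m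
      using Suc that by (simp add: L cinner_simps cinner_zpow_zpow)
    ultimately show ?case using Suc by auto
  qed
  have le: "norm (L2_of (g N)) \<le> norm x" for N
  proof -
    have "(\<Sum>n<N. (cmod (cinner_L2 x (zpow (int n))))\<^sup>2) \<le> (norm x)\<^sup>2"
      by (rule Bessel_inequality) (auto simp: cinner_zpow_zpow)
    then have "(norm (L2_of (g N)))\<^sup>2 \<le> (norm x)\<^sup>2" using g[of N] by linarith
    then show ?thesis by (rule power2_le_imp_le) simp
  qed
  have lim: "AE \<zeta> in circle_measure. (\<lambda>N. g N \<zeta>) \<longlonglongrightarrow> rad r x \<zeta>"
    using AE_circle_norm
  proof eventually_elim
    case (elim \<zeta>)
    have z: "cmod (of_real r * \<zeta>) < 1" using elim r by (simp add: norm_mult)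
    have "(\<lambda>n. a n * \<zeta> powi int n) = (\<lambda>n. cinner_L2 x (zpow (int n)) * (of_real r * \<zeta>) ^ n)"
      by (simp add: a_def power_mult_distrib mult.assoc)
    then have "(\<lambda>n. a n * \<zeta> powi int n) sums rad r x \<zeta>"
      using ev_sums[OF z, of x] by (simp add: rad_def disc_ext_fn[OF z])
    then show ?case by (simp add: sums_def g_def)
  qed
  show "rad r x \<in> L2_fun" "norm (L2_of (rad r x)) \<le> norm x"
    using L2_Fatou[of g "norm x", OF _ le _ lim] g by auto
qed

lemma L2_of_rad_simps:
  assumes r: "0 \<le> r" "r < 1"
  shows "L2_of (rad r (x + y)) = L2_of (rad r x) + L2_of (rad r y)"
    and "L2_of (rad r (d *\<^sub>C x)) = d *\<^sub>C L2_of (rad r x)"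
proof -
  note L = rad_L2(1)[OF r]
  have eq: "rad r x \<zeta> = ev (of_real r * \<zeta>) x" if "cmod \<zeta> = 1" for x \<zeta>
    unfolding rad_def using that r by (intro disc_ext_fn) (simp add: norm_mult)
  show "L2_of (rad r (x + y)) = L2_of (rad r x) + L2_of (rad r y)"
    unfolding L2_of_add[OF L L, symmetric] using AE_circle_norm
    by (subst L2_of_eq_iff) (auto simp: L L2_fun_add eq ev_simps elim!: eventually_mono)
  show "L2_of (rad r (d *\<^sub>C x)) = d *\<^sub>C L2_of (rad r x)"
    unfolding L2_of_scale[OF L, symmetric] using AE_circle_norm
    by (subst L2_of_eq_iff) (auto simp: L L2_fun_scale eq ev_simps elim!: eventually_mono)
qed

text \<open>Dilations are contractions, so it is enough to see convergence on monomials, which they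
  multiply by a power of \<open>r\<close>.\<close>

lemma rad_tendsto:
  assumes r: "\<And>n. 0 \<le> r n" "\<And>n. r n < 1" "r \<longlonglongrightarrow> 1" and x: "x \<in> Hardy2"
  shows "(\<lambda>n. L2_of (rad (r n) x)) \<longlonglongrightarrow> x"
proof -
  have "x \<in> {x. (\<lambda>n. L2_of (rad (r n) x)) \<longlonglongrightarrow> x}"
    using x
  proof (induction rule: Hardy2_induct)
    case closed
    show ?case
      unfolding closed_sequential_limits
    proof safe
      fix X x assume X: "\<forall>k. X k \<in> {x. (\<lambda>n. L2_of (rad (r n) x)) \<longlonglongrightarrow> x}" "X \<longlonglongrightarrow> x"
      show "(\<lambda>n. L2_of (rad (r n) x)) \<longlonglongrightarrow> x"
      proof (rule LIMSEQ_I)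
        fix e :: real assume e: "e > 0"
        then obtain k where k: "norm (X k - x) < e / 3" using LIMSEQ_D[OF X(2), of "e/3"] by auto
        obtain N where N: "\<And>n. n \<ge> N \<Longrightarrow> norm (L2_of (rad (r n) (X k)) - X k) < e / 3"
          using LIMSEQ_D[of "\<lambda>n. L2_of (rad (r n) (X k))" "X k" "e/3"] X(1) e by auto
        have "norm (L2_of (rad (r n) x) - x) < e" if "n \<ge> N" for n
        proof -
          have "L2_of (rad (r n) x) = L2_of (rad (r n) (X k)) + L2_of (rad (r n) (x - X k))"
            using L2_of_rad_simps(1)[OF r(1,2), of n "X k" "x - X k"] by simp
          then have "L2_of (rad (r n) x) - x = L2_of (rad (r n) (x - X k)) + (L2_of (rad (r n) (X k)) - X k) + (X k - x)"
            by simp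
          then have "norm (L2_of (rad (r n) x) - x) \<le> norm (L2_of (rad (r n) (x - X k))) + norm (L2_of (rad (r n) (X k)) - X k) + norm (X k - x)"
            by (metis norm_triangle_ineq norm_triangle_le add_mono order_refl)
          also have "\<dots> < e"
            using rad_L2(2)[OF r(1,2), of n "x - X k"] k N[OF that] by (simp add: norm_minus_commute)
          finally show ?thesis .
        qed
        then show "\<exists>no. \<forall>n\<ge>no. norm (L2_of (rad (r n) x) - x) < e" by blast
      qed
    qed
  next
    case zero
    have "L2_of (rad (r n) 0) = 0" for n using L2_of_rad_simps(2)[OF r(1,2), of n 0 0] by simp
    then show ?case by simp
  next
    case (add x y)
    then show ?case by (auto simp: L2_of_rad_simps(1)[OF r(1,2)] intro: tendsto_add)
  next
    case (scale c x)
    then show ?case using bounded_linear.tendsto[OF bounded_linear_scaleC] by (auto simp: L2_of_rad_simps(2)[OF r(1,2)])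
  next
    case (monomial k)
    have "L2_of (rad (r n) (zpow k)) = of_real (r n ^ nat k) *\<^sub>C zpow k" for n
    proof -
      have z: "(\<lambda>\<zeta>. of_real (r n ^ nat k) * \<zeta> powi k) \<in> L2_fun" by (intro Linf_fun_L2 Linf_fun_intros)
      have "L2_of (rad (r n) (zpow k)) = L2_of (\<lambda>\<zeta>. of_real (r n ^ nat k) * \<zeta> powi k)"
      proof (subst L2_of_eq_iff[OF rad_L2(1)[OF r(1,2)] z])
        show "AE \<zeta> in circle_measure. rad (r n) (zpow k) \<zeta> = of_real (r n ^ nat k) * \<zeta> powi k"
          using AE_circle_norm
        proof eventually_elim
          case (elim \<zeta>)
          then have "cmod (of_real (r n) * \<zeta>) < 1" using r(1)[of n] r(2)[of n] by (simp add: norm_mult)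
          then show ?case using monomial by (simp add: rad_def disc_ext_fn ev_zpow power_mult_distrib power_int_def)
        qed
      qed
      also have "\<dots> = of_real (r n ^ nat k) *\<^sub>C zpow k"
        unfolding zpow_def by (intro L2_of_scale Linf_fun_L2 Linf_fun_powi)
      finally show ?thesis .
    qed
    moreover have "(\<lambda>n. of_real (r n ^ nat k) *\<^sub>C zpow k) \<longlonglongrightarrow> of_real (1 ^ nat k) *\<^sub>C zpow k"
      unfolding scaleR_L2_circle_def[symmetric] by (intro tendsto_intros r)
    ultimately show ?case by simp
  qed
  then show ?thesis by simp
qed

lemma ev_holomorphic: "(\<lambda>z. ev z x) holomorphic_on ball 0 1"
  by (rule power_series_holomorphic[where a = "\<lambda>n. cinner_L2 x (zpow (int n))"]) (use ev_sums in auto)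

section \<open>Distances from a boundary point in polar coordinates\<close>

lemma half_le_sin: assumes "0 \<le> (s::real)" "s \<le> 1" shows "s / 2 \<le> sin s"
proof -
  have "sin 0 - 0 / 2 \<le> sin s - s / 2"
  proof (rule DERIV_nonneg_imp_nondecreasing[OF assms(1)])
    fix x assume x: "0 \<le> x" "x \<le> s"
    have "cos (pi / 3) \<le> cos x" using x assms pi_gt3 by (intro cos_monotone_0_pi_le) auto
    then have "0 \<le> cos x - 1 / 2" by (simp add: cos_60)
    moreover have "((\<lambda>x. sin x - x / 2) has_real_derivative cos x - 1 / 2) (at x)" by (auto intro!: derivative_eq_intros)
    ultimately show "\<exists>y. ((\<lambda>x. sin x - x / 2) has_real_derivative y) (at x) \<and> 0 \<le> y" by blast
  qed
  then show ?thesis by simp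
qed

lemma abs_le_2_abs_sin: "\<bar>s\<bar> \<le> 1 \<Longrightarrow> \<bar>s\<bar> \<le> 2 * \<bar>sin (s::real)\<bar>"
  using half_le_sin[of s] half_le_sin[of "- s"] by (cases "s \<ge> 0") auto

lemma norm_cis_minus_one: "cmod (cis s - 1) = 2 * \<bar>sin (s / 2)\<bar>"
  using dist_exp_i_1[of s] by (simp add: cis_conv_exp dist_norm)

text \<open>The first bound keeps arcs inside the region where \<theta> is bounded below, the second
  absorbs the derivative of the weight, and the third makes the distance to \<open>l\<close> at
  least \<open>e\<close> on the arc of radius \<open>1 - e\<close>.\<close>

lemma arc_distance:
  assumes l: "cmod l = 1" and r: "0 \<le> r" "r \<le> 1"
  shows "cmod (of_real r * (l * cis s) - l) \<le> (1 - r) + \<bar>s\<bar>"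
    and "r * \<bar>sin s\<bar> \<le> cmod (of_real r * (l * cis s) - l)"
    and "1 - r \<le> cmod (of_real r * (l * cis s) - l)"
proof -
  have "of_real r * (l * cis s) - l = l * (of_real r * cis s - 1)" by (simp add: algebra_simps)
  then have eq: "cmod (of_real r * (l * cis s) - l) = cmod (of_real r * cis s - 1)" using l by (simp add: norm_mult)
  have "of_real r * cis s - 1 = of_real (r - 1) * cis s + (cis s - 1)" by (simp add: algebra_simps)
  then have "cmod (of_real r * cis s - 1) \<le> cmod (of_real (r - 1) * cis s) + cmod (cis s - 1)"
    by (metis norm_triangle_ineq)
  also have "cmod (of_real (r - 1) * cis s) = 1 - r" using r by (simp add: norm_mult del: of_real_diff)
  also have "cmod (cis s - 1) \<le> \<bar>s\<bar>" using abs_sin_x_le_abs_x[of "s / 2"] by (simp add: norm_cis_minus_one)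
  finally show "cmod (of_real r * (l * cis s) - l) \<le> (1 - r) + \<bar>s\<bar>" unfolding eq by simp
  show "r * \<bar>sin s\<bar> \<le> cmod (of_real r * (l * cis s) - l)"
    unfolding eq using abs_Im_le_cmod[of "of_real r * cis s - 1"] r by (simp add: abs_mult)
  show "1 - r \<le> cmod (of_real r * (l * cis s) - l)"
    using norm_triangle_ineq2[of l "of_real r * (l * cis s)"] l r by (simp add: norm_mult norm_minus_commute)
qed

context inner_function
begin

section \<open>A lower bound near points where the inner function stays away from zero\<close>

definition conj_K :: "L2_circle \<Rightarrow> L2_circle" where
  "conj_K f = L2_of (\<lambda>\<zeta>. (\<theta> \<zeta> * cnj \<zeta>) * cnj (fn f \<zeta>))"

lemma cnj_fn_L2: "(\<lambda>\<zeta>. cnj (fn f \<zeta>)) \<in> L2_fun"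
  using fn_L2[of f] by (auto simp: L2_fun_def)

lemma conj_K_L2: "(\<lambda>\<zeta>. (\<theta> \<zeta> * cnj \<zeta>) * cnj (fn f \<zeta>)) \<in> L2_fun"
  by (intro L2_fun_mult Linf_fun_intros \<theta>_Linf cnj_fn_L2)

lemma AE_\<theta>_norm: "AE \<zeta> in circle_measure. cmod (\<theta> \<zeta>) = 1"
  using \<theta>_unimodular by (simp add: unimodular_def)

lemma \<theta>_measurable [measurable]: "\<theta> \<in> borel_measurable borel"
  by (rule Linf_fun_measurable[OF \<theta>_Linf])

lemma norm_conj_K: "norm (conj_K f) = norm f"
proof -
  have "(norm (conj_K f))\<^sup>2 = (LINT \<zeta>|circle_measure. (cmod (\<theta> \<zeta> * cnj \<zeta> * cnj (fn f \<zeta>)))\<^sup>2)"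
    unfolding conj_K_def by (rule norm_L2_of_sq[OF conj_K_L2])
  also have "\<dots> = (LINT \<zeta>|circle_measure. (cmod (fn f \<zeta>))\<^sup>2)"
  proof (rule integral_cong_AE)
    show "AE \<zeta> in circle_measure. (cmod (\<theta> \<zeta> * cnj \<zeta> * cnj (fn f \<zeta>)))\<^sup>2 = (cmod (fn f \<zeta>))\<^sup>2"
      using AE_\<theta>_norm AE_circle_norm by eventually_elim (simp add: norm_mult)
  qed measurable
  also have "\<dots> = (norm f)\<^sup>2" using norm_L2_of_sq[OF fn_L2[of f]] by (simp only: L2_of_fn)
  finally show ?thesis by (simp add: power2_eq_iff_nonneg)
qed

text \<open>The conjugation exchanges the two families of coefficients that cut out
  \<open>K\<close>, so orthogonality to \<open>\<theta> H^2\<close> turns into analyticity.\<close>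

lemma cinner_conj_K: "cinner_L2 (conj_K f) (zpow n) = cnj (cinner_L2 f (tpow (- n - 1)))"
proof -
  have t: "tpow (- n - 1) = L2_of (\<lambda>\<zeta>. \<theta> \<zeta> * \<zeta> powi (- n - 1))"
    unfolding tpow_def zpow_def by (rule mult_L2_of[OF \<theta>_Linf]) (intro Linf_fun_L2 Linf_fun_powi)
  have "cinner_L2 f (tpow (- n - 1)) = cinner_L2 (L2_of (fn f)) (tpow (- n - 1))" by simp
  also have "\<dots> = (LINT \<zeta>|circle_measure. fn f \<zeta> * cnj (\<theta> \<zeta> * \<zeta> powi (- n - 1)))"
    unfolding t by (rule cinner_L2_of) (auto intro!: Linf_fun_L2 Linf_fun_mult \<theta>_Linf Linf_fun_powi)
  finally have "cnj (cinner_L2 f (tpow (- n - 1))) = (LINT \<zeta>|circle_measure. cnj (fn f \<zeta> * cnj (\<theta> \<zeta> * \<zeta> powi (- n - 1))))"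
    by (simp only: Bochner_Integration.integral_cnj)
  also have "\<dots> = (LINT \<zeta>|circle_measure. (\<theta> \<zeta> * cnj \<zeta> * cnj (fn f \<zeta>)) * cnj (\<zeta> powi n))"
  proof (rule integral_cong_AE)
    show "AE \<zeta> in circle_measure. cnj (fn f \<zeta> * cnj (\<theta> \<zeta> * \<zeta> powi (- n - 1))) = (\<theta> \<zeta> * cnj \<zeta> * cnj (fn f \<zeta>)) * cnj (\<zeta> powi n)"
      using AE_circle_norm
    proof eventually_elim
      case (elim \<zeta>)
      then have nz: "\<zeta> \<noteq> 0" by auto
      have eq: "cnj \<zeta> * cnj (\<zeta> powi n) = \<zeta> powi (- n - 1)"
      proof -
        have "cnj \<zeta> * cnj (\<zeta> powi n) = cnj (\<zeta> powi (n + 1))" using nz by (simp add: power_int_add mult.commute)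
        also have "\<dots> = \<zeta> powi (- (n + 1))" by (rule cnj_powi[OF elim])
        finally show ?thesis by simp
      qed
      then show ?case by (simp only: complex_cnj_mult complex_cnj_cnj eq[symmetric] ac_simps)
    qed
  qed measurable
  also have "\<dots> = cinner_L2 (conj_K f) (zpow n)"
    unfolding conj_K_def zpow_def by (rule cinner_L2_of[symmetric, OF conj_K_L2]) (intro Linf_fun_L2 Linf_fun_powi)
  finally show ?thesis ..
qed

lemma conj_K_Hardy2: "f \<in> K \<Longrightarrow> conj_K f \<in> Hardy2"
  by (auto simp: Hardy2_iff cinner_conj_K K_iff)

lemma fn_conj_K: "AE \<zeta> in circle_measure. fn (conj_K f) \<zeta> = \<theta> \<zeta> * cnj \<zeta> * cnj (fn f \<zeta>)"
  unfolding conj_K_def by (rule fn_L2_of[OF conj_K_L2])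

context
  fixes l :: complex and \<rho> \<delta> e :: real
  assumes l: "cmod l = 1" and \<delta>: "\<delta> > 0" and e: "0 < e" "e \<le> 1/2" "2 * e < \<rho>"
    and low: "\<And>z. cmod z < 1 \<Longrightarrow> cmod (z - l) < \<rho> \<Longrightarrow> \<delta> \<le> cmod (disc_ext \<theta> z)"
begin

text \<open>On the circle \<open>arcF f\<close> is \<open>\<bar>f\<bar>\<^sup>2\<close>, because \<open>conj_K f = \<theta> cnj (\<zeta> f)\<close>.\<close>

definition arcF :: "L2_circle \<Rightarrow> complex \<Rightarrow> complex" where
  "arcF f z = z * disc_ext (fn f) z * disc_ext (fn (conj_K f)) z / disc_ext \<theta> z"

definition arcI :: "L2_circle \<Rightarrow> real \<Rightarrow> complex" where
  "arcI f r = (LINT s:{-e..e}|lborel. (e\<^sup>2 - s\<^sup>2) *\<^sub>R arcF f (of_real r * (l * cis s)))"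

lemma arcF_measurable [measurable]: "arcF f \<in> borel_measurable borel"
  unfolding arcF_def[abs_def] by measurable

text \<open>On this sector the distance to \<open>l\<close> is at most
  \<open>(1 - r) + |s| \<le> 2 * e\<close>, which is less than \<rho>.\<close>

lemma arc_in_region:
  assumes "1 - e \<le> r" "r < 1" "s \<in> {-e..e}"
  shows "cmod (of_real r * (l * cis s)) < 1" "cmod (of_real r * (l * cis s) - l) < \<rho>"
    "cmod (of_real r * (l * cis s)) = r"
  using arc_distance(1)[OF l, of r s] assms e l by (auto simp: norm_mult)

lemma arcF_bound:
  assumes "1 - e \<le> r" "r < 1" "s \<in> {-e..e}"
  shows "cmod (arcF f (of_real r * (l * cis s))) \<le> cmod (rad r f (l * cis s)) * cmod (rad r (conj_K f) (l * cis s)) / \<delta>"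
proof -
  note z = arc_in_region[OF assms]
  have "cmod (arcF f (of_real r * (l * cis s))) = r * (cmod (rad r f (l * cis s)) * cmod (rad r (conj_K f) (l * cis s))) / cmod (disc_ext \<theta> (of_real r * (l * cis s)))"
  proof -
    have "cmod (arcF f w) = cmod w * (cmod (disc_ext (fn f) w) * cmod (disc_ext (fn (conj_K f)) w)) / cmod (disc_ext \<theta> w)" for w
      by (simp add: arcF_def norm_mult norm_divide)
    then show ?thesis by (simp only: rad_def z(3))
  qed
  also have "\<dots> \<le> 1 * (cmod (rad r f (l * cis s)) * cmod (rad r (conj_K f) (l * cis s))) / \<delta>"
    using low[OF z(1,2)] \<delta> assms e by (intro frac_le mult_mono mult_nonneg_nonneg) auto
  finally show ?thesis by simp
qed

lemma rad_quotient:
  assumes "f \<in> Hardy2" "0 \<le> r" "r < 1" "cmod \<zeta> = 1"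
  shows "rad r (Zop f - l *\<^sub>C f) \<zeta> = (of_real r * \<zeta> - l) * rad r f \<zeta>"
proof -
  have z: "cmod (of_real r * \<zeta>) < 1" using assms by (simp add: norm_mult)
  show ?thesis
    unfolding rad_def disc_ext_fn[OF z] ev_simps ev_Zop[OF z] using assms(1) by (simp add: Hardy2_iff left_diff_distrib)
qed

text \<open>The point is uniformity in \<open>r\<close>. Both the arc of radius \<open>1 - e\<close>
  and the variation from there to \<open>r\<close> involve weights dominated by the distance to
  \<open>l\<close>; such a weight turns one factor \<open>f\<close> into
  \<open>(\<zeta> - l) f\<close>, and Cauchy-Schwarz does the rest.\<close>

lemma arcI_bound:
  assumes f: "f \<in> K" and r: "1 - e \<le> r" "r < 1"
  shows "cmod (arcI f r) \<le> 33 * pi / \<delta> * (norm (Zop f - l *\<^sub>C f) * norm f)"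
proof -
  define y where "y = Zop f - l *\<^sub>C f"
  define h where "h = conj_K f"
  have fH: "f \<in> Hardy2" using f by (rule K_Hardy2)
  define U where "U = ball 0 1 \<inter> ball l \<rho>"
  have U: "open U" by (simp add: U_def open_Int)
  have inU: "of_real r * (l * cis s) \<in> U" if "r \<in> {1 - e..r1}" "s \<in> {-e..e}" "r1 < 1" for r s r1
    using arc_in_region[of r s] that by (auto simp: U_def dist_norm norm_minus_commute)
  have \<theta>nz: "disc_ext \<theta> z \<noteq> 0" if "z \<in> U" for z using low[of z] that \<delta> by (auto simp: U_def dist_norm norm_minus_commute)
  have hol: "arcF f holomorphic_on U"
  proof -
    have evh: "(\<lambda>z. ev z x) holomorphic_on U" for x
      by (rule holomorphic_on_subset[OF ev_holomorphic]) (auto simp: U_def)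
    have eqs: "disc_ext (fn x) z = ev z x" "disc_ext \<theta> z = ev z (tpow 0)" if "z \<in> U" for z x
      using that by (auto simp: U_def disc_ext_fn ev_tpow_0)
    have "(\<lambda>z. z * ev z f * ev z (conj_K f) / ev z (tpow 0)) holomorphic_on U"
      by (intro holomorphic_intros evh) (use eqs(2) \<theta>nz in metis)
    then show ?thesis by (rule holomorphic_transform) (simp add: arcF_def eqs)
  qed
  let ?P = "norm y * norm f"
  have P0: "?P \<ge> 0" by simp
  have cs: "integrable circle_measure (\<lambda>\<zeta>. a * (cmod (rad r y \<zeta>) * cmod (rad r h \<zeta>)))"
    "a * (LINT \<zeta>|circle_measure. cmod (rad r y \<zeta>) * cmod (rad r h \<zeta>)) \<le> a * ?P" if "0 \<le> r" "r < 1" "a \<ge> 0" for r a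
  proof -
    note L = rad_L2[OF that(1,2)]
    show "integrable circle_measure (\<lambda>\<zeta>. a * (cmod (rad r y \<zeta>) * cmod (rad r h \<zeta>)))"
      by (intro integrable_mult_right L2_Cauchy_Schwarz_integral(1) L)
    have "(LINT \<zeta>|circle_measure. cmod (rad r y \<zeta>) * cmod (rad r h \<zeta>)) \<le> norm (L2_of (rad r y)) * norm (L2_of (rad r h))"
      by (intro L2_Cauchy_Schwarz_integral(2) L)
    also have "\<dots> \<le> norm y * norm h" by (intro mult_mono L) auto
    finally show "a * (LINT \<zeta>|circle_measure. cmod (rad r y \<zeta>) * cmod (rad r h \<zeta>)) \<le> a * ?P"
      using that(3) by (intro mult_left_mono) (simp_all add: h_def norm_conj_K)
  qed
  have quot: "cmod (rad r y (l * cis s)) = cmod (of_real r * (l * cis s) - l) * cmod (rad r f (l * cis s))" if "0 \<le> r" "r < 1" for r s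
    using rad_quotient[OF fH that, of "l * cis s"] l by (simp add: y_def norm_mult)
  \<comment> \<open>\<delta> pays for the division by \<theta>, the distance for replacing
    \<open>f\<close> by \<open>y\<close>; only \<open>a\<close> remains.\<close>
  have arc: "set_integrable lborel {-e..e} (\<lambda>s. wg s *\<^sub>R arcF f (of_real r * (l * cis s)))"
    "norm (LINT s:{-e..e}|lborel. wg s *\<^sub>R arcF f (of_real r * (l * cis s))) \<le> 2 * pi * (a * ?P)"
    if r: "1 - e \<le> r" "r < 1" and a: "a \<ge> 0" and wg[measurable]: "wg \<in> borel_measurable borel"
      and b: "\<And>s. s \<in> {-e..e} \<Longrightarrow> \<bar>wg s\<bar> \<le> \<delta> * a * cmod (of_real r * (l * cis s) - l)" for r a wg
  proof -
    have r': "0 \<le> r" using r e by simp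
    have le: "cmod (wg s *\<^sub>R arcF f (of_real r * (l * cis s))) \<le> a * (cmod (rad r y (l * cis s)) * cmod (rad r h (l * cis s)))"
      if s: "s \<in> {-e..e}" for s
    proof -
      have "cmod (wg s *\<^sub>R arcF f (of_real r * (l * cis s))) \<le> (\<delta> * a * cmod (of_real r * (l * cis s) - l)) *
          (cmod (rad r f (l * cis s)) * cmod (rad r h (l * cis s)) / \<delta>)"
        unfolding norm_scaleR using b[OF s] arcF_bound[OF r s, of f] a \<delta> by (intro mult_mono) (auto simp: h_def)
      also have "\<dots> = a * (cmod (rad r y (l * cis s)) * cmod (rad r h (l * cis s)))"
        unfolding quot[OF r' r(2)] using \<delta> by simp
      finally show ?thesis .
    qed
    have epi: "e \<le> pi" using e pi_gt3 by simp
    have m: "(\<lambda>\<zeta>. a * (cmod (rad r y \<zeta>) * cmod (rad r h \<zeta>))) \<in> borel_measurable borel"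
      "(\<lambda>s. wg s *\<^sub>R arcF f (of_real r * (l * cis s))) \<in> borel_measurable borel" by measurable
    have nn: "0 \<le> a * (cmod (rad r y \<zeta>) * cmod (rad r h \<zeta>))" for \<zeta> using a by simp
    note ai = arc_integrable[OF m cs(1)[OF r' r(2) a] nn l epi le]
    show "set_integrable lborel {-e..e} (\<lambda>s. wg s *\<^sub>R arcF f (of_real r * (l * cis s)))" by (rule ai(1))
    have "2 * pi * (LINT \<zeta>|circle_measure. a * (cmod (rad r y \<zeta>) * cmod (rad r h \<zeta>))) \<le> 2 * pi * (a * ?P)"
      using cs(2)[OF r' r(2) a] by (intro mult_left_mono) auto
    with ai(2) show "norm (LINT s:{-e..e}|lborel. wg s *\<^sub>R arcF f (of_real r * (l * cis s))) \<le> 2 * pi * (a * ?P)"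
      by (rule order_trans)
  qed
  have r0: "1 - e \<ge> 1 / 2" "1 - e > 0" using e by auto
  \<comment> \<open>From \<open>|s| \<le> 2 |sin s|\<close> and \<open>r \<ge> 1/2\<close> comes
    \<open>2 |s| \<le> 8 r |sin s|\<close>, which is the 8.\<close>
  have wt: "\<bar>2 * s\<bar> \<le> \<delta> * (8 / \<delta>) * cmod (of_real r * (l * cis s) - l)" if "1 - e \<le> r" "r < 1" "s \<in> {-e..e}" for r s
  proof -
    have "\<bar>s\<bar> \<le> 2 * \<bar>sin s\<bar>" using abs_le_2_abs_sin[of s] that e by auto
    also have "\<dots> \<le> 4 * (r * \<bar>sin s\<bar>)" using that r0 mult_right_mono[of "1/2" r "\<bar>sin s\<bar>"] by simp
    also have "\<dots> \<le> 4 * cmod (of_real r * (l * cis s) - l)" using arc_distance(2)[OF l, of r s] that r0 by simp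
    finally show ?thesis using \<delta> by simp
  qed
  have B1: "norm (integral {-e..e} (\<lambda>s. (2 * s) *\<^sub>R arcF f (of_real r * (l * cis s)))) \<le> 2 * pi * (8 / \<delta> * ?P)"
    if "1 - e \<le> r" "r < 1" for r
    using arc[OF that, of "8 / \<delta>" "\<lambda>s. 2 * s"] wt[OF that] \<delta> by (simp add: set_borel_integral_eq_integral)
  have wt0: "\<bar>e\<^sup>2 - s\<^sup>2\<bar> \<le> \<delta> * (e / \<delta>) * cmod (of_real (1 - e) * (l * cis s) - l)" if "s \<in> {-e..e}" for s
  proof -
    have "s\<^sup>2 \<le> e\<^sup>2" using that by (intro abs_le_square_iff[THEN iffD1]) auto
    then have "\<bar>e\<^sup>2 - s\<^sup>2\<bar> \<le> e * e" by (simp add: power2_eq_square)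
    also have "\<dots> \<le> e * cmod (of_real (1 - e) * (l * cis s) - l)"
      using arc_distance(3)[OF l, of "1 - e" s] e by (intro mult_left_mono) auto
    finally show ?thesis using \<delta> by simp
  qed
  \<comment> \<open>This bound degenerates as \<open>r\<close> tends to 1. It serves only
    integrability at a fixed \<open>r\<close>, in order to identify the Lebesgue integral with the
    gauge integral.\<close>
  have wtr: "\<bar>e\<^sup>2 - s\<^sup>2\<bar> \<le> \<delta> * (e\<^sup>2 / (\<delta> * (1 - r))) * cmod (of_real r * (l * cis s) - l)" if "s \<in> {-e..e}" "1 - e \<le> r" "r < 1" for s r
  proof -
    have "s\<^sup>2 \<le> e\<^sup>2" using that by (intro abs_le_square_iff[THEN iffD1]) auto
    then have "\<bar>e\<^sup>2 - s\<^sup>2\<bar> \<le> e\<^sup>2 / (1 - r) * (1 - r)" using that by (simp add: power2_eq_square)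
    also have "\<dots> \<le> e\<^sup>2 / (1 - r) * cmod (of_real r * (l * cis s) - l)"
      using arc_distance(3)[OF l, of r s] e that by (intro mult_left_mono) auto
    finally show ?thesis using \<delta> by simp
  qed
  have I_eq: "arcI f r = integral {-e..e} (\<lambda>s. (e\<^sup>2 - s\<^sup>2) *\<^sub>R arcF f (of_real r * (l * cis s)))" if "1 - e \<le> r" "r < 1" for r
    unfolding arcI_def using arc(1)[OF that, of "e\<^sup>2 / (\<delta> * (1 - r))" "\<lambda>s. e\<^sup>2 - s\<^sup>2"] wtr that \<delta>
    by (intro set_borel_integral_eq_integral) auto
  have I0: "arcI f (1 - e) = integral {-e..e} (\<lambda>s. (e\<^sup>2 - s\<^sup>2) *\<^sub>R arcF f (of_real (1 - e) * (l * cis s)))"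
    by (rule I_eq) (use e in auto)
  have B0: "norm (arcI f (1 - e)) \<le> 2 * pi * (e / \<delta> * ?P)"
    unfolding arcI_def using arc(2)[of "1 - e" "e / \<delta>" "\<lambda>s. e\<^sup>2 - s\<^sup>2"] wt0 e \<delta> by simp
  have "norm (arcI f r - arcI f (1 - e)) \<le> 2 * pi * (8 / \<delta> * ?P) / (1 - e) * (r - (1 - e))"
    unfolding I_eq[OF r] I0
    by (rule arc_integral_variation[OF U hol r0(2) r(1) e(1)]) (use r inU B1 in auto)
  also have "\<dots> \<le> 2 * pi * (8 / \<delta> * ?P) / (1 / 2) * 1"
    using r r0 e \<delta> P0 by (intro mult_mono divide_left_mono) auto
  \<comment> \<open>The variation costs \<open>2 * 8\<close>, doubled by
    \<open>1 - e \<ge> 1/2\<close>. The inner arc adds at most 1 more because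
    \<open>e \<le> 1/2\<close>, which makes 33.\<close>
  also have "\<dots> = 32 * pi / \<delta> * ?P" by simp
  finally have "norm (arcI f r) \<le> 32 * pi / \<delta> * ?P + 2 * pi * (e / \<delta> * ?P)"
    using B0 norm_triangle_ineq2[of "arcI f r" "arcI f (1 - e)"] by linarith
  also have "2 * pi * (e / \<delta> * ?P) \<le> 2 * pi * ((1/2) / \<delta> * ?P)"
    using e \<delta> P0 by (intro mult_left_mono mult_right_mono divide_right_mono) auto
  finally show ?thesis by (simp add: y_def algebra_simps)
qed

definition arcJ :: "L2_circle \<Rightarrow> real" where
  "arcJ f = (LINT s:{-e..e}|lborel. (e\<^sup>2 - s\<^sup>2) * (cmod (fn f (l * cis s)))\<^sup>2)"

lemma weight_bound: "s \<in> {-e..e} \<Longrightarrow> \<bar>e\<^sup>2 - s\<^sup>2\<bar> \<le> e\<^sup>2" "s \<in> {-e..e} \<Longrightarrow> 0 \<le> e\<^sup>2 - s\<^sup>2"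
proof -
  assume "s \<in> {-e..e}"
  then have "s\<^sup>2 \<le> e\<^sup>2" by (intro abs_le_square_iff[THEN iffD1]) auto
  then show "\<bar>e\<^sup>2 - s\<^sup>2\<bar> \<le> e\<^sup>2" "0 \<le> e\<^sup>2 - s\<^sup>2" by auto
qed

lemma e_le_pi: "e \<le> pi"
  using e pi_gt3 by simp

lemma arcJ_integrable:
  "set_integrable lborel {-e..e} (\<lambda>s. complex_of_real ((e\<^sup>2 - s\<^sup>2) * (cmod (fn f (l * cis s)))\<^sup>2))"
proof (rule arc_integrable(1)[where G = "\<lambda>\<zeta>. e\<^sup>2 * (cmod (fn f \<zeta>))\<^sup>2", OF _ _ _ _ l e_le_pi])
  show "integrable circle_measure (\<lambda>\<zeta>. e\<^sup>2 * (cmod (fn f \<zeta>))\<^sup>2)" using L2_fun_integrable[OF fn_L2] by simp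
  show "cmod (of_real ((e\<^sup>2 - s\<^sup>2) * (cmod (fn f (l * cis s)))\<^sup>2)) \<le> e\<^sup>2 * (cmod (fn f (l * cis s)))\<^sup>2" if "s \<in> {-e..e}" for s
    unfolding norm_of_real abs_mult using weight_bound[OF that] by (intro mult_mono) auto
qed auto

text \<open>Dilates of \<open>f\<close> and of its conjugate converge in mean square. For \<theta>
  in the denominator almost everywhere convergence is used, obtained along a subsequence; this is
  why only some sequence of radii is claimed.\<close>

lemma arcI_limit:
  assumes f: "f \<in> K"
  shows "\<exists>q. (\<forall>n. 1 - e \<le> q n \<and> q n < 1) \<and> (\<lambda>n::nat. arcI f (q n)) \<longlonglongrightarrow> of_real (arcJ f)"
proof -
  define h where "h = conj_K f"
  have fH: "f \<in> Hardy2" and hH: "h \<in> Hardy2" using f by (auto simp: h_def K_Hardy2 conj_K_Hardy2)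
  define r where "r n = 1 - e / real (n + 2)" for n
  have r: "1 - e \<le> r n" "r n < 1" "0 \<le> r n" for n
  proof -
    have "e / real (n + 2) \<le> e" using e by (simp add: divide_le_eq)
    moreover have "e / real (n + 2) > 0" using e by simp
    ultimately show "1 - e \<le> r n" "r n < 1" "0 \<le> r n" using e unfolding r_def by linarith+
  qed
  have rlim: "r \<longlonglongrightarrow> 1"
  proof -
    have "(\<lambda>n. 1 - e * (1 / real (n + 2))) \<longlonglongrightarrow> 1 - e * 0"
      using LIMSEQ_ignore_initial_segment[OF lim_1_over_n, of 2] by (intro tendsto_intros) simp
    then show ?thesis by (simp add: r_def[abs_def])
  qed
  have \<theta>L2: "\<theta> \<in> L2_fun" by (rule Linf_fun_L2[OF \<theta>_Linf])
  define w where "w n \<zeta> = rad (r n) (tpow 0) \<zeta> - \<theta> \<zeta>" for n \<zeta>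
  have wL: "w n \<in> L2_fun" for n unfolding w_def by (intro L2_fun_diff rad_L2 r \<theta>L2)
  have wn: "L2_of (w n) = L2_of (rad (r n) (tpow 0)) - tpow 0" for n
    unfolding w_def tpow_0 by (intro L2_of_diff rad_L2 r \<theta>L2)
  have "(\<lambda>n. norm (L2_of (w n))) \<longlonglongrightarrow> 0"
    unfolding wn using rad_tendsto[OF r(3,2) rlim tpow_Hardy2[of 0]] by (intro tendsto_norm_zero) (simp add: LIM_zero)
  then have "(\<lambda>n. LINT \<zeta>|circle_measure. norm (w n \<zeta>)) \<longlonglongrightarrow> 0"
    by (rule tendsto_sandwich[OF _ _ tendsto_const, rotated 2]) (auto intro!: always_eventually L2_fun_integrable_norm(2)[OF wL])
  from tendsto_L1_AE_subseq[OF L2_fun_integrable_norm(1)[OF wL] this]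
  obtain k where k: "strict_mono k" "AE \<zeta> in circle_measure. (\<lambda>n. w (k n) \<zeta>) \<longlonglongrightarrow> 0" by blast
  define q where "q n = r (k n)" for n
  have q: "1 - e \<le> q n" "q n < 1" "0 \<le> q n" for n using r by (auto simp: q_def)
  have qlim: "q \<longlonglongrightarrow> 1" using LIMSEQ_subseq_LIMSEQ[OF rlim k(1)] by (simp add: o_def q_def[abs_def])
  have inD: "cmod (of_real (q n) * \<zeta>) < 1" if "cmod \<zeta> = 1" for n \<zeta> using q that by (simp add: norm_mult)
  have \<theta>lim: "AE \<zeta> in circle_measure. (\<lambda>n. disc_ext \<theta> (of_real (q n) * \<zeta>)) \<longlonglongrightarrow> \<theta> \<zeta>"
    using k(2) AE_circle_norm
  proof eventually_elim
    case (elim \<zeta>)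
    have "w (k n) \<zeta> = disc_ext \<theta> (of_real (q n) * \<zeta>) - \<theta> \<zeta>" for n
      using inD[OF elim(2), of n] by (simp add: w_def rad_def q_def disc_ext_fn ev_tpow_0)
    then show ?case using elim(1) by (simp add: LIM_zero_iff)
  qed
  \<comment> \<open>A neighbourhood of \<open>l\<close> that contains the arc
    \<open>|s| \<le> e\<close> and whose dilates stay where \<theta> is bounded below.\<close>
  define A where "A = {\<zeta>. cmod (\<zeta> - l) \<le> e}"
  have [measurable]: "A \<in> sets borel" unfolding A_def by measurable
  \<comment> \<open>The factor \<open>q n\<close> belongs to the leading \<open>z\<close> in
    \<open>arcF\<close>.\<close>
  define u where "u n \<zeta> = of_real (q n) * rad (q n) f \<zeta> - fn f \<zeta>" for n \<zeta>
  define v where "v n \<zeta> = rad (q n) h \<zeta> - fn h \<zeta>" for n \<zeta>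
  define m where "m n \<zeta> = indicator A \<zeta> * cmod (1 / disc_ext \<theta> (of_real (q n) * \<zeta>) - 1 / \<theta> \<zeta>)" for n \<zeta>
  define D where "D n \<zeta> = indicator A \<zeta> * cmod (arcF f (of_real (q n) * \<zeta>) - of_real ((cmod (fn f \<zeta>))\<^sup>2))" for n \<zeta>
  \<comment> \<open>\<open>G1\<close> collects the error from dilating \<open>f\<close> and
    \<open>h\<close>, small in L1 by Cauchy-Schwarz; \<open>G2\<close> the error in
    \<open>1 / \<theta>\<close>, handled by dominated convergence.\<close>
  define G1 where "G1 n \<zeta> = 1 / \<delta> * (cmod (u n \<zeta>) * cmod (rad (q n) h \<zeta>) + cmod (fn f \<zeta>) * cmod (v n \<zeta>))" for n \<zeta>
  define G2 where "G2 n \<zeta> = cmod (fn f \<zeta>) * cmod (fn h \<zeta>) * m n \<zeta>" for n \<zeta>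
  have [measurable]: "u n \<in> borel_measurable borel" "v n \<in> borel_measurable borel" "m n \<in> borel_measurable borel"
    "D n \<in> borel_measurable borel" for n
    unfolding u_def v_def m_def D_def by measurable
  have uL: "u n \<in> L2_fun" and vL: "v n \<in> L2_fun" for n
    unfolding u_def v_def by (intro L2_fun_diff L2_fun_scale rad_L2 q fn_L2)+
  have un: "L2_of (u n) = of_real (q n) *\<^sub>C L2_of (rad (q n) f) - f" and vn: "L2_of (v n) = L2_of (rad (q n) h) - h" for n
    unfolding u_def v_def by (simp_all add: L2_of_diff L2_of_scale L2_fun_scale rad_L2 q)
  have ulim: "(\<lambda>n. norm (L2_of (u n))) \<longlonglongrightarrow> 0"
  proof (rule tendsto_norm_zero)
    have "(\<lambda>n. q n *\<^sub>R L2_of (rad (q n) f) - f) \<longlonglongrightarrow> 1 *\<^sub>R f - f"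
      by (intro tendsto_intros qlim rad_tendsto q fH)
    then show "(\<lambda>n. L2_of (u n)) \<longlonglongrightarrow> 0" by (simp add: un scaleR_L2_circle_def)
  qed
  have vlim: "(\<lambda>n. norm (L2_of (v n))) \<longlonglongrightarrow> 0"
  proof (rule tendsto_norm_zero)
    have "(\<lambda>n. L2_of (rad (q n) h) - h) \<longlonglongrightarrow> h - h"
      by (intro tendsto_intros qlim rad_tendsto q hH)
    then show "(\<lambda>n. L2_of (v n)) \<longlonglongrightarrow> 0" by (simp add: vn)
  qed
  have region: "\<delta> \<le> cmod (disc_ext \<theta> (of_real (q n) * \<zeta>))" if "cmod \<zeta> = 1" "\<zeta> \<in> A" for n \<zeta>
  proof (rule low[OF inD[OF that(1)]])
    have "of_real (q n) * \<zeta> - l = of_real (q n - 1) * \<zeta> + (\<zeta> - l)" by (simp add: algebra_simps)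
    then have "cmod (of_real (q n) * \<zeta> - l) \<le> cmod (of_real (q n - 1) * \<zeta>) + cmod (\<zeta> - l)" by (metis norm_triangle_ineq)
    also have "cmod (of_real (q n - 1) * \<zeta>) = 1 - q n" using that q[of n] by (simp add: norm_mult del: of_real_diff)
    finally show "cmod (of_real (q n) * \<zeta> - l) < \<rho>" using that(2) q[of n] e by (simp add: A_def)
  qed
  have m_bound: "AE \<zeta> in circle_measure. m n \<zeta> \<le> 1 / \<delta> + 1" for n
    using AE_circle_norm AE_\<theta>_norm
  proof eventually_elim
    case (elim \<zeta>)
    show ?case
    proof (cases "\<zeta> \<in> A")
      case True
      have "m n \<zeta> \<le> cmod (1 / disc_ext \<theta> (of_real (q n) * \<zeta>)) + cmod (1 / \<theta> \<zeta>)"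
        using norm_triangle_ineq4 True by (simp add: m_def)
      also have "\<dots> \<le> 1 / \<delta> + 1"
        using region[OF elim(1) True, of n] \<delta> elim(2) by (intro add_mono) (auto simp: norm_divide intro!: frac_le)
      finally show ?thesis .
    qed (use \<delta> in \<open>simp add: m_def\<close>)
  qed
  have m_nonneg: "0 \<le> m n \<zeta>" for n \<zeta> by (simp add: m_def)
  have intfh: "integrable circle_measure (\<lambda>\<zeta>. cmod (fn f \<zeta>) * cmod (fn h \<zeta>))"
    by (intro L2_Cauchy_Schwarz_integral(1) fn_L2)
  have G2b: "AE \<zeta> in circle_measure. norm (G2 n \<zeta>) \<le> (1 / \<delta> + 1) * (cmod (fn f \<zeta>) * cmod (fn h \<zeta>))" for n
    using m_bound[of n]
  proof eventually_elim
    case (elim \<zeta>)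
    show ?case using mult_left_mono[OF elim, of "cmod (fn f \<zeta>) * cmod (fn h \<zeta>)"] m_nonneg[of n \<zeta>]
      by (simp add: G2_def abs_mult mult.commute)
  qed
  have [measurable]: "G1 n \<in> borel_measurable borel" "G2 n \<in> borel_measurable borel" for n
    unfolding G1_def G2_def by measurable
  have G2lim: "(\<lambda>n. LINT \<zeta>|circle_measure. G2 n \<zeta>) \<longlonglongrightarrow> (LINT \<zeta>|circle_measure. 0)"
  proof (rule integral_dominated_convergence[OF _ _ _ _ G2b])
    show "integrable circle_measure (\<lambda>\<zeta>. (1 / \<delta> + 1) * (cmod (fn f \<zeta>) * cmod (fn h \<zeta>)))" using intfh by simp
    show "AE \<zeta> in circle_measure. (\<lambda>n. G2 n \<zeta>) \<longlonglongrightarrow> 0"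
      using \<theta>lim AE_\<theta>_norm
    proof eventually_elim
      case (elim \<zeta>)
      have "(\<lambda>n. cmod (fn f \<zeta>) * cmod (fn h \<zeta>) * (indicator A \<zeta> * cmod (1 / disc_ext \<theta> (of_real (q n) * \<zeta>) - 1 / \<theta> \<zeta>)))
          \<longlonglongrightarrow> cmod (fn f \<zeta>) * cmod (fn h \<zeta>) * (indicator A \<zeta> * cmod (1 / \<theta> \<zeta> - 1 / \<theta> \<zeta>))"
        using elim by (intro tendsto_intros) auto
      then show ?case by (simp add: G2_def m_def)
    qed
  qed measurable
  have G2int: "integrable circle_measure (G2 n)" for n
    by (rule Bochner_Integration.integrable_bound[where f = "\<lambda>\<zeta>. (1 / \<delta> + 1) * (cmod (fn f \<zeta>) * cmod (fn h \<zeta>))"])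
      (use intfh G2b[of n] \<delta> in \<open>auto elim!: eventually_mono\<close>)
  have G1int: "integrable circle_measure (G1 n)" for n
    unfolding G1_def by (intro integrable_mult_right Bochner_Integration.integrable_add L2_Cauchy_Schwarz_integral(1) uL vL fn_L2 rad_L2 q)
  have G1le: "(LINT \<zeta>|circle_measure. G1 n \<zeta>) \<le> 1 / \<delta> * (norm (L2_of (u n)) * norm h + norm f * norm (L2_of (v n)))" for n
  proof -
    have "(LINT \<zeta>|circle_measure. G1 n \<zeta>) = 1 / \<delta> * ((LINT \<zeta>|circle_measure. cmod (u n \<zeta>) * cmod (rad (q n) h \<zeta>)) + (LINT \<zeta>|circle_measure. cmod (fn f \<zeta>) * cmod (v n \<zeta>)))"
      unfolding G1_def by (subst Bochner_Integration.integral_add[symmetric])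
        (auto intro!: L2_Cauchy_Schwarz_integral(1) uL vL rad_L2 q)
    also have "\<dots> \<le> 1 / \<delta> * (norm (L2_of (u n)) * norm h + norm f * norm (L2_of (v n)))"
    proof (intro mult_left_mono add_mono)
      have "(LINT \<zeta>|circle_measure. cmod (u n \<zeta>) * cmod (rad (q n) h \<zeta>)) \<le> norm (L2_of (u n)) * norm (L2_of (rad (q n) h))"
        by (intro L2_Cauchy_Schwarz_integral(2) uL rad_L2 q)
      also have "\<dots> \<le> norm (L2_of (u n)) * norm h" by (intro mult_left_mono rad_L2 q) auto
      finally show "(LINT \<zeta>|circle_measure. cmod (u n \<zeta>) * cmod (rad (q n) h \<zeta>)) \<le> norm (L2_of (u n)) * norm h" .
      show "(LINT \<zeta>|circle_measure. cmod (fn f \<zeta>) * cmod (v n \<zeta>)) \<le> norm f * norm (L2_of (v n))"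
        using L2_Cauchy_Schwarz_integral(2)[OF fn_L2[of f] vL[of n]] by simp
    qed (use \<delta> in auto)
    finally show ?thesis .
  qed
  have DG: "AE \<zeta> in circle_measure. D n \<zeta> \<le> G1 n \<zeta> + G2 n \<zeta>" for n
    using AE_circle_norm AE_\<theta>_norm fn_conj_K[of f]
  proof eventually_elim
    case (elim \<zeta>)
    show ?case
    proof (cases "\<zeta> \<in> A")
      case True
      define t where "t = disc_ext \<theta> (of_real (q n) * \<zeta>)"
      define a b a' b' where "a = rad (q n) f \<zeta>" and "b = rad (q n) h \<zeta>" and "a' = fn f \<zeta>" and "b' = fn h \<zeta>"
      have t: "\<delta> \<le> cmod t" using region[OF elim(1) True] by (simp add: t_def)
      have tnz: "t \<noteq> 0" and \<theta>nz: "\<theta> \<zeta> \<noteq> 0" using t \<delta> elim(2) by auto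
      have zz: "\<zeta> * cnj \<zeta> = 1" using complex_norm_square[of \<zeta>] elim(1) by simp
      have sq: "of_real ((cmod (fn f \<zeta>))\<^sup>2) = \<zeta> * a' * b' / \<theta> \<zeta>"
      proof -
        have "\<zeta> * a' * b' / \<theta> \<zeta> = (\<zeta> * cnj \<zeta>) * (fn f \<zeta> * cnj (fn f \<zeta>))"
          using elim(3) \<theta>nz by (simp add: a'_def b'_def h_def ac_simps)
        then show ?thesis unfolding zz complex_norm_square by simp
      qed
      have F: "arcF f (of_real (q n) * \<zeta>) = of_real (q n) * \<zeta> * a * b / t"
        by (simp add: arcF_def t_def a_def b_def rad_def h_def)
      have "arcF f (of_real (q n) * \<zeta>) - of_real ((cmod (fn f \<zeta>))\<^sup>2)
        = \<zeta> * ((of_real (q n) * a - a') * b + a' * (b - b')) / t + \<zeta> * (a' * b') * (1 / t - 1 / \<theta> \<zeta>)"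
        unfolding F sq using tnz \<theta>nz by (simp add: field_simps)
      then have "D n \<zeta> \<le> cmod (\<zeta> * ((of_real (q n) * a - a') * b + a' * (b - b')) / t) + cmod (\<zeta> * (a' * b') * (1 / t - 1 / \<theta> \<zeta>))"
        using True norm_triangle_ineq by (simp add: D_def)
      also have "cmod (\<zeta> * (a' * b') * (1 / t - 1 / \<theta> \<zeta>)) = G2 n \<zeta>"
        using True elim(1) by (simp add: G2_def m_def norm_mult t_def a'_def b'_def)
      also have "cmod (\<zeta> * ((of_real (q n) * a - a') * b + a' * (b - b')) / t) \<le> G1 n \<zeta>"
      proof -
        have "cmod (\<zeta> * ((of_real (q n) * a - a') * b + a' * (b - b')) / t) = cmod ((of_real (q n) * a - a') * b + a' * (b - b')) / cmod t"
          using elim(1) by (simp add: norm_mult norm_divide)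
        also have "\<dots> \<le> (cmod (of_real (q n) * a - a') * cmod b + cmod a' * cmod (b - b')) / \<delta>"
          using t \<delta> norm_triangle_ineq[of "(of_real (q n) * a - a') * b" "a' * (b - b')"]
          by (intro frac_le) (auto simp: norm_mult)
        finally show ?thesis by (simp add: G1_def u_def v_def a_def b_def a'_def b'_def)
      qed
      finally show ?thesis by simp
    next
      case False
      have "0 \<le> G1 n \<zeta>" "0 \<le> G2 n \<zeta>" using \<delta> m_nonneg by (auto simp: G1_def G2_def)
      then show ?thesis using False by (simp add: D_def)
    qed
  qed
  have D_nonneg: "0 \<le> D n \<zeta>" for n \<zeta> by (simp add: D_def)
  have Dint: "integrable circle_measure (D n)" for n
    by (rule Bochner_Integration.integrable_bound[OF Bochner_Integration.integrable_add[OF G1int G2int, of n n]])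
      (use DG[of n] D_nonneg in \<open>auto elim!: eventually_mono\<close>)
  have Dle: "(LINT \<zeta>|circle_measure. D n \<zeta>) \<le> 1 / \<delta> * (norm (L2_of (u n)) * norm h + norm f * norm (L2_of (v n))) + (LINT \<zeta>|circle_measure. G2 n \<zeta>)" for n
  proof -
    have "(LINT \<zeta>|circle_measure. D n \<zeta>) \<le> (LINT \<zeta>|circle_measure. G1 n \<zeta> + G2 n \<zeta>)"
      by (rule integral_mono_AE[OF Dint Bochner_Integration.integrable_add[OF G1int G2int] DG])
    then show ?thesis using G1le[of n] by (simp add: Bochner_Integration.integral_add[OF G1int G2int])
  qed
  have diff: "norm (arcI f (q n) - of_real (arcJ f)) \<le> 2 * pi * (e\<^sup>2 * (LINT \<zeta>|circle_measure. D n \<zeta>))" for n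
  proof -
    have i1: "set_integrable lborel {-e..e} (\<lambda>s. (e\<^sup>2 - s\<^sup>2) *\<^sub>R arcF f (of_real (q n) * (l * cis s)))"
    proof (rule arc_integrable(1)[where G = "\<lambda>\<zeta>. e\<^sup>2 / \<delta> * (cmod (rad (q n) f \<zeta>) * cmod (rad (q n) h \<zeta>))", OF _ _ _ _ l e_le_pi])
      show "integrable circle_measure (\<lambda>\<zeta>. e\<^sup>2 / \<delta> * (cmod (rad (q n) f \<zeta>) * cmod (rad (q n) h \<zeta>)))"
        by (intro integrable_mult_right L2_Cauchy_Schwarz_integral(1) rad_L2 q)
      fix s assume s: "s \<in> {-e..e}"
      have "cmod ((e\<^sup>2 - s\<^sup>2) *\<^sub>R arcF f (of_real (q n) * (l * cis s))) \<le> e\<^sup>2 * (cmod (rad (q n) f (l * cis s)) * cmod (rad (q n) h (l * cis s)) / \<delta>)"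
        unfolding norm_scaleR h_def using weight_bound[OF s] arcF_bound[OF q(1,2) s] by (intro mult_mono) auto
      then show "cmod ((e\<^sup>2 - s\<^sup>2) *\<^sub>R arcF f (of_real (q n) * (l * cis s))) \<le> e\<^sup>2 / \<delta> * (cmod (rad (q n) f (l * cis s)) * cmod (rad (q n) h (l * cis s)))" by simp
    qed (use \<delta> in auto)
    have J: "of_real (arcJ f) = (LINT s:{-e..e}|lborel. complex_of_real ((e\<^sup>2 - s\<^sup>2) * (cmod (fn f (l * cis s)))\<^sup>2))"
      unfolding arcJ_def set_lebesgue_integral_def
      by (subst integral_complex_of_real[symmetric]) (auto intro!: Bochner_Integration.integral_cong simp: indicator_def)
    have eq: "arcI f (q n) - of_real (arcJ f) = (LINT s:{-e..e}|lborel. (e\<^sup>2 - s\<^sup>2) *\<^sub>R arcF f (of_real (q n) * (l * cis s)) - of_real ((e\<^sup>2 - s\<^sup>2) * (cmod (fn f (l * cis s)))\<^sup>2))"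
      unfolding J arcI_def by (rule set_integral_diff(2)[symmetric, OF i1 arcJ_integrable])
    have "norm (arcI f (q n) - of_real (arcJ f)) \<le> 2 * pi * (LINT \<zeta>|circle_measure. e\<^sup>2 * D n \<zeta>)"
      unfolding eq
    proof (rule arc_integrable(2)[OF _ _ _ _ l e_le_pi])
      show "integrable circle_measure (\<lambda>\<zeta>. e\<^sup>2 * D n \<zeta>)" using Dint by simp
      show "0 \<le> e\<^sup>2 * D n \<zeta>" for \<zeta> using D_nonneg by simp
      fix s assume s: "s \<in> {-e..e}"
      have "\<bar>s\<bar> \<le> e" using s by auto
      then have "l * cis s \<in> A" using arc_distance(1)[OF l, of 1 s] by (simp add: A_def)
      then have "cmod ((e\<^sup>2 - s\<^sup>2) *\<^sub>R arcF f (of_real (q n) * (l * cis s)) - of_real ((e\<^sup>2 - s\<^sup>2) * (cmod (fn f (l * cis s)))\<^sup>2))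
         = \<bar>e\<^sup>2 - s\<^sup>2\<bar> * D n (l * cis s)"
        unfolding D_def by (simp only: scaleR_conv_of_real of_real_mult right_diff_distrib[symmetric] norm_mult norm_of_real indicator_simps mult_1_left)
      also have "\<dots> \<le> e\<^sup>2 * D n (l * cis s)" using weight_bound[OF s] D_nonneg by (intro mult_right_mono) auto
      finally show "cmod ((e\<^sup>2 - s\<^sup>2) *\<^sub>R arcF f (of_real (q n) * (l * cis s)) - of_real ((e\<^sup>2 - s\<^sup>2) * (cmod (fn f (l * cis s)))\<^sup>2)) \<le> e\<^sup>2 * D n (l * cis s)" .
    qed measurable
    then show ?thesis by simp
  qed
  have "(\<lambda>n. arcI f (q n) - of_real (arcJ f)) \<longlonglongrightarrow> 0"
  proof (rule Lim_null_comparison)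
    show "\<forall>\<^sub>F n in sequentially. norm (arcI f (q n) - of_real (arcJ f)) \<le>
        2 * pi * (e\<^sup>2 * (1 / \<delta> * (norm (L2_of (u n)) * norm h + norm f * norm (L2_of (v n))) + (LINT \<zeta>|circle_measure. G2 n \<zeta>)))"
      using diff Dle by (intro always_eventually allI) (meson mult_left_mono order_trans pi_ge_zero zero_le_power2 mult_nonneg_nonneg zero_le_numeral)
    have "(\<lambda>n. 2 * pi * (e\<^sup>2 * (1 / \<delta> * (norm (L2_of (u n)) * norm h + norm f * norm (L2_of (v n))) + (LINT \<zeta>|circle_measure. G2 n \<zeta>))))
      \<longlonglongrightarrow> 2 * pi * (e\<^sup>2 * (1 / \<delta> * (0 * norm h + norm f * 0) + (LINT \<zeta>|circle_measure. 0)))"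
      by (intro tendsto_intros ulim vlim G2lim)
    then show "(\<lambda>n. 2 * pi * (e\<^sup>2 * (1 / \<delta> * (norm (L2_of (u n)) * norm h + norm f * norm (L2_of (v n))) + (LINT \<zeta>|circle_measure. G2 n \<zeta>))))
      \<longlonglongrightarrow> 0" by simp
  qed
  then have "(\<lambda>n. arcI f (q n)) \<longlonglongrightarrow> of_real (arcJ f)" by (rule LIM_zero_cancel)
  then show ?thesis using q by blast
qed

text \<open>For \<open>|s| \<le> e/2\<close> the weight is at least \<open>3 e^2 / 4\<close>, so
  \<open>arcJ\<close> controls the mass of \<open>f\<close> near \<open>l\<close>; away from
  \<open>l\<close> division by \<open>\<zeta> - l\<close> is bounded.\<close>

lemma lower_estimate_aux:
  "\<exists>C\<ge>0. \<forall>f\<in>K. norm f \<le> C * norm (Zop f - l *\<^sub>C f)"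
proof -
  \<comment> \<open>The chord that subtends the angle \<open>e/2\<close>: points of the circle
    nearer to \<open>l\<close> have \<open>|s| \<le> e/2\<close>.\<close>
  define \<eta> where "\<eta> = 2 * sin (e / 4)"
  have \<eta>: "\<eta> > 0" unfolding \<eta>_def using e pi_gt3 by (intro mult_pos_pos sin_gt_zero) auto
  define C2 where "C2 = 4 / (3 * e\<^sup>2) * (33 * pi / \<delta>)"
  define C3 where "C3 = 1 / \<eta>\<^sup>2"
  have C: "C2 \<ge> 0" "C3 \<ge> 0" using \<delta> by (auto simp: C2_def C3_def)
  have main: "(norm f)\<^sup>2 \<le> C2 * (norm (Zop f - l *\<^sub>C f) * norm f) + C3 * (norm (Zop f - l *\<^sub>C f))\<^sup>2" if f: "f \<in> K" for f
  proof -
    define y where "y = Zop f - l *\<^sub>C f"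
    define A where "A = {\<zeta>. cmod (\<zeta> - l) < \<eta>}"
    have [measurable]: "A \<in> sets borel" unfolding A_def by measurable
    let ?g = "\<lambda>\<zeta>. (cmod (fn f \<zeta>))\<^sup>2"
    have gint: "integrable circle_measure ?g" by (rule L2_fun_integrable[OF fn_L2])
    have gA: "integrable circle_measure (\<lambda>\<zeta>. ?g \<zeta> * indicator B \<zeta>)" if "B \<in> sets borel" for B
      using integrable_mult_indicator[of B circle_measure ?g] gint that by (simp add: mult.commute)
    have J0: "0 \<le> arcJ f"
      unfolding arcJ_def set_lebesgue_integral_def
      by (intro integral_nonneg_AE AE_I2) (auto simp: indicator_def intro!: mult_nonneg_nonneg weight_bound(2))
    have J: "arcJ f \<le> 33 * pi / \<delta> * (norm y * norm f)"
    proof -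
      obtain q where q: "\<And>n. 1 - e \<le> q n" "\<And>n. q n < 1" "(\<lambda>n::nat. arcI f (q n)) \<longlonglongrightarrow> of_real (arcJ f)"
        using arcI_limit[OF f] by blast
      have "norm (complex_of_real (arcJ f)) \<le> 33 * pi / \<delta> * (norm y * norm f)"
        by (rule LIMSEQ_le_const2[OF tendsto_norm[OF q(3)]]) (use arcI_bound[OF f q(1,2)] in \<open>auto simp: y_def\<close>)
      then show ?thesis using J0 by simp
    qed
    have near: "(LINT \<zeta>|circle_measure. ?g \<zeta> * indicator A \<zeta>) \<le> 4 / (3 * e\<^sup>2) * arcJ f"
    proof -
      let ?w = "\<lambda>s. 4 / (3 * e\<^sup>2) * ((e\<^sup>2 - s\<^sup>2) * ?g (l * cis s))"
      have sJ: "set_integrable lborel {-e..e} (\<lambda>s. (e\<^sup>2 - s\<^sup>2) * ?g (l * cis s))"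
      proof -
        have "integrable lborel (\<lambda>s. complex_of_real (indicator {-e..e} s *\<^sub>R ((e\<^sup>2 - s\<^sup>2) * ?g (l * cis s))))"
          using arcJ_integrable[of f] unfolding set_integrable_def by (simp add: scaleR_conv_of_real)
        from integrable_Re[OF this] show ?thesis unfolding set_integrable_def Re_complex_of_real .
      qed
      have "ennreal (2 * pi * (LINT \<zeta>|circle_measure. ?g \<zeta> * indicator A \<zeta>))
          = (\<integral>\<^sup>+s. ennreal (?g (l * cis s) * indicator A (l * cis s)) * indicator {-pi..pi} s \<partial>lborel)"
        by (rule arc_nn_integral_le[symmetric, OF _ gA _ l]) auto
      also have "\<dots> \<le> (\<integral>\<^sup>+s. ennreal (4 / (3 * e\<^sup>2) * (indicator {-e..e} s *\<^sub>R ((e\<^sup>2 - s\<^sup>2) * ?g (l * cis s)))) \<partial>lborel)"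
      proof (rule nn_integral_mono)
        fix s :: real
        show "ennreal (?g (l * cis s) * indicator A (l * cis s)) * indicator {-pi..pi} s \<le> ennreal (4 / (3 * e\<^sup>2) * (indicator {-e..e} s *\<^sub>R ((e\<^sup>2 - s\<^sup>2) * ?g (l * cis s))))"
        proof (cases "s \<in> {-pi..pi} \<and> l * cis s \<in> A")
          case True
          have "\<bar>s\<bar> \<le> e / 2"
          proof (rule ccontr)
            assume "\<not> \<bar>s\<bar> \<le> e / 2"
            then have "sin (e / 4) \<le> sin (\<bar>s\<bar> / 2)" using True e by (intro sin_monotone_2pi_le) auto
            also have "sin (\<bar>s\<bar> / 2) \<le> \<bar>sin (s / 2)\<bar>" by (cases "s \<ge> 0") auto
            finally have "\<eta> \<le> cmod (cis s - 1)" by (simp add: norm_cis_minus_one \<eta>_def)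
            also have "cmod (cis s - 1) = cmod (l * cis s - l)"
              using l norm_mult[of l "cis s - 1"] by (simp add: right_diff_distrib)
            finally show False using True by (simp add: A_def)
          qed
          then have se: "s \<in> {-e..e}" using e by auto
          have "\<bar>s\<bar>\<^sup>2 \<le> (e / 2)\<^sup>2" by (rule power_mono[OF \<open>\<bar>s\<bar> \<le> e / 2\<close>]) simp
          then have "3 * e\<^sup>2 / 4 \<le> e\<^sup>2 - s\<^sup>2" by (simp add: power_divide)
          then have "1 \<le> 4 / (3 * e\<^sup>2) * (e\<^sup>2 - s\<^sup>2)" using e by (simp add: field_simps)
          then have "1 * ?g (l * cis s) \<le> 4 / (3 * e\<^sup>2) * (e\<^sup>2 - s\<^sup>2) * ?g (l * cis s)" by (intro mult_right_mono) auto
          then have "ennreal (1 * ?g (l * cis s)) \<le> ennreal (4 / (3 * e\<^sup>2) * (e\<^sup>2 - s\<^sup>2) * ?g (l * cis s))"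
            by (rule ennreal_leI)
          moreover have "ennreal (?g (l * cis s) * indicator A (l * cis s)) * indicator {-pi..pi} s = ennreal (1 * ?g (l * cis s))"
            using True by simp
          moreover have "indicator {-e..e} s *\<^sub>R ((e\<^sup>2 - s\<^sup>2) * ?g (l * cis s)) = (e\<^sup>2 - s\<^sup>2) * ?g (l * cis s)"
            using se by simp
          ultimately show ?thesis by (simp only: mult.assoc)
        qed (auto simp: indicator_def)
      qed
      also have "\<dots> = ennreal (4 / (3 * e\<^sup>2) * arcJ f)"
        unfolding arcJ_def set_lebesgue_integral_def integral_mult_right_zero[symmetric]
        using sJ unfolding set_integrable_def
        by (intro nn_integral_eq_integral integrable_mult_right AE_I2) (auto simp: indicator_def intro!: mult_nonneg_nonneg divide_nonneg_nonneg weight_bound(2))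
      finally have "2 * pi * (LINT \<zeta>|circle_measure. ?g \<zeta> * indicator A \<zeta>) \<le> 4 / (3 * e\<^sup>2) * arcJ f"
        using J0 by (subst (asm) ennreal_le_iff) auto
      moreover have "1 * (LINT \<zeta>|circle_measure. ?g \<zeta> * indicator A \<zeta>) \<le> 2 * pi * (LINT \<zeta>|circle_measure. ?g \<zeta> * indicator A \<zeta>)"
        using pi_gt3 by (intro mult_right_mono integral_nonneg_AE) auto
      ultimately show ?thesis by simp
    qed
    have far: "(LINT \<zeta>|circle_measure. ?g \<zeta> * indicator (- A) \<zeta>) \<le> C3 * (norm y)\<^sup>2"
    proof -
      have yint: "integrable circle_measure (\<lambda>\<zeta>. C3 * (cmod (fn y \<zeta>))\<^sup>2)" using L2_fun_integrable[OF fn_L2] by simp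
      have "(LINT \<zeta>|circle_measure. ?g \<zeta> * indicator (- A) \<zeta>) \<le> (LINT \<zeta>|circle_measure. C3 * (cmod (fn y \<zeta>))\<^sup>2)"
      proof (rule integral_mono_AE[OF gA yint])
        show "AE \<zeta> in circle_measure. ?g \<zeta> * indicator (- A) \<zeta> \<le> C3 * (cmod (fn y \<zeta>))\<^sup>2"
          using fn_mult_L2[OF diff_symbol_Linf[of l], of f]
        proof eventually_elim
          case (elim \<zeta>)
          have fy: "(cmod (fn y \<zeta>))\<^sup>2 = (cmod (\<zeta> - l))\<^sup>2 * ?g \<zeta>"
            using elim unfolding y_def Zop_diff_eq_mult by (simp add: norm_mult power_mult_distrib)
          show ?case
          proof (cases "\<zeta> \<in> A")
            case False
            then have "\<eta>\<^sup>2 \<le> (cmod (\<zeta> - l))\<^sup>2" using \<eta> by (intro power_mono) (auto simp: A_def)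
            then have "1 * ?g \<zeta> \<le> C3 * (cmod (\<zeta> - l))\<^sup>2 * ?g \<zeta>" using \<eta> by (intro mult_right_mono) (auto simp: C3_def field_simps)
            then show ?thesis using False by (simp add: fy mult.assoc)
          qed (use C in auto)
        qed
      qed auto
      also have "\<dots> = C3 * (norm y)\<^sup>2" using norm_L2_of_sq[OF fn_L2[of y]] by simp
      finally show ?thesis .
    qed
    have "(norm f)\<^sup>2 = (LINT \<zeta>|circle_measure. ?g \<zeta>)" using norm_L2_of_sq[OF fn_L2[of f]] by simp
    also have "\<dots> = (LINT \<zeta>|circle_measure. ?g \<zeta> * indicator A \<zeta> + ?g \<zeta> * indicator (- A) \<zeta>)"
      by (intro Bochner_Integration.integral_cong) (auto simp: indicator_def)
    also have "\<dots> = (LINT \<zeta>|circle_measure. ?g \<zeta> * indicator A \<zeta>) + (LINT \<zeta>|circle_measure. ?g \<zeta> * indicator (- A) \<zeta>)"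
      by (intro Bochner_Integration.integral_add gA) auto
    also have "\<dots> \<le> 4 / (3 * e\<^sup>2) * arcJ f + C3 * (norm y)\<^sup>2" using near far by simp
    also have "4 / (3 * e\<^sup>2) * arcJ f \<le> 4 / (3 * e\<^sup>2) * (33 * pi / \<delta> * (norm y * norm f))"
      using J by (intro mult_left_mono) auto
    finally show ?thesis by (simp only: C2_def y_def mult.assoc)
  qed
  \<comment> \<open>Either \<open>f\<close> is already dominated, or the square in the last term may
    be replaced by the mixed product and one factor \<open>norm f\<close> cancelled.\<close>
  have "norm f \<le> (C2 + C3 + 1) * norm (Zop f - l *\<^sub>C f)" if f: "f \<in> K" for f
  proof (cases "norm f \<le> norm (Zop f - l *\<^sub>C f)")
    case True
    also have "1 * norm (Zop f - l *\<^sub>C f) \<le> (C2 + C3 + 1) * norm (Zop f - l *\<^sub>C f)" using C by (intro mult_right_mono) auto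
    finally show ?thesis by simp
  next
    case False
    let ?y = "norm (Zop f - l *\<^sub>C f)"
    have "norm f * norm f \<le> C2 * (?y * norm f) + C3 * (?y * norm f)"
      using main[OF f] False C mult_left_mono[of "?y * ?y" "?y * norm f" C3] mult_left_mono[of ?y "norm f" ?y]
      by (simp add: power2_eq_square)
    then have "norm f * norm f \<le> ((C2 + C3) * ?y) * norm f" by (simp add: algebra_simps)
    moreover have fp: "norm f > 0" using False norm_ge_zero[of "Zop f - l *\<^sub>C f"] by linarith
    ultimately have "norm f \<le> (C2 + C3) * ?y" by (rule mult_right_le_imp_le)
    also have "\<dots> \<le> (C2 + C3 + 1) * ?y" by (intro mult_right_mono) auto
    finally show ?thesis .
  qed
  then show ?thesis using C by (intro exI[of _ "C2 + C3 + 1"]) auto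
qed

end

end

context inner_function
begin

lemma lower_estimate:
  assumes l: "cmod l = 1" and ns: "l \<notin> inner_spectrum \<theta>"
  shows "\<exists>C\<ge>0. \<forall>f\<in>K. norm f \<le> C * norm (Zop f - l *\<^sub>C f)"
proof -
  let ?F = "at l within ball 0 1"
  let ?L = "Liminf ?F (\<lambda>z. ereal (norm (disc_ext \<theta> z)))"
  have "?L \<noteq> 0" using ns l by (simp add: inner_spectrum_def)
  moreover have "0 \<le> ?L" by (rule Liminf_bounded) simp
  ultimately have "0 < ?L" by simp
  then obtain \<delta> where \<delta>: "0 < ereal \<delta>" "ereal \<delta> < ?L" using ereal_dense2 by blast
  have "\<forall>\<^sub>F z in ?F. ereal \<delta> < ereal (norm (disc_ext \<theta> z))" by (rule less_LiminfD[OF \<delta>(2)])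
  then obtain d where d: "d > 0" "\<And>z. z \<in> ball 0 1 \<Longrightarrow> z \<noteq> l \<Longrightarrow> dist z l < d \<Longrightarrow> \<delta> < norm (disc_ext \<theta> z)"
    unfolding eventually_at by auto
  define e where "e = min (1/2) (d / 3)"
  have e: "0 < e" "e \<le> 1/2" "2 * e < d" using d(1) by (auto simp: e_def)
  have low: "\<delta> \<le> cmod (disc_ext \<theta> z)" if "cmod z < 1" "cmod (z - l) < d" for z
    using d(2)[of z] that l by (force simp: dist_norm)
  show ?thesis using lower_estimate_aux[OF l _ e low] \<delta>(1) by simp
qed

subsection \<open>Reproducing kernels of the model space\<close>

definition ker :: "complex \<Rightarrow> L2_circle" where
  "ker z = szego z - cnj (disc_ext \<theta> z) *\<^sub>C mult_L2 \<theta> (szego z)"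

lemma ker_K: assumes z: "cmod z < 1" shows "ker z \<in> K"
proof -
  have H: "ker z \<in> Hardy2"
    unfolding ker_def by (intro Hardy2_intros szego_Hardy2 z Hinf_mult_Hardy2 \<theta>_Hinf)
  have "cinner_L2 (ker z) (tpow n) = 0" if "n \<ge> 0" for n
  proof -
    have "cinner_L2 (szego z) (tpow n) = cnj (ev z (tpow n))" by (simp add: ev_def cinner_L2_commute[of "szego z"])
    also have "ev z (tpow n) = disc_ext \<theta> z * ev z (zpow n)"
      unfolding tpow_def by (rule ev_mult_Hinf[OF \<theta>_Hinf zpow_Hardy2[OF that] z])
    finally have 1: "cinner_L2 (szego z) (tpow n) = cnj (disc_ext \<theta> z) * cnj (ev z (zpow n))" by simp
    have "cinner_L2 (mult_L2 \<theta> (szego z)) (tpow n) = cnj (ev z (zpow n))"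
      unfolding tpow_def cinner_unimodular_mult[OF \<theta>_unimodular] by (simp add: ev_def cinner_L2_commute[of "szego z"])
    then show ?thesis by (simp add: ker_def cinner_simps 1)
  qed
  then show ?thesis using H by (auto simp: K_iff Hardy2_iff)
qed

lemma cinner_ker: assumes z: "cmod z < 1" and h: "h \<in> K" shows "cinner_L2 h (ker z) = ev z h"
  using K_orth[OF h szego_Hardy2[OF z]] by (simp add: ker_def cinner_simps ev_def)

lemma norm_ker_sq:
  assumes z: "cmod z < 1"
  shows "(norm (ker z))\<^sup>2 = (1 - (cmod (disc_ext \<theta> z))\<^sup>2) / (1 - (cmod z)\<^sup>2)"
proof -
  let ?t = "disc_ext \<theta> z"
  have s: "ev z (szego z) = of_real (1 / (1 - (cmod z)\<^sup>2))"
    unfolding norm_szego_sq[OF z, symmetric] by (simp add: ev_def cinner_self_eq_norm)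
  have "of_real ((norm (ker z))\<^sup>2) = ev z (ker z)"
    using cinner_ker[OF z ker_K[OF z]] by (simp add: cinner_self_eq_norm)
  also have "\<dots> = (1 - ?t * cnj ?t) * ev z (szego z)"
    unfolding ker_def by (simp add: ev_simps ev_mult_Hinf[OF \<theta>_Hinf szego_Hardy2[OF z] z] algebra_simps)
  also have "\<dots> = of_real ((1 - (cmod ?t)\<^sup>2) * (1 / (1 - (cmod z)\<^sup>2)))"
    unfolding s complex_norm_square[symmetric] by (simp only: of_real_mult of_real_diff of_real_1)
  finally show ?thesis by (simp only: of_real_eq_iff) simp
qed

subsection \<open>Regular boundary points\<close>

text \<open>Near \<open>l\<close>, \<open>(\<zeta> - l) dq z\<close> differs from the bounded
  function \<open>\<theta> - \<theta>(z)\<close> by \<open>(z - l) dq z\<close>, a perturbation that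
  the lower estimate absorbs. The difference quotients thus stay bounded along the radius, and
  compactness supplies a limit value of \<theta>.\<close>

lemma not_spectrum_imp_ADC:
  assumes l: "cmod l = 1" and C: "C \<ge> 0" "\<And>f. f \<in> K \<Longrightarrow> norm f \<le> C * norm (Zop f - l *\<^sub>C f)"
  shows "l \<in> T_ADC \<theta>"
proof -
  define D where "D = C + 1"
  have D: "D > 0" "\<And>f. f \<in> K \<Longrightarrow> norm f \<le> D * norm (Zop f - l *\<^sub>C f)"
  proof -
    show "D > 0" using C(1) by (simp add: D_def)
    show "norm f \<le> D * norm (Zop f - l *\<^sub>C f)" if "f \<in> K" for f
      by (rule order_trans[OF C(2)[OF that]]) (auto simp: D_def intro!: mult_right_mono)
  qed
  \<comment> \<open>The symbol has norm at most 2, and half of \<open>norm (dq z)\<close> is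
    absorbed on the left, which gives \<open>4 * D\<close>.\<close>
  have dq_le: "norm (dq z) \<le> 4 * D" if z: "cmod z < 1" "D * cmod (z - l) \<le> 1 / 2" for z
  proof -
    have "Zop (dq z) - l *\<^sub>C dq z = (tpow 0 - disc_ext \<theta> z *\<^sub>C zpow 0) + (z - l) *\<^sub>C dq z"
      using Zop_dq[OF z(1)] by (simp add: scaleC_diff_left algebra_simps)
    then have "norm (Zop (dq z) - l *\<^sub>C dq z) \<le> norm (tpow 0 - disc_ext \<theta> z *\<^sub>C zpow 0) + cmod (z - l) * norm (dq z)"
      by (metis norm_triangle_ineq norm_scaleC)
    also have "norm (tpow 0 - disc_ext \<theta> z *\<^sub>C zpow 0) \<le> norm (tpow 0) + norm (disc_ext \<theta> z *\<^sub>C zpow 0)"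
      by (rule norm_triangle_ineq4)
    also have "\<dots> \<le> 2" using norm_disc_ext_le[OF z(1)] by (simp add: norm_scaleC)
    finally have "norm (Zop (dq z) - l *\<^sub>C dq z) \<le> 2 + cmod (z - l) * norm (dq z)" by simp
    then have "D * norm (Zop (dq z) - l *\<^sub>C dq z) \<le> D * (2 + cmod (z - l) * norm (dq z))" using D(1) by simp
    then have "norm (dq z) \<le> 2 * D + D * cmod (z - l) * norm (dq z)"
      using D(2)[OF dq_K[OF z(1)]] by (simp add: algebra_simps)
    also have "\<dots> \<le> 2 * D + 1 / 2 * norm (dq z)" using z(2) by (intro add_left_mono mult_right_mono) auto
    finally show ?thesis by simp
  qed
  define \<epsilon> where "\<epsilon> = min (1/2) (1 / (2 * D))"
  have \<epsilon>: "0 < \<epsilon>" "\<epsilon> \<le> 1/2" "D * \<epsilon> \<le> 1 / 2"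
  proof -
    show "0 < \<epsilon>" "\<epsilon> \<le> 1/2" using D(1) by (auto simp: \<epsilon>_def)
    have "D * \<epsilon> \<le> D * (1 / (2 * D))" using D(1) by (intro mult_left_mono) (auto simp: \<epsilon>_def)
    then show "D * \<epsilon> \<le> 1 / 2" using D(1) by simp
  qed
  define z where "z n = of_real (1 - \<epsilon> / real (Suc n)) * l" for n
  have small: "0 < \<epsilon> / real (Suc n)" "\<epsilon> / real (Suc n) \<le> \<epsilon>" for n
    using \<epsilon> by (auto simp: divide_le_eq)
  have z1: "cmod (z n) < 1" for n
    unfolding z_def norm_mult norm_of_real l using small[of n] \<epsilon> by simp
  have z2: "D * cmod (z n - l) \<le> 1 / 2" for n
  proof -
    have "z n - l = of_real (- (\<epsilon> / real (Suc n))) * l" by (simp add: z_def algebra_simps)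
    then have "cmod (z n - l) = \<bar>- (\<epsilon> / real (Suc n))\<bar> * cmod l" by (simp only: norm_mult norm_of_real)
    then have "cmod (z n - l) = \<epsilon> / real (Suc n)" using \<epsilon>(1) l by simp
    then have "D * cmod (z n - l) \<le> D * \<epsilon>" using small(2)[of n] D(1) by (intro mult_left_mono) auto
    then show ?thesis using \<epsilon>(3) by linarith
  qed
  have zlim: "z \<longlonglongrightarrow> l"
  proof -
    have "(\<lambda>n. of_real (1 - \<epsilon> * (1 / real (Suc n))) * l) \<longlonglongrightarrow> of_real (1 - \<epsilon> * 0) * l"
      by (intro tendsto_intros LIMSEQ_Suc[OF lim_1_over_n])
    then show ?thesis by (simp add: z_def[abs_def])
  qed
  have "\<forall>n. disc_ext \<theta> (z n) \<in> cball 0 1" using norm_disc_ext_le[OF z1] by simp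
  then obtain w k where wk: "strict_mono k" "((\<lambda>n. disc_ext \<theta> (z n)) \<circ> k) \<longlonglongrightarrow> w"
    using compact_cball[of "0::complex" 1] unfolding compact_def by metis
  have "\<exists>g. Zop g - l *\<^sub>C g = tpow 0 - w *\<^sub>C zpow 0"
  proof (rule dq_limit[OF l, where z = "z \<circ> k" and C = "4 * D"])
    show "(z \<circ> k) \<longlonglongrightarrow> l" by (rule LIMSEQ_subseq_LIMSEQ[OF zlim wk(1)])
    show "(\<lambda>n. disc_ext \<theta> ((z \<circ> k) n)) \<longlonglongrightarrow> w" using wk(2) by (simp add: o_def)
  qed (use z1 z2 dq_le in auto)
  then show ?thesis using boundary_quotient_imp_ADC[OF l] by blast
qed

end

context matrix_model
begin

text \<open>Away from the inner spectrum the lower estimate for \<open>\<zeta> - l\<close> on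
  \<open>K\<close> passes to pairs once the constants are eliminated; with the dense range this
  gives surjectivity.\<close>

lemma boundary_regular:
  assumes l: "cmod l = 1" and ns: "l \<notin> inner_spectrum \<theta>" and \<Delta>: "DeltaM (inner_value \<theta> l) \<noteq> 0"
  shows "l \<in> T_ADC \<theta> \<and> regular l"
proof -
  obtain C where C: "C \<ge> 0" "\<And>f. f \<in> K \<Longrightarrow> norm f \<le> C * norm (Zop f - l *\<^sub>C f)"
    using lower_estimate[OF l ns] by blast
  have adc: "l \<in> T_ADC \<theta>" by (rule not_spectrum_imp_ADC[OF l C])
  let ?w = "inner_value \<theta> l"
  obtain u where u: "Zop u - l *\<^sub>C u = tpow 0 - ?w *\<^sub>C zpow 0" using ADC_imp_boundary_quotient[OF adc] by blast
  have w1: "cmod ?w = 1" using circle_resolvent_dichotomy[OF l, of u 1 ?w] u by simp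
  then have ww: "?w * cnj ?w = 1" using complex_norm_square[of ?w] by simp
  have ll: "l * cnj l = 1" using l complex_norm_square[of l] by simp
  have l0: "l \<noteq> 0" using l by auto
  have uK: "u \<in> K" using resolvent_K[OF u, of "1 - ?w * cnj \<theta>0"] rhs_symbol[of 1 ?w] l by simp
  let ?q = "cnj ?w - cnj \<theta>0"
  have D: "1\<^sup>2 - \<alpha> * \<beta> * ?q\<^sup>2 \<noteq> 0"
  proof
    assume "1\<^sup>2 - \<alpha> * \<beta> * ?q\<^sup>2 = 0"
    then have "?w\<^sup>2 * (1 - \<alpha> * \<beta> * ?q\<^sup>2) = 0" by simp
    moreover have "?w\<^sup>2 * (1 - \<alpha> * \<beta> * ?q\<^sup>2) = ?w\<^sup>2 - \<alpha> * \<beta> * (?w * cnj ?w - cnj \<theta>0 * ?w)\<^sup>2"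
      by (simp add: power2_eq_square algebra_simps)
    ultimately show False using \<Delta> unfolding ww DeltaM_def by simp
  qed
  have a0: "cinner_L2 (zpow 0) u = l * ?q"
  proof -
    have "\<theta>0 - ?w = - l * cinner_L2 u (zpow 0)"
      using resolvent_coeff(1)[OF u, of 0] uK by (simp add: cinner_simps cinner_zpow_zpow \<theta>0_eq K_iff)
    then have "cnj l * (\<theta>0 - ?w) = - (l * cnj l) * cinner_L2 u (zpow 0)" by (simp add: mult.commute mult.left_commute)
    then have "cinner_L2 u (zpow 0) = cnj l * (?w - \<theta>0)" unfolding ll by (simp add: algebra_simps)
    then show ?thesis by (subst cinner_L2_commute) simp
  qed
  have tu: "cinner_L2 (tpow 0) u = 0" using uK by (subst cinner_L2_commute) (simp add: K_iff)
  \<comment> \<open>Unlike off the circle, pairing \<open>(\<zeta> - l) f\<close> with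
    \<open>u\<close> does not give zero but \<open>- l * c f\<close>, because the shift preserves
    inner products. Scaled by \<open>l\<close>, this is a system with \<open>p = 1\<close> and
    \<open>q = cnj w - cnj \<theta>(0)\<close>, whose determinant is \<open>DeltaM w / w^2\<close>
    for \<open>w = \<theta>(l)\<close>.\<close>
  have bb: "\<exists>C. \<forall>x\<in>KK. norm x \<le> C * norm (Lop l x)"
  proof (rule matrix_bounded_below[OF C D])
    fix f h b assume f: "f \<in> K" and eq: "Zop f - l *\<^sub>C f = h + c f *\<^sub>C tpow 0 - b *\<^sub>C k0"
    have Zu: "Zop u = l *\<^sub>C u + tpow 0 - ?w *\<^sub>C zpow 0" using u by (simp add: algebra_simps)
    have "cinner_L2 f u = cinner_L2 (Zop f) (Zop u)" by (rule cinner_unimodular_mult[OF unimodular_id, symmetric])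
    also have "\<dots> = cnj l * cinner_L2 (Zop f) u + c f"
      unfolding Zu using f by (simp add: cinner_simps cinner_Zop_tpow cinner_Zop_zpow K_iff)
    finally have "l * cinner_L2 f u = (l * cnj l) * cinner_L2 (Zop f) u + l * c f" by (simp add: algebra_simps)
    then have 1: "cinner_L2 (Zop f - l *\<^sub>C f) u = - l * c f" unfolding ll by (simp add: cinner_simps)
    have "cinner_L2 (Zop f - l *\<^sub>C f) u = cinner_L2 h u - b * (l * ?q)"
      unfolding eq by (simp add: cinner_simps tu cinner_k0 a0)
    then have 2: "cinner_L2 h u = l * (b * ?q - c f)" using 1 by (simp add: algebra_simps)
    have "cinner_L2 h (l *\<^sub>C u) = (l * cnj l) * (b * ?q - c f)" by (simp add: cinner_simps 2)
    then show "c f * 1 - b * ?q = - cinner_L2 h (l *\<^sub>C u)" unfolding ll by simp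
  qed
  then obtain C' where C': "\<And>x. x \<in> KK \<Longrightarrow> norm x \<le> C' * norm (Lop l x)" by blast
  have "\<not> eigen l" using circle_eigen_iff[OF l] \<Delta> by blast
  have "Lop l ` KK = KK"
  proof (rule bounded_below_dense_imp_surj[OF closed_KK bounded_linear_Lop _ _ C'])
    show "Lop l ` KK \<subseteq> KK" by (rule Lop_image_subset)
    show "KK \<subseteq> closure (Lop l ` KK)" by (rule circle_dense[OF l \<open>\<not> eigen l\<close>])
  qed (rule KK_diff)
  then have "regular l" by (intro regularI[OF C']) auto
  then show ?thesis using adc by blast
qed

text \<open>If the range were everything, the normalised kernels at points approaching \<open>l\<close> along which
  \<open>\<theta>\<close> tends to \<open>0\<close> would be pointwise bounded although their norms are not.\<close>

lemma spectrum_not_surj: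
  assumes l: "cmod l = 1" and sp: "l \<in> inner_spectrum \<theta>"
  shows "Lop l ` KK \<noteq> KK"
proof
  assume surj: "Lop l ` KK = KK"
  have "\<exists>z. cmod z < 1 \<and> cmod (z - l) < 1 / real (Suc n) \<and> cmod (disc_ext \<theta> z) < 1 / 2" for n
  proof (rule ccontr)
    assume "\<not> ?thesis"
    then have "1 / 2 \<le> cmod (disc_ext \<theta> z)" if "cmod z < 1" "cmod (z - l) < 1 / real (Suc n)" for z
      using that by (meson not_less)
    then have "\<forall>\<^sub>F z in at l within ball 0 1. ereal (1/2) \<le> ereal (norm (disc_ext \<theta> z))"
      unfolding eventually_at by (intro exI[of _ "1 / real (Suc n)"]) (auto simp: dist_norm not_less)
    then have "ereal (1/2) \<le> Liminf (at l within ball 0 1) (\<lambda>z. ereal (norm (disc_ext \<theta> z)))"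
      by (rule Liminf_bounded)
    then show False using sp by (simp add: inner_spectrum_def)
  qed
  then obtain z where z: "\<And>n. cmod (z n) < 1" "\<And>n. cmod (z n - l) < 1 / real (Suc n)" "\<And>n. cmod (disc_ext \<theta> (z n)) < 1 / 2"
    by metis
  define N where "N n = norm (ker (z n))" for n
  have Nsq: "(N n)\<^sup>2 * (1 - (cmod (z n))\<^sup>2) = 1 - (cmod (disc_ext \<theta> (z n)))\<^sup>2" for n
  proof -
    have "(cmod (z n))\<^sup>2 < 1" using z(1) by (simp add: abs_square_less_1)
    then show ?thesis using norm_ker_sq[OF z(1)[of n]] by (simp add: N_def)
  qed
  \<comment> \<open>The value 1/2 keeps the numerator of the squared kernel norm at least 3/4, while
    \<open>1 - |z|\<close> is at most the distance to \<open>l\<close>.\<close>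
  have N2: "1 / 4 \<le> (N n)\<^sup>2 * (1 / real (Suc n))" for n
  proof -
    have "(cmod (disc_ext \<theta> (z n)))\<^sup>2 \<le> (1/2)\<^sup>2" using z(3)[of n] by (intro power_mono) auto
    then have "3 / 4 \<le> (N n)\<^sup>2 * (1 - (cmod (z n))\<^sup>2)" unfolding Nsq by (simp add: power_divide)
    also have "1 - (cmod (z n))\<^sup>2 = (1 - cmod (z n)) * (1 + cmod (z n))" by (simp add: power2_eq_square algebra_simps)
    also have "(N n)\<^sup>2 * ((1 - cmod (z n)) * (1 + cmod (z n))) \<le> (N n)\<^sup>2 * (1 / real (Suc n) * 2)"
    proof (intro mult_left_mono mult_mono)
      have "1 - cmod (z n) \<le> cmod (z n - l)" using norm_triangle_ineq2[of l "z n"] l by (simp add: norm_minus_commute)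
      then show "1 - cmod (z n) \<le> 1 / real (Suc n)" using z(2)[of n] by linarith
    qed (use z(1)[of n] in auto)
    finally have "3 / 4 \<le> (N n)\<^sup>2 * (1 / real (Suc n)) * 2" by (simp only: mult.assoc)
    then show ?thesis by linarith
  qed
  have Npos: "N n > 0" for n
  proof (rule ccontr)
    assume "\<not> N n > 0"
    then have "N n = 0" using norm_ge_zero by (simp add: N_def)
    then show False using N2[of n] by simp
  qed
  \<comment> \<open>The two summands match the two parts of \<open>ev (z n) h\<close>: the first
    bounds \<open>(z - l) ev z f\<close> by \<open>\<epsilon> n * N n * norm f\<close>, the second
    makes \<open>N n * \<epsilon> n \<ge> 1\<close> so that the constant terms are absorbed. The
    vectors \<open>w n\<close> then have norm \<open>1 / \<epsilon> n\<close>, which is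
    unbounded.\<close>
  define \<epsilon> where "\<epsilon> n = cmod (z n - l) + 1 / N n" for n
  have \<epsilon>: "\<epsilon> n > 0" "cmod (z n - l) \<le> \<epsilon> n" "1 / N n \<le> \<epsilon> n" for n
    using Npos[of n] by (auto simp: \<epsilon>_def add_nonneg_pos)
  define w where "w n = (1 / (N n * \<epsilon> n)) *\<^sub>R ker (z n)" for n
  have wK: "w n \<in> K" for n unfolding w_def by (intro subspace_scale[OF subspace_K] ker_K z)
  have "\<exists>B. \<forall>n. norm (w n) \<le> B"
  proof (rule uniform_boundedness_inner[OF closed_K subspace_K wK])
    fix h assume h: "h \<in> K"
    then have "(h, 0) \<in> Lop l ` KK" using surj K_intros(1) by simp
    then obtain f g where fg: "f \<in> K" "g \<in> K" "Lop l (f, g) = (h, 0)" by force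
    have eq: "Zop f - l *\<^sub>C f = h + c f *\<^sub>C tpow 0 - (\<alpha> * c g) *\<^sub>C k0"
      using fg(3) by (simp add: Lop_def Tc_eq_iff)
    define B where "B = norm f + cmod (c f) + cmod (\<alpha> * c g) * (1 + cmod \<theta>0)"
    have "\<bar>inner h (w n)\<bar> \<le> B" for n
    proof -
      let ?z = "z n"
      have fK: "cinner_L2 f (zpow (-1)) = 0" using fg(1) by (simp add: K_iff)
      have "ev ?z h = ev ?z (Zop f - l *\<^sub>C f) - c f * disc_ext \<theta> ?z + \<alpha> * c g * (1 - cnj \<theta>0 * disc_ext \<theta> ?z)"
        unfolding eq by (simp add: ev_simps k0_def ev_tpow_0 ev_zpow z)
      also have "ev ?z (Zop f - l *\<^sub>C f) = (?z - l) * ev ?z f" by (simp add: ev_simps ev_Zop z fK algebra_simps)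
      finally have evh: "ev ?z h = (?z - l) * ev ?z f - c f * disc_ext \<theta> ?z + \<alpha> * c g * (1 - cnj \<theta>0 * disc_ext \<theta> ?z)" .
      have evf: "cmod (ev ?z f) \<le> norm f * N n"
        using cinner_Cauchy_Schwarz[of f "ker ?z"] by (simp add: cinner_ker[OF z(1) fg(1)] N_def)
      have t1: "cmod (disc_ext \<theta> ?z) \<le> 1" using z(3)[of n] by simp
      have "cmod (ev ?z h) \<le> cmod ((?z - l) * ev ?z f) + cmod (c f * disc_ext \<theta> ?z) + cmod (\<alpha> * c g * (1 - cnj \<theta>0 * disc_ext \<theta> ?z))"
        unfolding evh by (intro order_trans[OF norm_triangle_ineq] add_mono norm_triangle_ineq4 order_refl)
      also have "\<dots> \<le> \<epsilon> n * (norm f * N n) + cmod (c f) * 1 + cmod (\<alpha> * c g) * (1 + cmod \<theta>0)"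
      proof (intro add_mono)
        show "cmod ((?z - l) * ev ?z f) \<le> \<epsilon> n * (norm f * N n)"
          unfolding norm_mult using \<epsilon>[of n] evf by (intro mult_mono) auto
        show "cmod (c f * disc_ext \<theta> ?z) \<le> cmod (c f) * 1"
          unfolding norm_mult using t1 by (intro mult_left_mono) auto
        have "cmod (1 - cnj \<theta>0 * disc_ext \<theta> ?z) \<le> 1 + cmod \<theta>0 * 1"
          using norm_triangle_ineq4[of 1 "cnj \<theta>0 * disc_ext \<theta> ?z"] mult_left_mono[OF t1, of "cmod \<theta>0"] by (simp add: norm_mult)
        then show "cmod (\<alpha> * c g * (1 - cnj \<theta>0 * disc_ext \<theta> ?z)) \<le> cmod (\<alpha> * c g) * (1 + cmod \<theta>0)"
          unfolding norm_mult[of "\<alpha> * c g"] by (intro mult_left_mono) auto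
      qed
      also have "\<dots> \<le> \<epsilon> n * (norm f * N n) + (N n * \<epsilon> n) * cmod (c f) + (N n * \<epsilon> n) * (cmod (\<alpha> * c g) * (1 + cmod \<theta>0))"
      proof -
        have one: "1 \<le> N n * \<epsilon> n" using \<epsilon>(3)[of n] Npos[of n] by (simp add: field_simps)
        have "1 * X \<le> (N n * \<epsilon> n) * X" if "X \<ge> 0" for X using one that by (intro mult_right_mono) auto
        from this[of "cmod (c f)"] this[of "cmod (\<alpha> * c g) * (1 + cmod \<theta>0)"] show ?thesis by simp
      qed
      finally have evB: "cmod (ev ?z h) \<le> (N n * \<epsilon> n) * B" by (simp add: B_def algebra_simps)
      have "\<bar>inner h (w n)\<bar> = \<bar>Re (ev ?z h)\<bar> / (N n * \<epsilon> n)"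
        using Npos[of n] \<epsilon>(1)[of n] by (simp add: w_def abs_mult Re_cinner[of h "ker ?z", symmetric] cinner_ker[OF z(1) h])
      also have "\<dots> \<le> (N n * \<epsilon> n) * B / (N n * \<epsilon> n)"
        using evB abs_Re_le_cmod[of "ev ?z h"] Npos[of n] \<epsilon>(1)[of n] by (intro divide_right_mono) auto
      finally show ?thesis using Npos[of n] \<epsilon>(1)[of n] by simp
    qed
    then show "\<exists>B. \<forall>n. \<bar>inner h (w n)\<bar> \<le> B" by blast
  qed
  then obtain B where B: "\<And>n. norm (w n) \<le> B" by blast
  have "norm (w n) = 1 / \<epsilon> n" for n
    using Npos[of n] \<epsilon>(1)[of n] by (simp add: w_def N_def[symmetric])
  then have lowb: "1 \<le> B * \<epsilon> n" for n using B[of n] \<epsilon>(1)[of n] by (simp add: divide_le_eq)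
  have "\<epsilon> \<longlonglongrightarrow> 0"
  proof (rule Lim_null_comparison)
    show "\<forall>\<^sub>F n in sequentially. norm (\<epsilon> n) \<le> 1 / real (Suc n) + 2 * sqrt (1 / real (Suc n))"
    proof (intro always_eventually allI)
      fix n
      have "1 / (N n)\<^sup>2 \<le> 4 * (1 / real (Suc n))" using N2[of n] Npos[of n] by (simp add: field_simps)
      then have "(1 / N n)\<^sup>2 \<le> 4 * (1 / real (Suc n))" by (simp add: power_divide)
      then have "1 / N n \<le> sqrt (4 * (1 / real (Suc n)))" by (rule real_le_rsqrt)
      also have "\<dots> = 2 * sqrt (1 / real (Suc n))" by (simp only: real_sqrt_mult) simp
      finally show "norm (\<epsilon> n) \<le> 1 / real (Suc n) + 2 * sqrt (1 / real (Suc n))"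
        using z(2)[of n] \<epsilon>(1)[of n] by (simp add: \<epsilon>_def)
    qed
    have "(\<lambda>n. 1 / real (Suc n) + 2 * sqrt (1 / real (Suc n))) \<longlonglongrightarrow> 0 + 2 * sqrt 0"
      by (intro tendsto_intros LIMSEQ_Suc[OF lim_1_over_n])
    then show "(\<lambda>n. 1 / real (Suc n) + 2 * sqrt (1 / real (Suc n))) \<longlonglongrightarrow> 0" by simp
  qed
  then have "(\<lambda>n. B * \<epsilon> n) \<longlonglongrightarrow> B * 0" by (intro tendsto_intros)
  then have "1 \<le> B * 0" by (rule LIMSEQ_le_const) (use lowb in auto)
  then show False by simp
qed

end

section \<open>The dual-band shift\<close>

text \<open>Against \<open>u\<close> in \<open>K\<close> the part \<open>P \<theta>\<close> is
  invisible, and the other part moves to \<open>\<theta> a\<close> with \<open>a = cnj Q u\<close>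
  in the Hardy space. This is orthogonal to \<open>K\<close>, and from the shifted \<open>f\<close>
  it sees only the coefficient that has just left \<open>K\<close>. The symbol \<open>s\<close> is
  general so that a quotient of the multipliers and its conjugate are both covered.\<close>

lemma (in inner_function) symbol_compression:
  assumes P: "P \<in> Hinf" and Q: "(\<lambda>z. cnj (Q z)) \<in> Hinf" and s: "s \<in> Linf_fun"
    and sym: "AE z in circle_measure. s z = Q z * cnj (\<theta> z) + P z * \<theta> z"
    and f: "f \<in> K" and u: "u \<in> K"
  shows "cinner_L2 (mult_L2 s f) u = 0"
    and "cinner_L2 (mult_L2 s (Zop f)) u = cnj (disc_ext (\<lambda>z. cnj (Q z)) 0) * c f * cinner_L2 k0 u"
proof -
  note PL = Hinf_Linf[OF P] and QL' = Hinf_Linf[OF Q] and tL = \<theta>_Linf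
  have QL: "Q \<in> Linf_fun" using Linf_fun_cnj[OF QL'] by simp
  define a where "a = mult_L2 (\<lambda>z. cnj (Q z)) u"
  have a: "a \<in> Hardy2" unfolding a_def by (intro Hinf_mult_Hardy2 Q K_Hardy2 u)
  have red: "cinner_L2 (mult_L2 s x) u = cinner_L2 x (mult_L2 \<theta> a)" if x: "x \<in> Hardy2" for x
  proof -
    have "mult_L2 s x = mult_L2 (\<lambda>z. Q z * cnj (\<theta> z) + P z * \<theta> z) x"
      by (rule mult_L2_cong[OF s _ sym]) (intro Linf_fun_intros QL PL tL)
    also have "\<dots> = mult_L2 Q (mult_L2 (\<lambda>z. cnj (\<theta> z)) x) + mult_L2 P (mult_L2 \<theta> x)"
      by (simp add: mult_L2_add_symbol mult_L2_mult Linf_fun_mult Linf_fun_cnj QL PL tL)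
    finally have "cinner_L2 (mult_L2 s x) u = cinner_L2 x (mult_L2 \<theta> a) + cinner_L2 (mult_L2 \<theta> (mult_L2 P x)) u"
      using mult_L2_commute[OF PL tL, of x]
      by (simp add: cinner_simps a_def cinner_mult_left[OF QL] cinner_mult_left[OF Linf_fun_cnj[OF tL]])
    moreover have "cinner_L2 (mult_L2 \<theta> (mult_L2 P x)) u = 0"
      using K_orth[OF u Hinf_mult_Hardy2[OF P x]] by (subst cinner_L2_commute) simp
    ultimately show ?thesis by simp
  qed
  show "cinner_L2 (mult_L2 s f) u = 0"
    using red[OF K_Hardy2[OF f]] K_orth[OF f a] by simp
  \<comment> \<open>Only the constant term of \<open>a\<close> contributes: \<open>Zop f\<close>
    against \<open>tpow n\<close> is \<open>f\<close> against \<open>tpow (n - 1)\<close>, zero for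
    \<open>n \<ge> 1\<close>.\<close>
  have "a \<in> {a. cinner_L2 (mult_L2 \<theta> a) (Zop f) = cinner_L2 a (zpow 0) * cnj (c f)}"
    using a
  proof (induction rule: Hardy2_induct)
    case closed
    show ?case
      by (intro closed_Collect_eq continuous_intros bounded_linear.continuous_on[OF bounded_linear_mult_L2[OF tL]])
  next
    case (monomial n)
    have "cinner_L2 (mult_L2 \<theta> (zpow n)) (Zop f) = cnj (cinner_L2 f (tpow (n - 1)))"
      unfolding tpow_def[symmetric] cinner_Zop_tpow[symmetric] by (rule cinner_L2_commute)
    then show ?case using monomial f by (auto simp: K_iff cinner_zpow_zpow)
  qed (auto simp: mult_L2_simps cinner_simps algebra_simps)
  then have "cinner_L2 (Zop f) (mult_L2 \<theta> a) = c f * cnj (cinner_L2 a (zpow 0))"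
    by (subst cinner_L2_commute) simp
  also have "cinner_L2 a (zpow 0) = disc_ext (\<lambda>z. cnj (Q z)) 0 * cinner_L2 u (zpow 0)"
    using ev_mult_Hinf[OF Q K_Hardy2[OF u], of 0] by (simp add: a_def ev_zero)
  also have "cnj (disc_ext (\<lambda>z. cnj (Q z)) 0 * cinner_L2 u (zpow 0)) = cnj (disc_ext (\<lambda>z. cnj (Q z)) 0) * cinner_L2 k0 u"
    using u cinner_L2_commute[of "zpow 0" u] cinner_L2_commute[of "tpow 0" u] by (simp add: k0_def cinner_simps K_iff)
  finally show "cinner_L2 (mult_L2 s (Zop f)) u = cnj (disc_ext (\<lambda>z. cnj (Q z)) 0) * c f * cinner_L2 k0 u"
    using red[OF Zop_Hardy2[OF K_Hardy2[OF f]]] by simp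
qed

locale dual_band = inner_function +
  fixes \<phi> \<psi> Ap Am :: "complex \<Rightarrow> complex"
  assumes \<phi>: "unimodular \<phi>" and \<psi>: "unimodular \<psi>"
    and Ap: "Ap \<in> Hinf" and Am: "(\<lambda>z. cnj (Am z)) \<in> Hinf"
    and symbol: "AE z in circle_measure. cnj (\<psi> z) * \<phi> z = Am z * cnj (\<theta> z) + Ap z * \<theta> z"
begin

sublocale matrix_model \<theta> "cnj (disc_ext Ap 0)" "cnj (disc_ext (\<lambda>z. cnj (Am z)) 0)"
  by unfold_locales

definition W :: "L2_circle \<times> L2_circle \<Rightarrow> L2_circle" where
  "W x = mult_L2 \<phi> (fst x) + mult_L2 \<psi> (snd x)"

abbreviation M :: "L2_circle set" where "M \<equiv> dual_band_space \<phi> \<psi> \<theta>"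
abbreviation S :: "L2_circle \<Rightarrow> L2_circle" where "S \<equiv> compressed_shift M"

lemma M_eq: "M = W ` KK"
  by (force simp: dual_band_space_def W_def)

lemma \<phi>L: "\<phi> \<in> Linf_fun" and \<psi>L: "\<psi> \<in> Linf_fun"
  using \<phi> \<psi> by (auto simp: unimodular_Linf)

lemma cross:
  assumes f: "f \<in> K" and u: "u \<in> K"
  shows "cinner_L2 (mult_L2 \<phi> f) (mult_L2 \<psi> u) = 0"
    "cinner_L2 (mult_L2 \<psi> f) (mult_L2 \<phi> u) = 0"
    "cinner_L2 (Zop (mult_L2 \<phi> f)) (mult_L2 \<psi> u) = cnj (disc_ext (\<lambda>z. cnj (Am z)) 0) * c f * cinner_L2 k0 u"
    "cinner_L2 (Zop (mult_L2 \<psi> f)) (mult_L2 \<phi> u) = cnj (disc_ext Ap 0) * c f * cinner_L2 k0 u"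
proof -
  have L: "(\<lambda>z. cnj (\<psi> z) * \<phi> z) \<in> Linf_fun" "(\<lambda>z. cnj (\<phi> z) * \<psi> z) \<in> Linf_fun"
    by (intro Linf_fun_intros \<phi>L \<psi>L)+
  have 1: "cinner_L2 (mult_L2 \<phi> x) (mult_L2 \<psi> u) = cinner_L2 (mult_L2 (\<lambda>z. cnj (\<psi> z) * \<phi> z) x) u" for x
    by (simp add: cinner_mult_right[OF \<psi>L] mult_L2_mult Linf_fun_cnj \<phi>L \<psi>L)
  have 2: "cinner_L2 (mult_L2 \<psi> x) (mult_L2 \<phi> u) = cinner_L2 (mult_L2 (\<lambda>z. cnj (\<phi> z) * \<psi> z) x) u" for x
    by (simp add: cinner_mult_right[OF \<phi>L] mult_L2_mult Linf_fun_cnj \<phi>L \<psi>L)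
  \<comment> \<open>Conjugation exchanges the roles of \<open>Ap\<close> and \<open>Am\<close>, so
    one computation yields both off-diagonal entries.\<close>
  have symbol': "AE z in circle_measure. cnj (\<phi> z) * \<psi> z = cnj (Ap z) * cnj (\<theta> z) + cnj (Am z) * \<theta> z"
    using symbol
  proof eventually_elim
    case (elim z)
    have "cnj (cnj (\<psi> z) * \<phi> z) = cnj (Am z * cnj (\<theta> z) + Ap z * \<theta> z)" using elim by simp
    then show ?case by (simp add: mult.commute add.commute)
  qed
  have Ap': "(\<lambda>z. cnj (cnj (Ap z))) \<in> Hinf" using Ap by simp
  show "cinner_L2 (mult_L2 \<phi> f) (mult_L2 \<psi> u) = 0"
    unfolding 1 by (rule symbol_compression(1)[OF Ap Am L(1) symbol f u])
  show "cinner_L2 (mult_L2 \<psi> f) (mult_L2 \<phi> u) = 0"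
    unfolding 2 by (rule symbol_compression(1)[OF Am Ap' L(2) symbol' f u])
  show "cinner_L2 (Zop (mult_L2 \<phi> f)) (mult_L2 \<psi> u) = cnj (disc_ext (\<lambda>z. cnj (Am z)) 0) * c f * cinner_L2 k0 u"
    unfolding mult_L2_commute[OF Linf_fun_id \<phi>L] 1 by (rule symbol_compression(2)[OF Ap Am L(1) symbol f u])
  show "cinner_L2 (Zop (mult_L2 \<psi> f)) (mult_L2 \<phi> u) = cnj (disc_ext Ap 0) * c f * cinner_L2 k0 u"
    unfolding mult_L2_commute[OF Linf_fun_id \<psi>L] 2
    using symbol_compression(2)[OF Am Ap' L(2) symbol' f u] by simp
qed

section \<open>Isometric equivalence with the matrix model\<close>

lemma W_diff: "W x - W y = W (x - y)" and W_scale: "W (d *\<^sub>C f, d *\<^sub>C g) = d *\<^sub>C W (f, g)"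
  by (simp_all add: W_def mult_L2_simps scaleC_add_right)

lemma cinner_W:
  assumes "x \<in> KK" "y \<in> KK"
  shows "cinner_L2 (W x) (W y) = cinner_L2 (fst x) (fst y) + cinner_L2 (snd x) (snd y)"
  using assms by (auto simp: W_def cinner_simps cross cinner_unimodular_mult[OF \<phi>] cinner_unimodular_mult[OF \<psi>])

lemma norm_W: assumes "x \<in> KK" shows "norm (W x) = norm x"
proof -
  have "(norm (W x))\<^sup>2 = (norm (fst x))\<^sup>2 + (norm (snd x))\<^sup>2"
    unfolding norm_L2_sq cinner_W[OF assms assms] by simp
  then show ?thesis by (metis norm_prod_def norm_ge_zero real_sqrt_unique)
qed

lemma inj_on_W: "inj_on W KK"
proof (rule inj_onI)
  fix x y assume xy: "x \<in> KK" "y \<in> KK" "W x = W y"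
  then have "norm (x - y) = 0" using norm_W[OF KK_diff[OF xy(1,2)]] W_diff[of x y] by simp
  then show "x = y" by simp
qed

text \<open>The definite description in \<open>orth_proj\<close> is evaluated by exhibiting the
  projection: the cross terms make the residual orthogonal to \<open>M\<close>, and two candidates
  differ by a vector of \<open>M\<close> orthogonal to itself.\<close>

lemma S_W:
  assumes x: "x \<in> KK" shows "S (W x) = W (Lop 0 x)"
  unfolding compressed_shift_def orth_proj_def
proof (rule the_equality)
  obtain f g where fg: "x = (f, g)" "f \<in> K" "g \<in> K" using x by auto
  have LM: "W (Lop 0 x) \<in> M" unfolding M_eq by (intro imageI Lop_KK x)
  have orth: "cinner_L2 (Zop (W x) - W (Lop 0 x)) h = 0" if h: "h \<in> M" for h
  proof -
    obtain u v where uv: "h = W (u, v)" "u \<in> K" "v \<in> K" using h unfolding M_eq by auto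
    have t: "cinner_L2 (tpow 0) u = 0" "cinner_L2 (tpow 0) v = 0"
      using uv cinner_L2_commute[of "tpow 0" u] cinner_L2_commute[of "tpow 0" v] by (auto simp: K_iff)
    have same: "cinner_L2 (Zop (mult_L2 s y)) (mult_L2 s y') = cinner_L2 (Zop y) y'" if "unimodular s" for s y y'
      unfolding mult_L2_commute[OF Linf_fun_id unimodular_Linf[OF that]] by (rule cinner_unimodular_mult[OF that])
    have "cinner_L2 (Zop (W x)) h = cinner_L2 (Zop f) u + cnj (disc_ext Ap 0) * c g * cinner_L2 k0 u
        + (cinner_L2 (Zop g) v + cnj (disc_ext (\<lambda>z. cnj (Am z)) 0) * c f * cinner_L2 k0 v)"
      using fg uv by (simp add: W_def mult_L2_add cinner_simps cross same[OF \<phi>] same[OF \<psi>])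
    moreover have "cinner_L2 (W (Lop 0 x)) h = cinner_L2 (Zop f) u + cnj (disc_ext Ap 0) * c g * cinner_L2 k0 u
        + (cinner_L2 (Zop g) v + cnj (disc_ext (\<lambda>z. cnj (Am z)) 0) * c f * cinner_L2 k0 v)"
      using cinner_W[OF Lop_KK[OF x], of "(u, v)" 0] uv fg
      by (simp add: Lop_def Tc_def cinner_simps t)
    ultimately show ?thesis by (simp add: cinner_simps)
  qed
  show "W (Lop 0 x) \<in> M \<and> (\<forall>h\<in>M. cinner_L2 (Zop (W x) - W (Lop 0 x)) h = 0)" using LM orth by blast
  fix y assume y: "y \<in> M \<and> (\<forall>h\<in>M. cinner_L2 (Zop (W x) - y) h = 0)"
  have d: "y - W (Lop 0 x) \<in> M"
    using y LM unfolding M_eq by (auto simp: W_diff intro!: imageI K_intros)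
  have "cinner_L2 (y - W (Lop 0 x)) (y - W (Lop 0 x))
     = cinner_L2 (Zop (W x) - W (Lop 0 x)) (y - W (Lop 0 x)) - cinner_L2 (Zop (W x) - y) (y - W (Lop 0 x))"
    by (simp add: cinner_simps)
  also have "\<dots> = 0" using orth[OF d] y d by simp
  finally show "y = W (Lop 0 x)" by simp
qed

lemma S_diff_W:
  assumes x: "x \<in> KK" shows "S (W x) - \<mu> *\<^sub>C W x = W (Lop \<mu> x)"
proof -
  have "W (Lop 0 x) - \<mu> *\<^sub>C W x = W (Lop 0 x - (\<mu> *\<^sub>C fst x, \<mu> *\<^sub>C snd x))"
    unfolding W_diff[symmetric] W_scale by simp
  then show ?thesis unfolding S_W[OF x] by (simp add: Lop_def)
qed

lemma image_S: "(\<lambda>f. S f - \<mu> *\<^sub>C f) ` M = W ` (Lop \<mu> ` KK)"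
proof -
  have "(\<lambda>f. S f - \<mu> *\<^sub>C f) ` M = (\<lambda>f. S f - \<mu> *\<^sub>C f) ` W ` KK" by (simp only: M_eq)
  also have "\<dots> = (\<lambda>x. W (Lop \<mu> x)) ` KK"
    unfolding image_image by (rule image_cong[OF refl]) (rule S_diff_W)
  finally show ?thesis by (simp only: image_image)
qed

lemma inj_on_S_iff: "inj_on (\<lambda>f. S f - \<mu> *\<^sub>C f) M \<longleftrightarrow> \<not> eigen \<mu>"
proof -
  have "inj_on (\<lambda>f. S f - \<mu> *\<^sub>C f) M \<longleftrightarrow> inj_on (\<lambda>f. S f - \<mu> *\<^sub>C f) (W ` KK)" by (simp only: M_eq)
  also have "\<dots> \<longleftrightarrow> inj_on (\<lambda>x. S (W x) - \<mu> *\<^sub>C W x) KK"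
    using comp_inj_on_iff[OF inj_on_W, of "\<lambda>f. S f - \<mu> *\<^sub>C f"] by (simp only: o_def)
  also have "\<dots> \<longleftrightarrow> inj_on (\<lambda>x. W (Lop \<mu> x)) KK" by (intro inj_on_cong S_diff_W)
  also have "\<dots> \<longleftrightarrow> inj_on (Lop \<mu>) KK"
  proof -
    have "inj_on W (Lop \<mu> ` KK)" by (rule inj_on_subset[OF inj_on_W Lop_image_subset])
    then show ?thesis using inj_on_imageI2[of W "Lop \<mu>" KK] comp_inj_on[of "Lop \<mu>" KK W] by (auto simp: o_def)
  qed
  finally show ?thesis by (simp add: inj_on_Lop_iff)
qed

lemma surj_S_iff: "(\<lambda>f. S f - \<mu> *\<^sub>C f) ` M = M \<longleftrightarrow> Lop \<mu> ` KK = KK"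
  unfolding image_S unfolding M_eq by (rule inj_on_image_eq_iff[OF inj_on_W Lop_image_subset order_refl])

lemma dense_S:
  assumes "KK \<subseteq> closure (Lop \<mu> ` KK)" shows "M \<subseteq> closure ((\<lambda>f. S f - \<mu> *\<^sub>C f) ` M)"
proof
  fix y assume "y \<in> M"
  then have "y \<in> W ` KK" by (simp only: M_eq)
  then obtain x where x: "x \<in> KK" "y = W x" by (elim imageE)
  have "x \<in> closure (Lop \<mu> ` KK)" by (rule subsetD[OF assms x(1)])
  then obtain s where "(\<forall>n. s n \<in> Lop \<mu> ` KK) \<and> s \<longlonglongrightarrow> x"
    unfolding closure_sequential by (elim exE)
  note s = this[THEN conjunct1, rule_format] this[THEN conjunct2]
  have sK: "s n \<in> KK" for n by (rule subsetD[OF Lop_image_subset s(1)])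
  have "(\<lambda>n. W (s n)) \<longlonglongrightarrow> y"
  proof (rule LIM_zero_cancel, rule tendsto_norm_zero_cancel)
    have "norm (W (s n) - y) = norm (s n - x)" for n
      unfolding x(2) W_diff by (rule norm_W[OF KK_diff[OF sK x(1)]])
    moreover have "(\<lambda>n. norm (s n - x)) \<longlonglongrightarrow> 0" using s(2) by (intro tendsto_norm_zero LIM_zero)
    ultimately show "(\<lambda>n. norm (W (s n) - y)) \<longlonglongrightarrow> 0" by simp
  qed
  moreover have "\<forall>n. W (s n) \<in> (\<lambda>f. S f - \<mu> *\<^sub>C f) ` M" unfolding image_S using s(1) by blast
  ultimately show "y \<in> closure ((\<lambda>f. S f - \<mu> *\<^sub>C f) ` M)"
    unfolding closure_sequential by (intro exI[of _ "\<lambda>n. W (s n)"] conjI)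
qed

lemma point_spectrum_iff: "\<mu> \<in> point_spectrum M S \<longleftrightarrow> eigen \<mu>"
proof -
  have "\<mu> \<in> point_spectrum M S \<longleftrightarrow> (\<exists>x\<in>KK. W x \<noteq> 0 \<and> S (W x) - \<mu> *\<^sub>C W x = 0)"
    by (auto simp: point_spectrum_def M_eq)
  also have "\<dots> \<longleftrightarrow> (\<exists>x\<in>KK. x \<noteq> 0 \<and> Lop \<mu> x = 0)"
  proof (rule bex_cong[OF refl])
    fix x assume x: "x \<in> KK"
    have z: "W y = 0 \<longleftrightarrow> y = 0" if "y \<in> KK" for y using norm_W[OF that] by (metis norm_eq_zero)
    show "(W x \<noteq> 0 \<and> S (W x) - \<mu> *\<^sub>C W x = 0) = (x \<noteq> 0 \<and> Lop \<mu> x = 0)"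
      unfolding S_diff_W[OF x] z[OF x] z[OF Lop_KK[OF x]] ..
  qed
  finally show ?thesis by (simp add: eigen_def)
qed

section \<open>Reading off the spectra\<close>

lemma regular_spectra:
  assumes "regular \<mu>"
  shows "\<mu> \<notin> op_spectrum M S" "\<mu> \<notin> continuous_spectrum M S" "\<not> eigen \<mu>"
proof -
  have inj: "\<not> eigen \<mu>" and surj: "Lop \<mu> ` KK = KK"
    using assms by (auto simp: regular_def bij_betw_def inj_on_Lop_iff)
  obtain C where C: "\<And>x. x \<in> KK \<Longrightarrow> norm x \<le> C * norm (Lop \<mu> x)" using assms by (auto simp: regular_def)
  have "norm f \<le> C * norm (S f - \<mu> *\<^sub>C f)" if "f \<in> M" for f
  proof -
    have "f \<in> W ` KK" using that by (simp only: M_eq)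
    then obtain x where x: "x \<in> KK" "f = W x" by (elim imageE)
    show ?thesis unfolding x(2) S_diff_W[OF x(1)] norm_W[OF x(1)] norm_W[OF Lop_KK[OF x(1)]] by (rule C[OF x(1)])
  qed
  then show "\<mu> \<notin> op_spectrum M S"
    unfolding op_spectrum_def bij_betw_def inj_on_S_iff surj_S_iff using inj surj by blast
  show "\<mu> \<notin> continuous_spectrum M S" "\<not> eigen \<mu>"
    unfolding continuous_spectrum_def using inj surj by (auto simp: surj_S_iff)
qed

lemma eigen_spectra:
  assumes "eigen \<mu>"
  shows "\<mu> \<in> op_spectrum M S" "\<mu> \<notin> continuous_spectrum M S"
  using assms by (auto simp: op_spectrum_def continuous_spectrum_def bij_betw_def inj_on_S_iff)

lemma continuous_spectra:
  assumes "\<not> eigen \<mu>" "KK \<subseteq> closure (Lop \<mu> ` KK)" "Lop \<mu> ` KK \<noteq> KK"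
  shows "\<mu> \<in> op_spectrum M S" "\<mu> \<in> continuous_spectrum M S"
  using assms dense_S[OF assms(2)] by (auto simp: op_spectrum_def continuous_spectrum_def bij_betw_def inj_on_S_iff surj_S_iff)

lemma Delta_eq: "Delta \<theta> Ap Am \<mu> = DeltaM (inner_value \<theta> \<mu>)"
  by (simp add: Delta_def DeltaM_def)

lemma Delta_tilde_eq: "Delta_tilde \<theta> Ap Am \<mu> = DeltaM_ext (disc_ext \<theta> (1 / cnj \<mu>))"
  by (simp add: Delta_tilde_def DeltaM_ext_def)

lemma disc_cases:
  assumes "cmod \<mu> < 1"
  shows "Delta \<theta> Ap Am \<mu> = 0 \<Longrightarrow> eigen \<mu>" "Delta \<theta> Ap Am \<mu> \<noteq> 0 \<Longrightarrow> regular \<mu>"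
  using disc_eigen[OF assms] disc_regular[OF assms] assms by (simp_all add: Delta_eq inner_value_def)

lemma exterior_cases:
  assumes "cmod \<mu> > 1"
  shows "Delta_tilde \<theta> Ap Am \<mu> = 0 \<Longrightarrow> eigen \<mu>" "Delta_tilde \<theta> Ap Am \<mu> \<noteq> 0 \<Longrightarrow> regular \<mu>"
  unfolding Delta_tilde_eq by (rule exterior_eigen[OF assms], assumption) (rule exterior_regular[OF assms], assumption)

text \<open>On the circle, points without an angular derivative belong to the inner spectrum; this
  puts all of them into the continuous spectrum.\<close>

lemma circle_cases:
  assumes l: "cmod \<mu> = 1"
  shows "eigen \<mu> \<longleftrightarrow> \<mu> \<in> T_ADC \<theta> \<and> Delta \<theta> Ap Am \<mu> = 0"
    and "\<mu> \<notin> inner_spectrum \<theta> \<Longrightarrow> \<mu> \<in> T_ADC \<theta>"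
    and "\<not> eigen \<mu> \<Longrightarrow> \<mu> \<notin> inner_spectrum \<theta> \<Longrightarrow> regular \<mu>"
proof -
  show e: "eigen \<mu> \<longleftrightarrow> \<mu> \<in> T_ADC \<theta> \<and> Delta \<theta> Ap Am \<mu> = 0" using circle_eigen_iff[OF l] by (simp add: Delta_eq)
  show adc: "\<mu> \<in> T_ADC \<theta>" if "\<mu> \<notin> inner_spectrum \<theta>"
    using lower_estimate[OF l that] not_spectrum_imp_ADC[OF l] by blast
  show "regular \<mu>" if "\<not> eigen \<mu>" "\<mu> \<notin> inner_spectrum \<theta>"
    using boundary_regular[OF l that(2)] that(1) adc[OF that(2)] unfolding e Delta_eq by blast
qed

lemma T_ADC_circle: "\<mu> \<in> T_ADC \<theta> \<Longrightarrow> cmod \<mu> = 1" and inner_spectrum_circle: "\<mu> \<in> inner_spectrum \<theta> \<Longrightarrow> cmod \<mu> = 1"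
  by (auto simp: T_ADC_def inner_spectrum_def)

lemma op_spectrum_iff:
  "\<mu> \<in> op_spectrum M S \<longleftrightarrow> (norm \<mu> < 1 \<and> Delta \<theta> Ap Am \<mu> = 0) \<or> (norm \<mu> > 1 \<and> Delta_tilde \<theta> Ap Am \<mu> = 0)
     \<or> \<mu> \<in> sphere 0 1 \<inter> inner_spectrum \<theta> \<or> (\<mu> \<in> T_ADC \<theta> - inner_spectrum \<theta> \<and> Delta \<theta> Ap Am \<mu> = 0)"
proof (cases "cmod \<mu>" "1 :: real" rule: linorder_cases)
  case less
  then show ?thesis using disc_cases[OF less] regular_spectra eigen_spectra T_ADC_circle inner_spectrum_circle by fastforce
next
  case greater
  then show ?thesis using exterior_cases[OF greater] regular_spectra eigen_spectra T_ADC_circle inner_spectrum_circle by fastforce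
next
  case equal
  note cc = circle_cases[OF equal]
  show ?thesis
  proof (cases "eigen \<mu>")
    case True
    then show ?thesis using cc(1) eigen_spectra equal by auto
  next
    case False
    show ?thesis
    proof (cases "\<mu> \<in> inner_spectrum \<theta>")
      case True
      then show ?thesis
        using continuous_spectra(1)[OF False circle_dense[OF equal False] spectrum_not_surj[OF equal True]] equal by simp
    next
      case ns: False
      then show ?thesis using cc False regular_spectra(1) equal by auto
    qed
  qed
qed

lemma point_spectrum_eq:
  "point_spectrum M S = {\<mu>. norm \<mu> < 1 \<and> Delta \<theta> Ap Am \<mu> = 0} \<union> {\<mu>. norm \<mu> > 1 \<and> Delta_tilde \<theta> Ap Am \<mu> = 0}
     \<union> {\<mu> \<in> T_ADC \<theta>. Delta \<theta> Ap Am \<mu> = 0}"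
proof (rule set_eqI)
  fix \<mu>
  have "eigen \<mu> \<longleftrightarrow> (norm \<mu> < 1 \<and> Delta \<theta> Ap Am \<mu> = 0) \<or> (norm \<mu> > 1 \<and> Delta_tilde \<theta> Ap Am \<mu> = 0) \<or> (\<mu> \<in> T_ADC \<theta> \<and> Delta \<theta> Ap Am \<mu> = 0)"
  proof (cases "cmod \<mu>" "1 :: real" rule: linorder_cases)
    case less
    then show ?thesis using disc_cases[OF less] regular_spectra(3) T_ADC_circle by fastforce
  next
    case greater
    then show ?thesis using exterior_cases[OF greater] regular_spectra(3) T_ADC_circle by fastforce
  qed (use circle_cases(1) in auto)
  then show "\<mu> \<in> point_spectrum M S \<longleftrightarrow> \<mu> \<in> {\<mu>. norm \<mu> < 1 \<and> Delta \<theta> Ap Am \<mu> = 0} \<union> {\<mu>. norm \<mu> > 1 \<and> Delta_tilde \<theta> Ap Am \<mu> = 0}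
     \<union> {\<mu> \<in> T_ADC \<theta>. Delta \<theta> Ap Am \<mu> = 0}"
    by (auto simp: point_spectrum_iff)
qed

lemma continuous_spectrum_eq:
  "continuous_spectrum M S = (sphere 0 1 - T_ADC \<theta>) \<union> {\<mu> \<in> T_ADC \<theta> \<inter> inner_spectrum \<theta>. Delta \<theta> Ap Am \<mu> \<noteq> 0}"
proof (rule set_eqI)
  fix \<mu>
  show "\<mu> \<in> continuous_spectrum M S \<longleftrightarrow> \<mu> \<in> (sphere 0 1 - T_ADC \<theta>) \<union> {\<mu> \<in> T_ADC \<theta> \<inter> inner_spectrum \<theta>. Delta \<theta> Ap Am \<mu> \<noteq> 0}"
  proof (cases "cmod \<mu>" "1 :: real" rule: linorder_cases)
    case less
    then show ?thesis using disc_cases[OF less] regular_spectra(2) eigen_spectra(2) T_ADC_circle by fastforce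
  next
    case greater
    then show ?thesis using exterior_cases[OF greater] regular_spectra(2) eigen_spectra(2) T_ADC_circle by fastforce
  next
    case equal
    note cc = circle_cases[OF equal]
    show ?thesis
    proof (cases "eigen \<mu>")
      case True
      then show ?thesis using cc(1) eigen_spectra(2) by auto
    next
      case False
      show ?thesis
      proof (cases "\<mu> \<in> inner_spectrum \<theta>")
        case True
        then show ?thesis
          using continuous_spectra(2)[OF False circle_dense[OF equal False] spectrum_not_surj[OF equal True]] equal cc(1) False by auto
      next
        case ns: False
        then show ?thesis using cc False regular_spectra(2) by auto
      qed
    qed
  qed
qed

text \<open>Off the circle a point that is no eigenvalue is regular, and on it the range is
  dense.\<close>

lemma residual_spectrum_eq: "residual_spectrum M S = {}"
proof -
  have "\<not> eigen \<mu> \<Longrightarrow> M \<subseteq> closure ((\<lambda>f. S f - \<mu> *\<^sub>C f) ` M)" for \<mu>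
  proof (rule dense_S)
    assume ne: "\<not> eigen \<mu>"
    show "KK \<subseteq> closure (Lop \<mu> ` KK)"
    proof (cases "cmod \<mu> = 1")
      case True
      then show ?thesis by (rule circle_dense[OF _ ne])
    next
      case False
      then have "regular \<mu>" using disc_cases exterior_cases ne by (metis linorder_neqE_linordered_idom)
      then have "Lop \<mu> ` KK = KK" by (auto simp: regular_def bij_betw_def)
      then show ?thesis using closure_subset by metis
    qed
  qed
  then show ?thesis unfolding residual_spectrum_def inj_on_S_iff by blast
qed

end

theorem theorem6p17:
  fixes \<theta> \<phi> \<psi> Ap Am :: "complex \<Rightarrow> complex"
  assumes "inner_fun \<theta>"
    and "unimodular \<phi>" and "unimodular \<psi>"
    and "Ap \<in> Hinf" and "(\<lambda>z. cnj (Am z)) \<in> Hinf"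
    and "AE z in circle_measure. cnj (\<psi> z) * \<phi> z = Am z * cnj (\<theta> z) + Ap z * \<theta> z"
    and "\<not> (\<exists>c. AE z in circle_measure. \<phi> z * cnj (\<psi> z) = c * \<theta> z)"
    and "\<not> (\<exists>c. AE z in circle_measure. cnj (\<phi> z) * \<psi> z = c * \<theta> z)"
  shows "(\<forall>\<mu>. \<mu> \<in> op_spectrum (dual_band_space \<phi> \<psi> \<theta>) (compressed_shift (dual_band_space \<phi> \<psi> \<theta>))
            \<longleftrightarrow> (norm \<mu> < 1 \<and> Delta \<theta> Ap Am \<mu> = 0)
              \<or> (norm \<mu> > 1 \<and> Delta_tilde \<theta> Ap Am \<mu> = 0)
              \<or> \<mu> \<in> sphere 0 1 \<inter> inner_spectrum \<theta>
              \<or> (\<mu> \<in> T_ADC \<theta> - inner_spectrum \<theta> \<and> Delta \<theta> Ap Am \<mu> = 0))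
       \<and> point_spectrum (dual_band_space \<phi> \<psi> \<theta>) (compressed_shift (dual_band_space \<phi> \<psi> \<theta>))
          = {\<mu>. norm \<mu> < 1 \<and> Delta \<theta> Ap Am \<mu> = 0}
            \<union> {\<mu>. norm \<mu> > 1 \<and> Delta_tilde \<theta> Ap Am \<mu> = 0}
            \<union> {\<mu> \<in> T_ADC \<theta>. Delta \<theta> Ap Am \<mu> = 0}
       \<and> continuous_spectrum (dual_band_space \<phi> \<psi> \<theta>) (compressed_shift (dual_band_space \<phi> \<psi> \<theta>))
          = (sphere 0 1 - T_ADC \<theta>) \<union> {\<mu> \<in> T_ADC \<theta> \<inter> inner_spectrum \<theta>. Delta \<theta> Ap Am \<mu> \<noteq> 0}
       \<and> residual_spectrum (dual_band_space \<phi> \<psi> \<theta>) (compressed_shift (dual_band_space \<phi> \<psi> \<theta>)) = {}"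
proof -
  interpret dual_band \<theta> \<phi> \<psi> Ap Am
    using assms by unfold_locales
  show ?thesis
    by (intro conjI allI op_spectrum_iff point_spectrum_eq continuous_spectrum_eq residual_spectrum_eq)
qed

end
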